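(* Let $s\in(0,1)$ and let $u$ be a solution of $(-\Delta)^{s/2}u=u-u^3$ in $\mathbb{R}^2$ which is a minimizer of $\mathcal E$ in $\mathbb{R}^2$. Then $u$ is one-dimensional, i.e. there exist $\bar u:\mathbb{R}\to\mathbb{R}$ and $\bar\omega\in S^{1}$ with $u(x)=\bar u(\bar\omega\cdot x)$ for all $x\in\mathbb{R}^2$.
   Context: Here $(-\Delta)^{s/2}u(x):=\int_{\mathbb{R}^n}\frac{u(x)-u(x+y)}{|y|^{n+s}}\,dy$ (normalization constant dropped), with $n=2$. For a domain $\Omega\subset\mathbb{R}^n$, $\mathcal E(u,\Omega):=\mathcal E^{\rm Dir}(u,\Omega)+\int_\Omega(1-u^2(x))^2\,dx$, where $\mathcal E^{\rm Dir}(u,\Omega):=C_{n,s}\iint_{\mathbb{R}^{2n}\setminus(\mathbb{R}^n\setminus\Omega)^2}\frac{|u(x)-u(y)|^2}{|x-y|^{n+s}}\,dx\,dy$ for an appropriate constant $C_{n,s}>0$. A solution $u$ is a minimizer of $\mathcal E$ in $\mathbb{R}^n$ if $\mathcal E(u,B)\le\mathcal E(u+\varphi,B)$ for every ball $B\subset\mathbb{R}^n$ and every $\varphi\in C^\infty_0(B)$. *)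

theory Defs
  imports "HOL-Analysis.Analysis"
begin

coinductive smooth_fun :: "('a::euclidean_space \<Rightarrow> real) \<Rightarrow> bool" where
  "(\<forall>x. f differentiable (at x)) \<Longrightarrow>
   (\<forall>v. smooth_fun (\<lambda>x. frechet_derivative f (at x) v)) \<Longrightarrow> smooth_fun f"

definition Cinf0 :: "('a::euclidean_space) set \<Rightarrow> ('a \<Rightarrow> real) set" where
  "Cinf0 B = {\<phi>. smooth_fun \<phi> \<and> compact (closure {x. \<phi> x \<noteq> 0})
                  \<and> closure {x. \<phi> x \<noteq> 0} \<subseteq> B}"

text \<open>Fractional operator with the normalization constant dropped, n = 2.\<close>
definition frac_lap :: "real \<Rightarrow> (real^2 \<Rightarrow> real) \<Rightarrow> real^2 \<Rightarrow> real" where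
  "frac_lap s u x = (\<integral>y. (u x - u (x + y)) / norm y powr (2 + s) \<partial>lborel)"

definition is_solution :: "real \<Rightarrow> (real^2 \<Rightarrow> real) \<Rightarrow> bool" where
  "is_solution s u \<longleftrightarrow>
     (\<forall>x. integrable lborel (\<lambda>y. (u x - u (x + y)) / norm y powr (2 + s))
          \<and> frac_lap s u x = u x - (u x) ^ 3)"

text \<open>Dirichlet part of the energy, with C_{n,s} = 1 (the constant for which the
Euler--Lagrange equation is exactly the equation above with constant dropped).\<close>
definition E_Dir :: "real \<Rightarrow> (real^2 \<Rightarrow> real) \<Rightarrow> (real^2) set \<Rightarrow> ennreal" where
  "E_Dir s u \<Omega> = (\<integral>\<^sup>+ p. indicator (UNIV - (- \<Omega>) \<times> (- \<Omega>)) p *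
        ennreal (\<bar>u (fst p) - u (snd p)\<bar>\<^sup>2 / norm (fst p - snd p) powr (2 + s))
      \<partial>(lborel \<Otimes>\<^sub>M lborel))"

definition E_energy :: "real \<Rightarrow> (real^2 \<Rightarrow> real) \<Rightarrow> (real^2) set \<Rightarrow> ennreal" where
  "E_energy s u \<Omega> = E_Dir s u \<Omega> +
      (\<integral>\<^sup>+ x. indicator \<Omega> x * ennreal ((1 - (u x)\<^sup>2)\<^sup>2) \<partial>lborel)"

definition is_minimizer :: "real \<Rightarrow> (real^2 \<Rightarrow> real) \<Rightarrow> bool" where
  "is_minimizer s u \<longleftrightarrow>
     (\<forall>c r \<phi>. \<phi> \<in> Cinf0 (ball c r) \<longrightarrow>
        E_energy s u (ball c r) \<le> E_energy s (\<lambda>x. u x + \<phi> x) (ball c r))"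

end

theory Submission
  imports Defs
begin

text \<open>
  A domain displacement \<open>\<tau> x = x + \<Phi> x *\<^sub>R h\<close> and its mirror image change the energy of the minimizer, in
  the sum of both, only to second order in the gradient of \<open>\<Phi>\<close>. The energy in a ball of radius
  \<open>R\<close> is \<open>O(R\<^sup>2)\<close>, so averaging cutoffs over \<open>N\<close> dyadic scales makes this change \<open>O(1 / N)\<close>. Replacing
  \<open>u\<close> and the displaced function \<open>v\<close> by their minimum and maximum gains the double integral of
  \<open>2 (v - u)\<^sup>+(x) (v - u)\<^sup>-(y) / \<bar>x - y\<bar>\<^bsup>2+s\<^esup>\<close>, which therefore vanishes for the translate \<open>v x = u (x - h)\<close>:
  \<open>u\<close> is monotone in every direction, hence one-dimensional in the plane.

  Minimality says nothing as long as the energy may be infinite, so the bounds \<open>\<bar>u\<bar> \<le> 1\<close> and \<open>O(R\<^sup>2)\<close>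
  have to come from the equation, tested for \<open>(\<bar>u\<bar> - 1)\<^sup>+\<close> and for \<open>u\<^sup>2\<close> against
  \<open>(1 + \<bar>x\<bar> / R)\<^bsup>-2-s\<^esup>\<close>. Since the equation only holds pointwise, with an absolutely
  convergent integral at each point but no uniformity, a Baire category argument is needed to see
  that pointwise inequalities hold weakly.
\<close>

text \<open>The kernel is positive at every distance, so the vanishing double integral couples all
  pairs of points, and the positive and negative parts of \<open>u (x - h) - u x\<close> integrate
  to a product: one of them is zero on the whole plane.

  The minimum and maximum of \<open>u\<close> and a displaced copy are only as regular as
  \<open>u\<close>, while minimality is given for smooth compactly supported perturbations. It is
  extended to rough competitors because mollification does not increase the Dirichlet energy, and
  convergence without loss of norm is strong convergence.

  The plane is the critical case: a cutoff at scale \<open>R\<close> has squared gradient of order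
  \<open>1 / R^2\<close> on a region of energy \<open>R^2\<close>, so a single scale leaves an error
  that is bounded but does not decay.

  For \<open>s < 1\<close> a Lipschitz function with decay has an absolutely convergent fractional
  Laplacian. Test functions are therefore Lipschitz, with the decay
  \<open>\<bar>x\<bar>^(-2-s)\<close> that the operator itself produces.

  At the end, connectedness of circles turns monotonicity in every direction into arbitrarily short
  periods; a limit of their directions is a line of invariance.\<close>

lemma nn_integral_affine:
  fixes f :: "'a::euclidean_space \<Rightarrow> ennreal"
  assumes [measurable]: "f \<in> borel_measurable borel" and c: "c \<noteq> 0"
  shows "(\<integral>\<^sup>+x. f x \<partial>lborel) = ennreal (\<bar>c\<bar> ^ DIM('a)) * (\<integral>\<^sup>+x. f (t + c *\<^sub>R x) \<partial>lborel)"
  by (subst lborel_affine[OF c, of t]) (simp add: nn_integral_density nn_integral_distr nn_integral_cmult)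

lemma integral_affine:
  fixes f :: "'a::euclidean_space \<Rightarrow> real"
  assumes [measurable]: "f \<in> borel_measurable borel" and c: "c \<noteq> 0"
  shows "(\<integral>x. f x \<partial>lborel) = \<bar>c\<bar> ^ DIM('a) * (\<integral>x. f (t + c *\<^sub>R x) \<partial>lborel)"
  by (subst lborel_affine[OF c, of t]) (simp add: integral_density integral_distr)

lemma integrable_affine_iff:
  fixes f :: "'a::euclidean_space \<Rightarrow> real"
  assumes [measurable]: "f \<in> borel_measurable borel" and c: "c \<noteq> 0"
  shows "integrable lborel (\<lambda>x. f (t + c *\<^sub>R x)) \<longleftrightarrow> integrable lborel f"
proof -
  have "(\<integral>\<^sup>+x. ennreal (norm (f x)) \<partial>lborel) =
      ennreal (\<bar>c\<bar> ^ DIM('a)) * (\<integral>\<^sup>+x. ennreal (norm (f (t + c *\<^sub>R x))) \<partial>lborel)"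
    using c by (intro nn_integral_affine) auto
  moreover have "0 < \<bar>c\<bar> ^ DIM('a)" using c by simp
  ultimately show ?thesis
    using c by (auto simp: integrable_iff_bounded ennreal_mult_less_top ennreal_zero_less_mult_iff)
qed

lemma nn_integral_translate:
  fixes f :: "'a::euclidean_space \<Rightarrow> ennreal"
  assumes "f \<in> borel_measurable borel"
  shows "(\<integral>\<^sup>+x. f (t + x) \<partial>lborel) = (\<integral>\<^sup>+x. f x \<partial>lborel)"
  using nn_integral_affine[OF assms, of 1 t] by simp

lemma integral_translate:
  fixes f :: "'a::euclidean_space \<Rightarrow> real"
  assumes "f \<in> borel_measurable borel"
  shows "(\<integral>x. f (t + x) \<partial>lborel) = (\<integral>x. f x \<partial>lborel)"
  using integral_affine[OF assms, of 1 t] by simp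

lemma integrable_translate:
  fixes f :: "'a::euclidean_space \<Rightarrow> real"
  assumes "f \<in> borel_measurable borel"
  shows "integrable lborel (\<lambda>x. f (t + x)) \<longleftrightarrow> integrable lborel f"
  using integrable_affine_iff[OF assms, of 1 t] by simp

lemma cball_measurable [measurable]: "cball (x :: 'a::euclidean_space) r \<in> sets borel" by auto
lemma ball_measurable [measurable]: "ball (x :: 'a::euclidean_space) r \<in> sets borel" by auto

lemma emeasure_cball_plane:
  fixes c :: "real^2"
  assumes "0 \<le> r"
  shows "emeasure lborel (cball c r) = ennreal (pi * r\<^sup>2)"
    and "emeasure lborel (ball c r) = ennreal (pi * r\<^sup>2)"
  using assms by (simp_all add: emeasure_cball emeasure_ball unit_ball_vol_2)

lemma ex_dyadic:
  fixes x :: real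
  assumes "1 \<le> x"
  shows "\<exists>k. 2 ^ k \<le> x \<and> x < 2 ^ Suc k"
proof -
  obtain n where n: "x < 2 ^ n" using real_arch_pow[of 2 x] by auto
  define k where "k = (LEAST n. x < 2 ^ n)"
  have k: "x < 2 ^ k" unfolding k_def by (rule LeastI[of _ n]) (rule n)
  have "k \<noteq> 0" using k assms by (intro notI) auto
  then obtain j where j: "k = Suc j" by (cases k) auto
  have "\<not> x < 2 ^ j" using not_less_Least[of j "\<lambda>n. x < 2 ^ n"] j unfolding k_def by auto
  then show ?thesis using k j by (intro exI[of _ j]) auto
qed

section \<open>The kernel, the decay weight and their integrability\<close>

locale fractional_order =
  fixes s :: real
  assumes s0: "0 < s" and s1: "s < 1"
begin

definition K :: "real^2 \<Rightarrow> real" where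
  "K y = 1 / norm y powr (2 + s)"

text \<open>This is the decay that the nonlocal operator produces even from compactly supported test
  functions. Regular functions are integrable against it, so it measures test functions and their
  images alike.\<close>

definition w :: "real^2 \<Rightarrow> real" where
  "w x = 1 / (1 + norm x) powr (2 + s)"

definition m :: "real^2 \<Rightarrow> real" where
  "m y = min (norm y) 1 * K y"

lemma K_nonneg [simp]: "0 \<le> K y" by (simp add: K_def)
lemma K_pos: "y \<noteq> 0 \<Longrightarrow> 0 < K y" by (simp add: K_def)
lemma K_0 [simp]: "K 0 = 0" by (simp add: K_def)
lemma K_uminus [simp]: "K (- y) = K y" by (simp add: K_def)
lemma K_minus: "K (x - y) = K (y - x)" by (simp add: K_def norm_minus_commute)
lemma K_measurable [measurable]: "K \<in> borel_measurable borel" unfolding K_def by measurable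
lemma w_measurable [measurable]: "w \<in> borel_measurable borel" unfolding w_def by measurable
lemma m_measurable [measurable]: "m \<in> borel_measurable borel" unfolding m_def by measurable
lemma w_pos: "0 < w x"
proof -
  have "1 + norm x > 0" by (smt (verit) norm_ge_zero)
  then show ?thesis by (simp add: w_def)
qed
lemma w_nonneg [simp]: "0 \<le> w x" using w_pos[of x] by simp
lemma w_le_1: "w x \<le> 1"
proof -
  have "(1::real) \<le> (1 + norm x) powr (2 + s)" using s0 by (intro ge_one_powr_ge_zero) auto
  then show ?thesis unfolding w_def by (simp add: divide_le_eq)
qed
lemma m_nonneg [simp]: "0 \<le> m y" by (simp add: m_def)

lemma K_mono: "x \<noteq> 0 \<Longrightarrow> norm x \<le> norm y \<Longrightarrow> K y \<le> K x"
  unfolding K_def using s0 by (intro divide_left_mono powr_mono2 mult_pos_pos) auto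

lemma K_scale: "r > 0 \<Longrightarrow> K (r *\<^sub>R y) = K y / r powr (2 + s)"
  by (simp add: K_def powr_mult)

lemma w_le_K: "y \<noteq> 0 \<Longrightarrow> w y \<le> K y"
  unfolding K_def w_def using s0 
  by (intro divide_left_mono powr_mono2 mult_pos_pos) (auto simp: add_pos_nonneg add_nonneg_eq_0_iff)

lemma m_far: "1 \<le> norm y \<Longrightarrow> m y = K y" by (simp add: m_def)

lemma m_near: "y \<noteq> 0 \<Longrightarrow> norm y \<le> 1 \<Longrightarrow> m y = 1 / norm y powr (1 + s)"
proof -
  assume y: "y \<noteq> 0" "norm y \<le> 1"
  have "norm y powr (2 + s) = norm y powr 1 * norm y powr (1 + s)"
    by (subst powr_add[symmetric]) simp
  also have "\<dots> = norm y * norm y powr (1 + s)" using y by simp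
  finally show ?thesis using y by (simp add: m_def K_def)
qed

lemma w_le_m: "y \<noteq> 0 \<Longrightarrow> w y \<le> m y"
proof (cases "norm y \<le> 1")
  case True
  assume y: "y \<noteq> 0"
  have "norm y powr (1 + s) \<le> 1" using True s0 by (intro powr_le1) auto
  then have "1 \<le> m y" using y True by (simp add: m_near)
  with w_le_1[of y] show ?thesis by simp
qed (use w_le_K in \<open>simp add: m_far\<close>)

text \<open>Dyadic covering: near the origin the value is at most \<open>q ^ Suc k\<close> on a disc
  of area of order \<open>1 / 4 ^ k\<close>, at infinity at most \<open>1 / p ^ k\<close> on a disc
  of area of order \<open>4 ^ k\<close>. The two geometric series converge because
  \<open>q < 4\<close>, which is \<open>s < 1\<close>, and \<open>4 < p\<close>, which is
  \<open>0 < s\<close>.\<close>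

lemma nn_integral_m: "(\<integral>\<^sup>+y. ennreal (m y) \<partial>lborel) < \<infinity>"
proof -
  define q where "q = 2 powr (1 + s)"
  define p where "p = 2 powr (2 + s)"
  have q: "0 < q" "q < 4"
  proof -
    have "2 powr (1 + s) < 2 powr (2::real)" using s1 by (intro powr_less_mono) auto
    then show "0 < q" "q < 4" by (auto simp: q_def)
  qed
  have p: "4 < p"
  proof -
    have "2 powr (2::real) < 2 powr (2 + s)" using s0 by (intro powr_less_mono) auto
    then show ?thesis by (auto simp: p_def)
  qed
  have pw: "(2 ^ k) powr a = (2 powr a) ^ k" for k :: nat and a :: real
    by (simp add: powr_realpow[symmetric] powr_powr mult.commute)
  let ?A = "\<lambda>k. cball (0::real^2) (1 / 2 ^ k)"
  let ?B = "\<lambda>k. cball (0::real^2) (2 ^ Suc k)"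
  define F where "F k y = ennreal (q ^ Suc k) * indicator (?A k) y + ennreal (1 / p ^ k) * indicator (?B k) y" for k and y :: "real^2"
  have le: "ennreal (m y) \<le> (\<Sum>k. F k y)" for y
  proof -
    have "\<exists>k. ennreal (m y) \<le> F k y"
    proof (cases "y = 0")
      case True then show ?thesis by (simp add: m_def)
    next
      case y: False
      show ?thesis
      proof (cases "norm y \<le> 1")
        case True
        then obtain k where k: "2 ^ k \<le> 1 / norm y" "1 / norm y < 2 ^ Suc k"
          using ex_dyadic[of "1 / norm y"] y by auto
        have "m y = (1 / norm y) powr (1 + s)" using True y by (simp add: m_near powr_divide)
        also have "\<dots> \<le> (2 ^ Suc k) powr (1 + s)" using k s0 by (intro powr_mono2) auto
        also have "\<dots> = q ^ Suc k" by (simp only: pw q_def)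
        finally have "m y \<le> q ^ Suc k" .
        moreover have "y \<in> ?A k" using k y by (simp add: field_simps)
        ultimately have "ennreal (m y) \<le> ennreal (q ^ Suc k) * indicator (?A k) y"
          by (simp del: power_Suc add: ennreal_leI)
        also have "\<dots> \<le> F k y" by (simp add: F_def)
        finally show ?thesis by blast
      next
        case False
        then obtain k where k: "2 ^ k \<le> norm y" "norm y < 2 ^ Suc k"
          using ex_dyadic[of "norm y"] by auto
        have "m y = 1 / norm y powr (2 + s)" using False by (simp add: m_far K_def)
        also have "\<dots> \<le> 1 / (2 ^ k) powr (2 + s)" using k s0 y by (intro divide_left_mono powr_mono2 mult_pos_pos) auto
        also have "\<dots> = 1 / p ^ k" by (simp only: pw p_def)
        finally have "m y \<le> 1 / p ^ k" .
        moreover have "y \<in> ?B k" using k by simp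
        ultimately have "ennreal (m y) \<le> ennreal (1 / p ^ k) * indicator (?B k) y"
          by (simp del: power_Suc add: ennreal_leI)
        also have "\<dots> \<le> F k y" by (simp add: F_def)
        finally show ?thesis by blast
      qed
    qed
    then obtain k where "ennreal (m y) \<le> F k y" by blast
    also have "F k y = (\<Sum>i\<in>{k}. F i y)" by simp
    also have "\<dots> \<le> (\<Sum>k. F k y)" by (rule sum_le_suminf) auto
    finally show ?thesis .
  qed
  have int: "(\<integral>\<^sup>+y. F k y \<partial>lborel) = ennreal (pi * q * (q / 4) ^ k + 4 * pi * (4 / p) ^ k)" for k
  proof -
    have "(\<integral>\<^sup>+y. F k y \<partial>lborel) = ennreal (q ^ Suc k) * emeasure lborel (?A k) + ennreal (1 / p ^ k) * emeasure lborel (?B k)"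
      unfolding F_def
      by (subst nn_integral_add) (auto simp: nn_integral_cmult_indicator simp del: power_Suc)
    also have "\<dots> = ennreal (q ^ Suc k * (pi * (1 / 2 ^ k)\<^sup>2)) + ennreal (1 / p ^ k * (pi * (2 ^ Suc k)\<^sup>2))"
      using q p by (simp only: emeasure_cball_plane ennreal_mult[symmetric] zero_le_power zero_le_divide_1_iff
          zero_le_numeral less_imp_le mult_nonneg_nonneg pi_ge_zero power_mult_distrib)
    also have "\<dots> = ennreal (q ^ Suc k * (pi * (1 / 2 ^ k)\<^sup>2) + 1 / p ^ k * (pi * (2 ^ Suc k)\<^sup>2))"
      using q p by (simp add: ennreal_plus[symmetric] del: ennreal_plus)
    also have "q ^ Suc k * (pi * (1 / 2 ^ k)\<^sup>2) + 1 / p ^ k * (pi * (2 ^ Suc k)\<^sup>2) = pi * q * (q / 4) ^ k + 4 * pi * (4 / p) ^ k"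
    proof -
      have "(2 ^ k)\<^sup>2 = (2\<^sup>2 :: real) ^ k" by (simp only: power_mult[symmetric] mult.commute)
      then have "(2 ^ k)\<^sup>2 = (4::real) ^ k" by simp
      then show ?thesis by (simp add: power_mult_distrib power_divide field_simps)
    qed
    finally show ?thesis .
  qed
  have "(\<integral>\<^sup>+y. ennreal (m y) \<partial>lborel) \<le> (\<integral>\<^sup>+y. (\<Sum>k. F k y) \<partial>lborel)"
    by (intro nn_integral_mono le)
  also have "\<dots> = (\<Sum>k. \<integral>\<^sup>+y. F k y \<partial>lborel)"
    unfolding F_def by (intro nn_integral_suminf) measurable
  also have "\<dots> = (\<Sum>k. ennreal (pi * q * (q / 4) ^ k + 4 * pi * (4 / p) ^ k))" by (simp add: int)
  also have "\<dots> = ennreal (\<Sum>k. pi * q * (q / 4) ^ k + 4 * pi * (4 / p) ^ k)"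
    using q p by (intro suminf_ennreal2 summable_add summable_mult summable_geometric) auto
  also have "\<dots> < \<infinity>" by simp
  finally show ?thesis .
qed

lemma integrable_m: "integrable lborel m"
  using nn_integral_m by (intro integrableI_nonneg) auto

lemma AE_nonzero: "AE y in lborel. (y::real^2) \<noteq> a"
  by (rule AE_lborel_singleton)

lemma integrable_w: "integrable lborel w"
proof (rule Bochner_Integration.integrable_bound[OF integrable_m])
  show "AE x in lborel. norm (w x) \<le> norm (m x)"
    using AE_nonzero[of 0] by eventually_elim (simp add: w_le_m)
qed simp

lemma w_translate: "w (x + y) \<le> (1 + norm y) powr (2 + s) * w x"
proof -
  have "1 + norm x \<le> 1 + norm y + norm (x + y)"
    using norm_triangle_ineq4[of "x + y" y] by simp
  also have "\<dots> \<le> (1 + norm y) * (1 + norm (x + y))" by (simp add: algebra_simps)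
  finally have "(1 + norm x) powr (2 + s) \<le> ((1 + norm y) * (1 + norm (x + y))) powr (2 + s)"
    using s0 by (intro powr_mono2) auto
  also have "\<dots> = (1 + norm y) powr (2 + s) * (1 + norm (x + y)) powr (2 + s)"
    by (simp add: powr_mult)
  finally show ?thesis
    unfolding w_def by (simp add: divide_simps add_pos_nonneg add_nonneg_eq_0_iff mult.commute)
qed

lemma two_powr_le: "2 powr (2 + s) \<le> 8"
proof -
  have "2 powr (2 + s) \<le> 2 powr (3::real)" using s1 by (intro powr_mono) auto
  then show ?thesis by simp
qed

lemma w_near: "norm y \<le> 1 \<Longrightarrow> w (x + y) \<le> 8 * w x"
proof -
  assume "norm y \<le> 1"
  then have "(1 + norm y) powr (2 + s) \<le> 2 powr (2 + s)" using s0 by (intro powr_mono2) auto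
  with two_powr_le have "(1 + norm y) powr (2 + s) * w x \<le> 8 * w x" by (intro mult_right_mono) auto
  with w_translate[of x y] show ?thesis by simp
qed

lemma w_half: "2 * a \<ge> 1 + norm x \<Longrightarrow> a > 0 \<Longrightarrow> 1 / a powr (2 + s) \<le> 8 * w x"
proof -
  assume a: "2 * a \<ge> 1 + norm x" "a > 0"
  have "(1 + norm x) powr (2 + s) \<le> (2 * a) powr (2 + s)" using a s0 by (intro powr_mono2) auto
  also have "\<dots> = 2 powr (2 + s) * a powr (2 + s)" using a by (simp add: powr_mult)
  also have "\<dots> \<le> 8 * a powr (2 + s)" using two_powr_le by (intro mult_right_mono) auto
  finally show ?thesis using a
    unfolding w_def by (simp add: divide_simps add_pos_nonneg add_nonneg_eq_0_iff mult.commute)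
qed

text \<open>One of \<open>1 + norm (x + y)\<close> and \<open>norm y\<close> is at least half of
  \<open>1 + norm x\<close>, so one factor is already at most \<open>8 * w x\<close>, and the other
  is kept because it is integrable in \<open>y\<close>. The 8 bounds
  \<open>2 powr (2 + s)\<close>.\<close>

lemma w_K_product: "1 \<le> norm y \<Longrightarrow> w (x + y) * K y \<le> 8 * w x * (w (x + y) + K y)"
proof -
  assume y: "1 \<le> norm y"
  have tri: "1 + norm x \<le> (1 + norm (x + y)) + norm y"
    using norm_triangle_ineq4[of "x + y" y] by simp
  show ?thesis
  proof (cases "norm y \<le> 1 + norm (x + y)")
    case True
    then have "w (x + y) \<le> 8 * w x" using tri unfolding w_def[of "x + y"] by (intro w_half) (auto simp: add_pos_nonneg)
    then have "w (x + y) * K y \<le> 8 * w x * K y" by (intro mult_right_mono) auto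
    also have "\<dots> \<le> 8 * w x * (w (x + y) + K y)" by (intro mult_left_mono) auto
    finally show ?thesis .
  next
    case False
    then have "K y \<le> 8 * w x" using tri y unfolding K_def by (intro w_half) auto
    then have "w (x + y) * K y \<le> w (x + y) * (8 * w x)" by (intro mult_left_mono) auto
    also have "\<dots> \<le> 8 * w x * (w (x + y) + K y)" by (simp add: algebra_simps)
    finally show ?thesis .
  qed
qed

subsection \<open>Test functions\<close>

text \<open>The constant is part of the predicate because limits are taken along families of test
  functions with one common majorant. The Lipschitz clause also carries the factor
  \<open>w x\<close>, so that short increments decay like the function itself.\<close>

definition tame :: "real \<Rightarrow> (real^2 \<Rightarrow> real) \<Rightarrow> bool" where
  "tame A \<eta> \<longleftrightarrow> \<eta> \<in> borel_measurable borel \<and> (\<forall>x. \<bar>\<eta> x\<bar> \<le> A * w x) \<and>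
     (\<forall>x y. norm y \<le> 1 \<longrightarrow> \<bar>\<eta> x - \<eta> (x + y)\<bar> \<le> A * w x * norm y)"

lemma tameD:
  assumes "tame A \<eta>"
  shows "\<eta> \<in> borel_measurable borel" "\<bar>\<eta> x\<bar> \<le> A * w x"
    "norm y \<le> 1 \<Longrightarrow> \<bar>\<eta> x - \<eta> (x + y)\<bar> \<le> A * w x * norm y" "0 \<le> A"
proof -
  show "\<eta> \<in> borel_measurable borel" "\<bar>\<eta> x\<bar> \<le> A * w x" 
    "norm y \<le> 1 \<Longrightarrow> \<bar>\<eta> x - \<eta> (x + y)\<bar> \<le> A * w x * norm y" using assms by (auto simp: tame_def)
  have "0 \<le> A * w x" using \<open>\<bar>\<eta> x\<bar> \<le> A * w x\<close> by linarith
  then show "0 \<le> A" using w_pos[of x] by (simp add: zero_le_mult_iff)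
qed

text \<open>Short increments use the Lipschitz clause and give \<open>m\<close>; long ones use the
  decay of both values, with \<open>w_K_product\<close> for the term in \<open>w (x + y)\<close>. By
  translation invariance the right side integrates in \<open>y\<close> to a constant times
  \<open>w x\<close>.\<close>

lemma tame_kernel_bound:
  assumes "tame A \<eta>"
  shows "\<bar>\<eta> x - \<eta> (x + y)\<bar> * K y \<le> A * w x * (9 * m y + 8 * w (x + y))"
proof (cases "norm y \<le> 1")
  case True
  have "\<bar>\<eta> x - \<eta> (x + y)\<bar> * K y \<le> A * w x * norm y * K y"
    using tameD(3)[OF assms True] by (intro mult_right_mono) auto
  also have "\<dots> = A * w x * m y" using True by (simp add: m_def)
  also have "\<dots> \<le> A * w x * (9 * m y + 8 * w (x + y))"
    using tameD(4)[OF assms] by (intro mult_left_mono) (auto simp: add_nonneg_nonneg)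
  finally show ?thesis .
next
  case False
  have A: "0 \<le> A" by (rule tameD(4)[OF assms])
  have "\<bar>\<eta> x - \<eta> (x + y)\<bar> * K y \<le> (A * w x + A * w (x + y)) * K y"
    using tameD(2)[OF assms, of x] tameD(2)[OF assms, of "x + y"] by (intro mult_right_mono) auto
  also have "\<dots> = A * w x * K y + A * (w (x + y) * K y)" by (simp add: algebra_simps)
  also have "\<dots> \<le> A * w x * K y + A * (8 * w x * (w (x + y) + K y))"
    using A False by (intro add_left_mono mult_left_mono w_K_product) auto
  also have "\<dots> = A * w x * (9 * m y + 8 * w (x + y))" using False by (simp add: m_far algebra_simps)
  finally show ?thesis .
qed

definition cL :: real where "cL = (\<integral>y. 9 * m y \<partial>lborel) + (\<integral>y. 8 * w y \<partial>lborel)"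

lemma integrable_kernel_majorant: "integrable lborel (\<lambda>y. c * (9 * m y + 8 * w (x + y)))"
  using integrable_w integrable_m by (auto simp: integrable_translate)

lemma integral_kernel_majorant: "(\<integral>y. c * (9 * m y + 8 * w (x + y)) \<partial>lborel) = c * cL"
  using integrable_w integrable_m 
  by (simp add: integrable_translate integral_translate cL_def)

lemma cL_nonneg: "0 \<le> cL" unfolding cL_def by (intro add_nonneg_nonneg integral_nonneg_AE) auto

lemma tame_integrable:
  assumes "tame A \<eta>"
  shows "integrable lborel (\<lambda>y. (\<eta> x - \<eta> (x + y)) * K y)"
proof (rule Bochner_Integration.integrable_bound[OF integrable_kernel_majorant[of "A * w x" x]])
  have [measurable]: "\<eta> \<in> borel_measurable borel" by (rule tameD[OF assms])
  show "(\<lambda>y. (\<eta> x - \<eta> (x + y)) * K y) \<in> borel_measurable lborel" by measurable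
  show "AE y in lborel. norm ((\<eta> x - \<eta> (x + y)) * K y) \<le> norm (A * w x * (9 * m y + 8 * w (x + y)))"
    using tame_kernel_bound[OF assms, of x] tameD(4)[OF assms]
    by (intro AE_I2) (simp add: abs_mult add_nonneg_nonneg)
qed

lemma frac_lap_K: "frac_lap s v x = (\<integral>y. (v x - v (x + y)) * K y \<partial>lborel)"
  by (simp add: frac_lap_def K_def)

lemma tame_frac_lap:
  assumes "tame A \<eta>"
  shows "\<bar>frac_lap s \<eta> x\<bar> \<le> A * cL * w x"
proof -
  have "\<bar>frac_lap s \<eta> x\<bar> \<le> (\<integral>y. \<bar>(\<eta> x - \<eta> (x + y)) * K y\<bar> \<partial>lborel)"
    unfolding frac_lap_K by (rule integral_abs_bound)
  also have "\<dots> \<le> (\<integral>y. A * w x * (9 * m y + 8 * w (x + y)) \<partial>lborel)"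
    by (intro integral_mono integrable_abs tame_integrable[OF assms] integrable_kernel_majorant)
       (simp add: abs_mult tame_kernel_bound[OF assms])
  also have "\<dots> = A * cL * w x" by (simp only: integral_kernel_majorant) (simp add: mult_ac)
  finally show ?thesis .
qed

lemma frac_lap_measurable [measurable]:
  assumes [measurable]: "\<eta> \<in> borel_measurable borel"
  shows "frac_lap s \<eta> \<in> borel_measurable borel"
  unfolding frac_lap_K[abs_def] by measurable

lemma tame_limit:
  assumes \<eta>: "\<And>n::nat. tame A (\<eta> n)" and lim: "\<And>x. (\<lambda>n. \<eta> n x) \<longlonglongrightarrow> \<eta>' x"
  shows "(\<lambda>n. frac_lap s (\<eta> n) x) \<longlonglongrightarrow> frac_lap s \<eta>' x"
  unfolding frac_lap_K
proof (rule integral_dominated_convergence[OF _ _ integrable_kernel_majorant[of "A * w x" x]])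
  have [measurable]: "\<eta> n \<in> borel_measurable borel" for n by (rule tameD[OF \<eta>])
  have [measurable]: "\<eta>' \<in> borel_measurable borel" 
    by (rule borel_measurable_LIMSEQ_real[OF lim]) auto
  show "(\<lambda>y. (\<eta>' x - \<eta>' (x + y)) * K y) \<in> borel_measurable lborel" by measurable
  show "(\<lambda>y. (\<eta> n x - \<eta> n (x + y)) * K y) \<in> borel_measurable lborel" for n by measurable
  show "AE y in lborel. (\<lambda>n. (\<eta> n x - \<eta> n (x + y)) * K y) \<longlonglongrightarrow> (\<eta>' x - \<eta>' (x + y)) * K y"
    by (intro AE_I2 tendsto_intros lim)
  show "AE y in lborel. norm ((\<eta> n x - \<eta> n (x + y)) * K y) \<le> A * w x * (9 * m y + 8 * w (x + y))" for n
    using tame_kernel_bound[OF \<eta>[of n], of x] by (intro AE_I2) (simp add: abs_mult)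
qed

subsection \<open>Regular functions\<close>

text \<open>The absolute version of the operator, valued in \<open>ennreal\<close> so that Fatou's
  lemma applies to it before finiteness is known.\<close>

definition enosc :: "(real^2 \<Rightarrow> real) \<Rightarrow> real^2 \<Rightarrow> ennreal" where
  "enosc v x = (\<integral>\<^sup>+z. ennreal (\<bar>v x - v z\<bar> * K (z - x)) \<partial>lborel)"

text \<open>
  Pointwise solutions are regular in this sense, with no bound on \<^term>\<open>enosc v\<close> that is uniform in the point.
\<close>

definition regular :: "(real^2 \<Rightarrow> real) \<Rightarrow> bool" where
  "regular v \<longleftrightarrow> v \<in> borel_measurable borel \<and> (\<forall>x. enosc v x < \<infinity>)"

definition nosc :: "(real^2 \<Rightarrow> real) \<Rightarrow> real^2 \<Rightarrow> real" where
  "nosc v x = enn2real (enosc v x)"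

lemma regular_measurable: "regular v \<Longrightarrow> v \<in> borel_measurable borel"
  by (simp add: regular_def)

lemma nosc_nonneg [simp]: "0 \<le> nosc v x" by (simp add: nosc_def)

lemma enosc_eq: "regular v \<Longrightarrow> enosc v x = ennreal (nosc v x)"
  by (simp add: regular_def nosc_def)

lemma enosc_shift:
  assumes [measurable]: "v \<in> borel_measurable borel"
  shows "enosc v x = (\<integral>\<^sup>+y. ennreal (\<bar>v x - v (x + y)\<bar> * K y) \<partial>lborel)"
  unfolding enosc_def by (subst nn_integral_translate[of _ x, symmetric]) auto

lemma regular_integrable:
  assumes "regular v"
  shows "integrable lborel (\<lambda>y. (v x - v (x + y)) * K y)"
proof -
  have [measurable]: "v \<in> borel_measurable borel" by (rule regular_measurable[OF assms])
  have "enosc v x < \<infinity>" using assms by (simp add: regular_def)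
  then show ?thesis
    by (intro integrableI_bounded) (auto simp: enosc_shift abs_mult)
qed

lemma regular_integrable':
  assumes "regular v"
  shows "integrable lborel (\<lambda>z. \<bar>v x - v z\<bar> * K (z - x))"
    and "(\<integral>z. \<bar>v x - v z\<bar> * K (z - x) \<partial>lborel) = nosc v x"
proof -
  have [measurable]: "v \<in> borel_measurable borel" by (rule regular_measurable[OF assms])
  have "enosc v x < \<infinity>" using assms by (simp add: regular_def)
  then show "integrable lborel (\<lambda>z. \<bar>v x - v z\<bar> * K (z - x))"
    by (intro integrableI_bounded) (auto simp: enosc_def abs_mult)
  show "(\<integral>z. \<bar>v x - v z\<bar> * K (z - x) \<partial>lborel) = nosc v x"
    by (subst integral_eq_nn_integral) (auto simp: nosc_def enosc_def)
qed

text \<open>Supplies the closure properties used later: differences, truncations, minima and maxima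
  are Lipschitz in their ingredients.\<close>

lemma regular_dom:
  assumes [measurable]: "f \<in> borel_measurable borel" and "regular v" "regular v'" and "0 \<le> c"
    and le: "\<And>x z. \<bar>f x - f z\<bar> \<le> c * (\<bar>v x - v z\<bar> + \<bar>v' x - v' z\<bar>)"
  shows "regular f"
proof -
  have "enosc f x < \<infinity>" for x
  proof -
    have [measurable]: "v \<in> borel_measurable borel" "v' \<in> borel_measurable borel"
      by (rule regular_measurable, fact)+
    have "enosc f x \<le> (\<integral>\<^sup>+z. ennreal c * (ennreal (\<bar>v x - v z\<bar> * K (z - x)) + ennreal (\<bar>v' x - v' z\<bar> * K (z - x))) \<partial>lborel)"
      unfolding enosc_def
    proof (intro nn_integral_mono)
      fix z
      have "\<bar>f x - f z\<bar> * K (z - x) \<le> c * (\<bar>v x - v z\<bar> + \<bar>v' x - v' z\<bar>) * K (z - x)"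
        by (intro mult_right_mono le) auto
      also have "\<dots> = c * (\<bar>v x - v z\<bar> * K (z - x) + \<bar>v' x - v' z\<bar> * K (z - x))"
        by (simp add: algebra_simps)
      finally show "ennreal (\<bar>f x - f z\<bar> * K (z - x)) \<le> ennreal c * (ennreal (\<bar>v x - v z\<bar> * K (z - x)) + ennreal (\<bar>v' x - v' z\<bar> * K (z - x)))"
        using \<open>0 \<le> c\<close> by (simp add: ennreal_mult[symmetric] ennreal_plus[symmetric] ennreal_leI del: ennreal_plus)
    qed
    also have "\<dots> = ennreal c * (enosc v x + enosc v' x)"
      unfolding enosc_def by (subst nn_integral_cmult, measurable, subst nn_integral_add) auto
    also have "\<dots> < \<infinity>" using assms by (auto simp: regular_def ennreal_mult_less_top)
    finally show ?thesis .
  qed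
  then show ?thesis by (simp add: regular_def)
qed

lemma regular_dom1:
  assumes "f \<in> borel_measurable borel" and "regular v" and "0 \<le> c"
    and "\<And>x z. \<bar>f x - f z\<bar> \<le> c * \<bar>v x - v z\<bar>"
  shows "regular f"
proof (rule regular_dom[OF assms(1,2,2,3)])
  show "\<bar>f x - f z\<bar> \<le> c * (\<bar>v x - v z\<bar> + \<bar>v x - v z\<bar>)" for x z
    using assms(3) assms(4)[of x z] by (smt (verit) mult_left_mono abs_ge_zero)
qed

lemma enosc_cball:
  assumes [measurable]: "v \<in> borel_measurable borel" and "0 < r"
  shows "(\<integral>\<^sup>+z. ennreal \<bar>v x - v z\<bar> * indicator (cball x r) z \<partial>lborel) \<le> ennreal (r powr (2 + s)) * enosc v x"
proof -
  have "(\<integral>\<^sup>+z. ennreal \<bar>v x - v z\<bar> * indicator (cball x r) z \<partial>lborel)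
      \<le> (\<integral>\<^sup>+z. ennreal (r powr (2 + s)) * ennreal (\<bar>v x - v z\<bar> * K (z - x)) \<partial>lborel)"
  proof (intro nn_integral_mono)
    fix z
    show "ennreal \<bar>v x - v z\<bar> * indicator (cball x r) z \<le> ennreal (r powr (2 + s)) * ennreal (\<bar>v x - v z\<bar> * K (z - x))"
    proof (cases "z = x \<or> z \<notin> cball x r")
      case False
      then have "norm (z - x) powr (2 + s) \<le> r powr (2 + s)" "z \<noteq> x"
        using s0 by (auto intro!: powr_mono2 simp: dist_norm norm_minus_commute)
      then have "1 \<le> r powr (2 + s) * K (z - x)" by (simp add: K_def divide_simps)
      then have "\<bar>v x - v z\<bar> * 1 \<le> \<bar>v x - v z\<bar> * (r powr (2 + s) * K (z - x))"
        by (rule mult_left_mono) simp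
      then have "\<bar>v x - v z\<bar> \<le> r powr (2 + s) * (\<bar>v x - v z\<bar> * K (z - x))" by (simp add: mult_ac)
      then show ?thesis using False by (simp add: ennreal_mult[symmetric] ennreal_leI)
    qed auto
  qed
  also have "\<dots> = ennreal (r powr (2 + s)) * enosc v x"
    unfolding enosc_def by (rule nn_integral_cmult) measurable
  finally show ?thesis .
qed

text \<open>Both values are compared with \<open>v\<close> on the disc of radius
  \<open>r = norm (x - x')\<close> about \<open>x\<close>, which lies in the disc of radius
  \<open>2 * r\<close> about \<open>x'\<close>. The result is a Hoelder estimate only where
  \<open>nosc v\<close> is bounded, and it is used on level sets of \<open>nosc v\<close>.\<close>

lemma regular_holder:
  assumes v: "regular v"
  shows "\<bar>v x - v x'\<bar> \<le> 8 * norm (x - x') powr s * (nosc v x + nosc v x')"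
proof (cases "x = x'")
  case False
  have [measurable]: "v \<in> borel_measurable borel" by (rule regular_measurable[OF v])
  have [measurable]: "cball x r \<in> sets borel" for x :: "real^2" and r by auto
  define r where "r = norm (x - x')"
  have r: "0 < r" using False by (simp add: r_def)
  have "ennreal (\<bar>v x - v x'\<bar> * (pi * r\<^sup>2)) = (\<integral>\<^sup>+z. ennreal \<bar>v x - v x'\<bar> * indicator (cball x r) z \<partial>lborel)"
    using r by (simp add: nn_integral_cmult_indicator emeasure_cball_plane ennreal_mult)
  also have "\<dots> \<le> (\<integral>\<^sup>+z. ennreal \<bar>v x - v z\<bar> * indicator (cball x r) z + ennreal \<bar>v x' - v z\<bar> * indicator (cball x' (2 * r)) z \<partial>lborel)"
  proof (intro nn_integral_mono)
    fix z
    show "ennreal \<bar>v x - v x'\<bar> * indicator (cball x r) z \<le> ennreal \<bar>v x - v z\<bar> * indicator (cball x r) z + ennreal \<bar>v x' - v z\<bar> * indicator (cball x' (2 * r)) z"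
    proof (cases "z \<in> cball x r")
      case True
      have "dist x' z \<le> dist x' x + dist x z" by (rule dist_triangle)
      with True have "z \<in> cball x' (2 * r)" by (auto simp: r_def dist_norm norm_minus_commute)
      with True show ?thesis by (simp add: ennreal_plus[symmetric] ennreal_leI del: ennreal_plus)
    qed simp
  qed
  also have "\<dots> = (\<integral>\<^sup>+z. ennreal \<bar>v x - v z\<bar> * indicator (cball x r) z \<partial>lborel) + (\<integral>\<^sup>+z. ennreal \<bar>v x' - v z\<bar> * indicator (cball x' (2 * r)) z \<partial>lborel)"
    by (rule nn_integral_add) measurable
  also have "\<dots> \<le> ennreal (r powr (2 + s)) * enosc v x + ennreal ((2 * r) powr (2 + s)) * enosc v x'"
    using r by (intro add_mono enosc_cball) auto
  also have "\<dots> = ennreal (r powr (2 + s) * nosc v x + (2 * r) powr (2 + s) * nosc v x')"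
    by (simp add: enosc_eq[OF v] ennreal_mult[symmetric] ennreal_plus[symmetric] del: ennreal_plus)
  finally have "\<bar>v x - v x'\<bar> * (pi * r\<^sup>2) \<le> r powr (2 + s) * nosc v x + (2 * r) powr (2 + s) * nosc v x'"
    by (subst (asm) ennreal_le_iff) (auto intro!: add_nonneg_nonneg)
  also have "(2 * r) powr (2 + s) * nosc v x' \<le> 8 * r powr (2 + s) * nosc v x'"
    using two_powr_le r by (intro mult_right_mono) (auto simp: powr_mult)
  also have "r powr (2 + s) * nosc v x \<le> 8 * r powr (2 + s) * nosc v x" 
    by (intro mult_right_mono) auto
  finally have "\<bar>v x - v x'\<bar> * (pi * r\<^sup>2) \<le> 8 * r powr (2 + s) * (nosc v x + nosc v x')" by (simp only: distrib_left)
  also have "r powr (2 + s) = r\<^sup>2 * r powr s" using r by (simp add: powr_add)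
  finally have "\<bar>v x - v x'\<bar> * pi * r\<^sup>2 \<le> 8 * r powr s * (nosc v x + nosc v x') * r\<^sup>2" by (simp only: mult_ac)
  then have "\<bar>v x - v x'\<bar> * pi \<le> 8 * r powr s * (nosc v x + nosc v x')" using r by simp
  moreover have "\<bar>v x - v x'\<bar> * 1 \<le> \<bar>v x - v x'\<bar> * pi" using pi_ge_two by (intro mult_left_mono) auto
  ultimately show ?thesis by (simp add: r_def)
qed simp

text \<open>Along a sequence in the level set with limit \<open>l\<close>, the values of
  \<open>v\<close> converge by \<open>regular_holder\<close>, since \<open>nosc v l\<close> is at
  least finite. Fatou's lemma then carries the bound \<open>N\<close> over to
  \<open>l\<close>.\<close>

lemma regular_level_closed:
  assumes v: "regular v"
  shows "closed {x. nosc v x \<le> N}"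
  unfolding closed_sequential_limits
proof (intro allI impI, elim conjE)
  fix X l assume X: "\<forall>n. X n \<in> {x. nosc v x \<le> N}" and lim: "X \<longlonglongrightarrow> l"
  have [measurable]: "v \<in> borel_measurable borel" by (rule regular_measurable[OF v])
  have "(\<lambda>n. 8 * norm (X n - l) powr s * (N + nosc v l)) \<longlonglongrightarrow> 8 * 0 * (N + nosc v l)"
  proof (intro tendsto_intros tendsto_zero_powrI)
    show "(\<lambda>n. norm (X n - l)) \<longlonglongrightarrow> 0" using lim by (simp add: LIM_zero_iff tendsto_norm_zero)
  qed (use s0 in auto)
  moreover have "norm (v (X n) - v l) \<le> 8 * norm (X n - l) powr s * (N + nosc v l)" for n
  proof -
    have "\<bar>v (X n) - v l\<bar> \<le> 8 * norm (X n - l) powr s * (nosc v (X n) + nosc v l)" by (rule regular_holder[OF v])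
    also have "\<dots> \<le> 8 * norm (X n - l) powr s * (N + nosc v l)" using X by (intro mult_left_mono) auto
    finally show ?thesis by simp
  qed
  ultimately have "(\<lambda>n. v (X n) - v l) \<longlonglongrightarrow> 0"
    by (intro Lim_null_comparison[where f="\<lambda>n. v (X n) - v l"]) auto
  then have vl: "(\<lambda>n. v (X n)) \<longlonglongrightarrow> v l" by (simp add: LIM_zero_iff)
  have N: "0 \<le> N" using X nosc_nonneg[of v "X 0"] by (metis mem_Collect_eq order_trans)
  have "enosc v l = (\<integral>\<^sup>+z. liminf (\<lambda>n. ennreal (\<bar>v (X n) - v z\<bar> * K (z - X n))) \<partial>lborel)"
    unfolding enosc_def
  proof (intro nn_integral_cong_AE)
    show "AE z in lborel. ennreal (\<bar>v l - v z\<bar> * K (z - l)) = liminf (\<lambda>n. ennreal (\<bar>v (X n) - v z\<bar> * K (z - X n)))"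
      using AE_nonzero[of l]
    proof eventually_elim
      case (elim z)
      have "(\<lambda>n. \<bar>v (X n) - v z\<bar> * K (z - X n)) \<longlonglongrightarrow> \<bar>v l - v z\<bar> * K (z - l)"
        unfolding K_def using elim by (intro tendsto_intros vl lim) auto
      then show ?case by (intro lim_imp_Liminf[symmetric] tendsto_ennrealI) auto
    qed
  qed
  also have "\<dots> \<le> liminf (\<lambda>n. enosc v (X n))"
    unfolding enosc_def by (rule nn_integral_liminf) measurable
  also have "\<dots> \<le> liminf (\<lambda>n. ennreal N)"
    using X by (intro Liminf_mono always_eventually) (auto simp: enosc_eq[OF v] ennreal_leI)
  also have "\<dots> = ennreal N" by (simp add: Liminf_const)
  finally show "l \<in> {x. nosc v x \<le> N}" using N by (simp add: enosc_eq[OF v])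
qed

text \<open>Baire's theorem in \<open>C\<close>: the closed level sets of \<open>nosc v\<close> at
  integer heights exhaust \<open>C\<close>. If the bound failed near every point of
  \<open>C\<close>, their complements would be relatively open and dense in \<open>C\<close>, yet
  their intersection is empty.\<close>

lemma regular_portion:
  assumes v: "regular v" and C: "closed C" "C \<noteq> {}"
  shows "\<exists>x\<in>C. \<exists>r>0. \<exists>N. \<forall>y\<in>C \<inter> ball x r. nosc v y \<le> N"
proof (rule ccontr)
  assume neg: "\<not> ?thesis"
  let ?T = "\<lambda>n::nat. C - {x. nosc v x \<le> real n}"
  have "C \<subseteq> closure (\<Inter> (range ?T))"
  proof (rule Baire[OF C(1)])
    fix T assume "T \<in> range ?T"
    then obtain n where T: "T = ?T n" by blast
    show "openin (top_of_set C) T \<and> C \<subseteq> closure T"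
    proof
      have "T = C \<inter> - {x. nosc v x \<le> real n}" using T by blast
      moreover have "open (- {x. nosc v x \<le> real n})" using regular_level_closed[OF v] by (simp add: open_Compl)
      ultimately show "openin (top_of_set C) T" by (auto simp: openin_open)
      show "C \<subseteq> closure T"
      proof
        fix x assume x: "x \<in> C"
        show "x \<in> closure T"
          unfolding closure_approachable
        proof (intro allI impI)
          fix e :: real assume "0 < e"
          then obtain y where "y \<in> C \<inter> ball x e" "\<not> nosc v y \<le> real n" using neg x by blast
          then show "\<exists>y\<in>T. dist y x < e" using T by (auto simp: dist_commute)
        qed
      qed
    qed
  qed simp
  moreover have "\<Inter> (range ?T) = {}"
    using real_arch_simple by fast
  ultimately show False using C(2) by (simp only: closure_empty subset_empty)
qed

text \<open>The single finite value \<open>nosc v 0\<close> controls the growth at infinity, since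
  \<open>w\<close> lies below the kernel based at the origin.\<close>

lemma regular_weighted:
  assumes v: "regular v"
  shows "integrable lborel (\<lambda>z. \<bar>v z\<bar> * w z)"
proof (rule Bochner_Integration.integrable_bound)
  have [measurable]: "v \<in> borel_measurable borel" by (rule regular_measurable[OF v])
  show "integrable lborel (\<lambda>z. \<bar>v 0\<bar> * w z + \<bar>v 0 - v z\<bar> * K (z - 0))"
    by (intro Bochner_Integration.integrable_add integrable_mult_right integrable_w regular_integrable'(1)[OF v])
  show "(\<lambda>z. \<bar>v z\<bar> * w z) \<in> borel_measurable lborel" by measurable
  show "AE z in lborel. norm (\<bar>v z\<bar> * w z) \<le> norm (\<bar>v 0\<bar> * w z + \<bar>v 0 - v z\<bar> * K (z - 0))"
    using AE_nonzero[of 0]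
  proof eventually_elim
    case (elim z)
    have "\<bar>v z\<bar> * w z \<le> (\<bar>v 0\<bar> + \<bar>v 0 - v z\<bar>) * w z" by (intro mult_right_mono) auto
    also have "\<dots> \<le> \<bar>v 0\<bar> * w z + \<bar>v 0 - v z\<bar> * K z"
      using mult_left_mono[OF w_le_K[OF elim], of "\<bar>v 0 - v z\<bar>"] by (simp add: algebra_simps)
    finally show ?case by (simp add: add_nonneg_nonneg)
  qed
qed

subsection \<open>Mollification of pointwise inequalities\<close>

lemma one_le_w: "norm x \<le> R \<Longrightarrow> 1 \<le> (1 + R) powr (2 + s) * w x"
proof -
  assume x: "norm x \<le> R"
  then have "(1 + norm x) powr (2 + s) \<le> (1 + R) powr (2 + s)" using s0 by (intro powr_mono2) auto
  moreover have "0 < (1 + norm x) powr (2 + s)" by (simp add: add_nonneg_eq_0_iff)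
  ultimately show ?thesis unfolding w_def by (simp add: divide_simps)
qed

lemma tame_compact_lipschitz:
  assumes [measurable]: "f \<in> borel_measurable borel" and lip: "\<And>x y. \<bar>f x - f (x + y)\<bar> \<le> l * norm y" and bd: "\<And>x. \<bar>f x\<bar> \<le> M"
    and supp: "\<And>x. R \<le> norm x \<Longrightarrow> f x = 0" and "0 \<le> R" "0 \<le> l"
  shows "tame ((M + l) * (2 + R) powr (2 + s)) f"
proof -
  have M: "0 \<le> M" using bd[of 0] by linarith
  have *: "1 \<le> (2 + R) powr (2 + s) * w x" if "norm x \<le> R + 1" for x
    using one_le_w[OF that] by simp
  show ?thesis
    unfolding tame_def
  proof (intro conjI allI impI)
    fix x
    have "M * 1 \<le> (M + l) * ((2 + R) powr (2 + s) * w x)" if "norm x \<le> R"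
      using that M \<open>0 \<le> l\<close> by (intro mult_mono *) auto
    then show "\<bar>f x\<bar> \<le> (M + l) * (2 + R) powr (2 + s) * w x"
      using bd[of x] supp[of x] M \<open>0 \<le> l\<close> by (cases "norm x \<le> R") (auto simp: mult.assoc)
  next
    fix x y :: "real^2" assume y: "norm y \<le> 1"
    show "\<bar>f x - f (x + y)\<bar> \<le> (M + l) * (2 + R) powr (2 + s) * w x * norm y"
    proof (cases "norm x \<le> R + 1")
      case True
      have "l * norm y * 1 \<le> (M + l) * norm y * ((2 + R) powr (2 + s) * w x)"
        using True M \<open>0 \<le> l\<close> by (intro mult_mono *) auto
      then show ?thesis using lip[of x y] by (simp add: mult_ac)
    next
      case False
      then have "R \<le> norm x" "R \<le> norm (x + y)" using y norm_triangle_ineq4[of "x + y" y] by auto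
      then show ?thesis using supp M \<open>0 \<le> l\<close> by simp
    qed
  qed simp
qed

text \<open>A cone, whose Lipschitz continuity makes it tame. Its mass is not normalised but is the
  same number \<open>c0\<close> at every scale, which accounts for the factor \<open>c0\<close> in
  all limits below.\<close>

definition \<rho> :: "real \<Rightarrow> real^2 \<Rightarrow> real" where
  "\<rho> e x = max 0 (1 - norm x / e) / e\<^sup>2"

lemma \<rho>_nonneg [simp]: "0 \<le> \<rho> e x" by (simp add: \<rho>_def)
lemma \<rho>_measurable [measurable]: "\<rho> e \<in> borel_measurable borel" unfolding \<rho>_def by measurable
lemma \<rho>_uminus [simp]: "\<rho> e (- y) = \<rho> e y" by (simp add: \<rho>_def)
lemma \<rho>_outside: "0 < e \<Longrightarrow> e \<le> norm x \<Longrightarrow> \<rho> e x = 0" by (simp add: \<rho>_def)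
lemma \<rho>_scale: "0 < e \<Longrightarrow> \<rho> e x = \<rho> 1 ((1 / e) *\<^sub>R x) / e\<^sup>2" by (simp add: \<rho>_def)
lemma \<rho>_le: "0 < e \<Longrightarrow> \<rho> e x \<le> 1 / e\<^sup>2" unfolding \<rho>_def by (intro divide_right_mono) auto

lemma \<rho>_tame:
  assumes e: "0 < e"
  shows "\<exists>A. tame A (\<rho> e)"
proof (rule exI, rule tame_compact_lipschitz[where R=e and M="1 / e\<^sup>2" and l="1 / e / e\<^sup>2"])
  show "\<bar>\<rho> e x - \<rho> e (x + y)\<bar> \<le> 1 / e / e\<^sup>2 * norm y" for x y
  proof -
    have "\<bar>norm x - norm (x + y)\<bar> \<le> norm y" using norm_triangle_ineq3[of x "x + y"] by simp
    then have "\<bar>norm x / e - norm (x + y) / e\<bar> \<le> norm y / e" using e 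
      by (simp add: diff_divide_distrib[symmetric] divide_right_mono)
    then have "\<bar>max 0 (1 - norm x / e) - max 0 (1 - norm (x + y) / e)\<bar> \<le> norm y / e" by linarith
    then have "\<bar>max 0 (1 - norm x / e) - max 0 (1 - norm (x + y) / e)\<bar> / e\<^sup>2 \<le> norm y / e / e\<^sup>2" by (rule divide_right_mono) simp
    then show ?thesis by (simp add: \<rho>_def diff_divide_distrib[symmetric])
  qed
qed (use e in \<open>auto simp: \<rho>_outside \<rho>_le\<close>)

lemma tame_translate:
  assumes "tame A \<eta>"
  shows "tame ((1 + norm a) powr (2 + s) * A) (\<lambda>z. \<eta> (z - a))"
proof -
  have [measurable]: "\<eta> \<in> borel_measurable borel" by (rule tameD[OF assms])
  have A: "0 \<le> A" by (rule tameD(4)[OF assms])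
  have le: "A * w (z - a) \<le> (1 + norm a) powr (2 + s) * A * w z" for z
    using mult_left_mono[OF w_translate[of z "-a"] A] by (simp add: mult_ac)
  show ?thesis
    unfolding tame_def
  proof (intro conjI allI impI)
    show "\<bar>\<eta> (x - a)\<bar> \<le> (1 + norm a) powr (2 + s) * A * w x" for x
      using tameD(2)[OF assms, of "x - a"] le[of x] by linarith
    show "\<bar>\<eta> (x - a) - \<eta> (x + y - a)\<bar> \<le> (1 + norm a) powr (2 + s) * A * w x * norm y" if "norm y \<le> 1" for x y
    proof -
      have "\<bar>\<eta> (x - a) - \<eta> (x + y - a)\<bar> \<le> A * w (x - a) * norm y"
        using tameD(3)[OF assms that, of "x - a"] by (simp add: algebra_simps)
      also have "\<dots> \<le> (1 + norm a) powr (2 + s) * A * w x * norm y" by (intro mult_right_mono le) auto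
      finally show ?thesis .
    qed
  qed simp
qed

lemma frac_lap_translate: "frac_lap s (\<lambda>z. \<eta> (z - a)) z = frac_lap s \<eta> (z - a)"
  unfolding frac_lap_def by (simp add: algebra_simps)

lemma frac_lap_scale:
  assumes [measurable]: "f \<in> borel_measurable borel" and e: "0 < e"
  shows "frac_lap s (\<lambda>x. f ((1 / e) *\<^sub>R x)) x = frac_lap s f ((1 / e) *\<^sub>R x) / e powr s"
proof -
  have "frac_lap s (\<lambda>x. f ((1 / e) *\<^sub>R x)) x = e\<^sup>2 * (\<integral>y. (f ((1 / e) *\<^sub>R x) - f ((1 / e) *\<^sub>R x + y)) * K (e *\<^sub>R y) \<partial>lborel)"
    unfolding frac_lap_K using e by (subst integral_affine[of _ e 0]) (auto simp: scaleR_add_right)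
  also have "\<dots> = e\<^sup>2 * (\<integral>y. (f ((1 / e) *\<^sub>R x) - f ((1 / e) *\<^sub>R x + y)) * K y / e powr (2 + s) \<partial>lborel)"
    using e by (simp add: K_scale)
  also have "\<dots> = e\<^sup>2 / e powr (2 + s) * frac_lap s f ((1 / e) *\<^sub>R x)"
    by (simp add: frac_lap_K)
  also have "e\<^sup>2 / e powr (2 + s) = 1 / e powr s" using e by (simp add: powr_add)
  finally show ?thesis by simp
qed

lemma frac_lap_cmult: "frac_lap s (\<lambda>x. c * f x) x = c * frac_lap s f x"
  unfolding frac_lap_def 
  by (subst integral_mult_right_zero[symmetric]) (simp add: algebra_simps)

lemma frac_lap_translate': "frac_lap s (\<lambda>z. \<eta> (z - a)) = (\<lambda>z. frac_lap s \<eta> (z - a))"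
  by (intro ext frac_lap_translate)

definition A\<rho> :: real where "A\<rho> = (SOME A. tame A (\<rho> 1)) * cL"

lemma A\<rho>_bound: "\<bar>frac_lap s (\<rho> 1) x\<bar> \<le> A\<rho> * w x" and A\<rho>_nonneg: "0 \<le> A\<rho>"
proof -
  have t: "tame (SOME A. tame A (\<rho> 1)) (\<rho> 1)" by (rule someI_ex) (rule \<rho>_tame, simp)
  show "\<bar>frac_lap s (\<rho> 1) x\<bar> \<le> A\<rho> * w x"
    using tame_frac_lap[OF t] by (simp add: A\<rho>_def)
  show "0 \<le> A\<rho>" using tameD(4)[OF t] cL_nonneg by (simp add: A\<rho>_def)
qed

lemma \<rho>_frac_lap: "0 < e \<Longrightarrow> frac_lap s (\<rho> e) x = frac_lap s (\<rho> 1) ((1 / e) *\<^sub>R x) / e powr (2 + s)"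
proof -
  assume e: "0 < e"
  have "frac_lap s (\<rho> e) x = frac_lap s (\<lambda>x. 1 / e\<^sup>2 * \<rho> 1 ((1 / e) *\<^sub>R x)) x"
    using \<rho>_scale[OF e] by (intro arg_cong[where f="\<lambda>f. frac_lap s f x"] ext) simp
  also have "\<dots> = 1 / e\<^sup>2 * (frac_lap s (\<rho> 1) ((1 / e) *\<^sub>R x) / e powr s)"
    using e by (subst frac_lap_cmult, subst frac_lap_scale) auto
  finally show ?thesis using e by (simp add: powr_add)
qed

lemma \<rho>_frac_lap_bound:
  assumes e: "0 < e"
  shows "\<bar>frac_lap s (\<rho> e) x\<bar> \<le> A\<rho> / (e + norm x) powr (2 + s)"
proof -
  have "\<bar>frac_lap s (\<rho> e) x\<bar> \<le> A\<rho> * w ((1 / e) *\<^sub>R x) / e powr (2 + s)"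
    using A\<rho>_bound[of "(1 / e) *\<^sub>R x"] by (subst \<rho>_frac_lap[OF e]) (simp add: divide_right_mono)
  also have "\<dots> = A\<rho> / ((1 + norm x / e) powr (2 + s) * e powr (2 + s))"
    using e by (simp add: w_def)
  also have "(1 + norm x / e) powr (2 + s) * e powr (2 + s) = ((1 + norm x / e) * e) powr (2 + s)"
    using e by (simp add: powr_mult)
  also have "(1 + norm x / e) * e = e + norm x" using e by (simp add: field_simps)
  finally show ?thesis .
qed

text \<open>If \<open>norm (x - y) \<le> e\<close>, then \<open>e + norm (z - x)\<close> dominates
  \<open>norm (z - y)\<close>, so the smoothed kernel centred at \<open>x\<close> lies below a
  multiple of the kernel centred at \<open>y\<close>. The multiple does not depend on
  \<open>e\<close>: a bound on \<open>nosc v\<close> at one point controls the mollified form within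
  one mollification radius of it.\<close>

lemma \<rho>_frac_lap_bound_K:
  assumes e: "0 < e" and "norm (x - y) \<le> e" "z \<noteq> y"
  shows "\<bar>frac_lap s (\<rho> e) (z - x)\<bar> \<le> A\<rho> * K (z - y)"
proof -
  have "norm (z - y) \<le> norm (z - x) + norm (x - y)" using norm_triangle_ineq[of "z - x" "x - y"] by simp
  then have "norm (z - y) powr (2 + s) \<le> (e + norm (z - x)) powr (2 + s)"
    using assms s0 by (intro powr_mono2) auto
  then have "A\<rho> / (e + norm (z - x)) powr (2 + s) \<le> A\<rho> / norm (z - y) powr (2 + s)"
    using assms A\<rho>_nonneg by (intro divide_left_mono mult_pos_pos) (auto simp: add_nonneg_eq_0_iff)
  with \<rho>_frac_lap_bound[OF e, of "z - x"] show ?thesis by (simp add: K_def)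
qed

definition c0 :: real where "c0 = (\<integral>x. \<rho> 1 x \<partial>lborel)"

lemma tame_integrable_self:
  assumes "tame A \<eta>" shows "integrable lborel \<eta>"
  using tameD(1,2)[OF assms] tameD(4)[OF assms]
  by (intro Bochner_Integration.integrable_bound[OF integrable_mult_right[OF integrable_w, of A]] AE_I2) auto

lemma \<rho>_integrable: "0 < e \<Longrightarrow> integrable lborel (\<rho> e)"
proof -
  assume "0 < e"
  then obtain A where "tame A (\<rho> e)" using \<rho>_tame by blast
  then show ?thesis
    by (rule tame_integrable_self)
qed

lemma \<rho>_integral: "0 < e \<Longrightarrow> (\<integral>x. \<rho> e x \<partial>lborel) = c0"
  by (subst integral_affine[of _ e 0]) (auto simp: \<rho>_scale[of e] c0_def)

lemma c0_pos: "0 < c0"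
proof -
  have "c0 \<noteq> 0"
  proof
    assume "c0 = 0"
    then have "AE x in lborel. \<rho> 1 x = 0"
      unfolding c0_def by (subst (asm) integral_nonneg_eq_0_iff_AE) (auto intro: \<rho>_integrable)
    then have "AE x in lborel. x \<notin> ball (0::real^2) 1"
      by eventually_elim (auto simp: \<rho>_def)
    then have "emeasure lborel {x \<in> space lborel. x \<in> ball (0::real^2) 1} = 0"
      by (rule emeasure_eq_0_AE)
    moreover have "{x \<in> space lborel. x \<in> ball (0::real^2) 1} = ball 0 1" by auto
    ultimately show False by (simp add: emeasure_cball_plane)
  qed
  moreover have "0 \<le> c0" unfolding c0_def by (intro integral_nonneg_AE) auto
  ultimately show ?thesis by simp
qed

lemma tame_frac_lap_integrable:
  assumes "tame A \<eta>" shows "integrable lborel (frac_lap s \<eta>)"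
  using tameD(1,4)[OF assms] tame_frac_lap[OF assms] cL_nonneg
  by (intro Bochner_Integration.integrable_bound[OF integrable_mult_right[OF integrable_w, of "A * cL"]] AE_I2) auto

text \<open>By Fubini and translation invariance: for fixed \<open>y\<close> the increment
  \<open>\<eta> x - \<eta> (x + y)\<close> has integral 0 in \<open>x\<close>. This permits
  subtracting a constant from \<open>v\<close> in pairings with
  \<open>frac_lap s \<eta>\<close>.\<close>

lemma tame_frac_lap_integral:
  assumes "tame A \<eta>"
  shows "(\<integral>x. frac_lap s \<eta> x \<partial>lborel) = 0"
proof -
  have [measurable]: "\<eta> \<in> borel_measurable borel" by (rule tameD[OF assms])
  let ?f = "\<lambda>(x, y). (\<eta> x - \<eta> (x + y)) * K y"
  have "integrable (lborel \<Otimes>\<^sub>M lborel) ?f"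
  proof (rule lborel_pair.Fubini_integrable)
    show "?f \<in> borel_measurable (lborel \<Otimes>\<^sub>M lborel)" by measurable
    show "AE x in lborel. integrable lborel (\<lambda>y. ?f (x, y))" using tame_integrable[OF assms] by simp
    show "integrable lborel (\<lambda>x. \<integral>y. norm (?f (x, y)) \<partial>lborel)"
    proof (rule Bochner_Integration.integrable_bound[OF integrable_mult_right[OF integrable_w, of "A * cL"]])
      show "AE x in lborel. norm (\<integral>y. norm (?f (x, y)) \<partial>lborel) \<le> norm (A * cL * w x)"
      proof (rule AE_I2)
        fix x
        have "(\<integral>y. norm (?f (x, y)) \<partial>lborel) \<le> (\<integral>y. A * w x * (9 * m y + 8 * w (x + y)) \<partial>lborel)"
          using tame_integrable[OF assms, of x]
          by (intro integral_mono integrable_norm integrable_kernel_majorant)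
             (simp_all add: abs_mult tame_kernel_bound[OF assms])
        also have "\<dots> = A * cL * w x" by (simp only: integral_kernel_majorant) (simp add: mult_ac)
        finally show "norm (\<integral>y. norm (?f (x, y)) \<partial>lborel) \<le> norm (A * cL * w x)" by simp
      qed
    qed measurable
  qed
  then have "(\<integral>x. (\<integral>y. (\<eta> x - \<eta> (x + y)) * K y \<partial>lborel) \<partial>lborel) = (\<integral>y. (\<integral>x. (\<eta> x - \<eta> (x + y)) * K y \<partial>lborel) \<partial>lborel)"
    by (rule lborel_pair.Fubini_integral[symmetric])
  also have "\<dots> = (\<integral>y. 0 \<partial>(lborel :: (real^2) measure))"
  proof (rule Bochner_Integration.integral_cong[OF refl])
    fix y :: "real^2"
    have i: "integrable lborel \<eta>" by (rule tame_integrable_self[OF assms])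
    have "integrable lborel (\<lambda>x. \<eta> (y + x))" "(\<integral>x. \<eta> (y + x) \<partial>lborel) = (\<integral>x. \<eta> x \<partial>lborel)"
      using i by (auto simp: integrable_translate integral_translate)
    then show "(\<integral>x. (\<eta> x - \<eta> (x + y)) * K y \<partial>lborel) = 0"
      using i by (simp add: add.commute)
  qed
  finally show ?thesis by (simp add: frac_lap_K)
qed

section \<open>Weak form and mollified form of the inequality\<close>

definition weak_form :: "(real^2 \<Rightarrow> real) \<Rightarrow> (real^2 \<Rightarrow> real) \<Rightarrow> (real^2 \<Rightarrow> real) \<Rightarrow> real" where
  "weak_form v b \<eta> = (\<integral>z. v z * frac_lap s \<eta> z \<partial>lborel) + (\<integral>z. b z * \<eta> z \<partial>lborel)"

text \<open>Formally the convolution of \<open>frac_lap s v + b\<close> with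
  \<open>\<rho> e\<close>. The operator acts on the mollifier, since \<open>nosc v\<close> may be
  unbounded near \<open>x\<close>.\<close>

definition moll_form :: "(real^2 \<Rightarrow> real) \<Rightarrow> (real^2 \<Rightarrow> real) \<Rightarrow> real \<Rightarrow> real^2 \<Rightarrow> real" where
  "moll_form v b e x = (\<integral>z. v z * frac_lap s (\<rho> e) (z - x) \<partial>lborel) + (\<integral>z. b z * \<rho> e (z - x) \<partial>lborel)"

lemma moll_form_eq: "moll_form v b e x = weak_form v b (\<lambda>z. \<rho> e (z - x))"
  by (simp add: moll_form_def weak_form_def frac_lap_translate)

lemma weighted_integrable:
  assumes v: "regular v" and [measurable]: "P \<in> borel_measurable borel" and P: "\<And>z. \<bar>P z\<bar> \<le> C * w z"
  shows "integrable lborel (\<lambda>z. v z * P z)"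
proof (rule Bochner_Integration.integrable_bound[OF integrable_mult_right[OF regular_weighted[OF v], of C]])
  have [measurable]: "v \<in> borel_measurable borel" by (rule regular_measurable[OF v])
  show "(\<lambda>z. v z * P z) \<in> borel_measurable lborel" by measurable
  show "AE z in lborel. norm (v z * P z) \<le> norm (C * (\<bar>v z\<bar> * w z))"
  proof (rule AE_I2)
    fix z
    have "\<bar>v z * P z\<bar> \<le> \<bar>v z\<bar> * (C * w z)" unfolding abs_mult by (intro mult_left_mono P) auto
    also have "\<dots> \<le> \<bar>C * (\<bar>v z\<bar> * w z)\<bar>" by (simp add: mult_ac)
    finally show "norm (v z * P z) \<le> norm (C * (\<bar>v z\<bar> * w z))" by simp
  qed
qed

lemma weighted_limit:
  assumes v: "regular v" and [measurable]: "\<And>n. P n \<in> borel_measurable borel" "P' \<in> borel_measurable borel"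
    and P: "\<And>n z. \<bar>P n z\<bar> \<le> C * w z" and lim: "\<And>z. (\<lambda>n. P n z) \<longlonglongrightarrow> P' z"
  shows "(\<lambda>n. \<integral>z. v z * P n z \<partial>lborel) \<longlonglongrightarrow> (\<integral>z. v z * P' z \<partial>lborel)"
proof (rule integral_dominated_convergence[OF _ _ integrable_mult_right[OF regular_weighted[OF v], of C]])
  have [measurable]: "v \<in> borel_measurable borel" by (rule regular_measurable[OF v])
  show "(\<lambda>z. v z * P' z) \<in> borel_measurable lborel" by measurable
  show "(\<lambda>z. v z * P n z) \<in> borel_measurable lborel" for n by measurable
  show "AE z in lborel. (\<lambda>n. v z * P n z) \<longlonglongrightarrow> v z * P' z" by (intro AE_I2 tendsto_intros lim)
  show "AE z in lborel. norm (v z * P n z) \<le> C * (\<bar>v z\<bar> * w z)" for n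
  proof (rule AE_I2)
    fix z
    have "\<bar>v z * P n z\<bar> \<le> \<bar>v z\<bar> * (C * w z)" unfolding abs_mult by (intro mult_left_mono P) auto
    then show "norm (v z * P n z) \<le> C * (\<bar>v z\<bar> * w z)" by (simp add: mult_ac)
  qed
qed

lemma weak_form_limit:
  assumes v: "regular v" and b: "regular b" and \<eta>: "\<And>n. tame A (\<eta> n)" and lim: "\<And>x. (\<lambda>n. \<eta> n x) \<longlonglongrightarrow> \<eta>' x"
  shows "(\<lambda>n. weak_form v b (\<eta> n)) \<longlonglongrightarrow> weak_form v b \<eta>'"
proof -
  have [measurable]: "\<eta> n \<in> borel_measurable borel" for n by (rule tameD[OF \<eta>])
  have [measurable]: "\<eta>' \<in> borel_measurable borel" 
    by (rule borel_measurable_LIMSEQ_real[OF lim]) auto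
  show ?thesis
    unfolding weak_form_def
    by (intro tendsto_add weighted_limit[OF v, where C="A * cL"] weighted_limit[OF b, where C=A] tame_frac_lap[OF \<eta>] tame_limit[OF \<eta> lim] tameD(2)[OF \<eta>] lim) measurable
qed

text \<open>The transformed mollifier has mean zero, so \<open>v z\<close> may be replaced by
  \<open>v z - v y\<close>, and \<open>\<rho>_frac_lap_bound_K\<close> turns the integral into
  \<open>nosc v y\<close>. The choice of \<open>y\<close> within distance \<open>e\<close> is free;
  the Baire argument takes it in the portion where \<open>nosc v\<close> is bounded.\<close>

lemma moll_form_bound:
  assumes v: "regular v" and b: "regular b" and M: "\<And>x. \<bar>b x\<bar> \<le> M" and e: "0 < e" and x: "norm (x - y) \<le> e"
  shows "\<bar>moll_form v b e x\<bar> \<le> A\<rho> * nosc v y + M * c0"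
proof -
  have [measurable]: "v \<in> borel_measurable borel" "b \<in> borel_measurable borel" by (rule regular_measurable, fact)+
  obtain A where A: "tame A (\<rho> e)" using \<rho>_tame[OF e] by blast
  let ?L = "\<lambda>z. frac_lap s (\<rho> e) (z - x)"
  have tt: "tame ((1 + norm x) powr (2 + s) * A) (\<lambda>z. \<rho> e (z - x))" by (rule tame_translate[OF A])
  have L: "integrable lborel ?L" "(\<integral>z. ?L z \<partial>lborel) = 0"
    using tame_frac_lap_integrable[OF tt] tame_frac_lap_integral[OF tt] by (simp_all add: frac_lap_translate')
  have vL: "integrable lborel (\<lambda>z. v z * ?L z)"
    using tame_frac_lap[OF tt] by (intro weighted_integrable[OF v]) (auto simp: frac_lap_translate)
  have "(\<integral>z. v z * ?L z \<partial>lborel) = (\<integral>z. v z * ?L z - v y * ?L z \<partial>lborel)"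
    using L vL by simp
  also have "\<bar>\<dots>\<bar> \<le> (\<integral>z. A\<rho> * (\<bar>v y - v z\<bar> * K (z - y)) \<partial>lborel)"
  proof -
    have "\<bar>\<integral>z. v z * ?L z - v y * ?L z \<partial>lborel\<bar> \<le> (\<integral>z. \<bar>v z * ?L z - v y * ?L z\<bar> \<partial>lborel)" by (rule integral_abs_bound)
    also have "\<dots> \<le> (\<integral>z. A\<rho> * (\<bar>v y - v z\<bar> * K (z - y)) \<partial>lborel)"
    proof (rule integral_mono_AE)
      show "integrable lborel (\<lambda>z. \<bar>v z * ?L z - v y * ?L z\<bar>)" using L vL by auto
      show "integrable lborel (\<lambda>z. A\<rho> * (\<bar>v y - v z\<bar> * K (z - y)))" using regular_integrable'(1)[OF v] by simp
      show "AE z in lborel. \<bar>v z * ?L z - v y * ?L z\<bar> \<le> A\<rho> * (\<bar>v y - v z\<bar> * K (z - y))"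
        using AE_nonzero[of y]
      proof eventually_elim
        case (elim z)
        have "\<bar>v z * ?L z - v y * ?L z\<bar> = \<bar>v y - v z\<bar> * \<bar>?L z\<bar>"
          unfolding abs_mult[symmetric] by (subst abs_minus_cancel[symmetric]) (simp add: algebra_simps)
        also have "\<dots> \<le> \<bar>v y - v z\<bar> * (A\<rho> * K (z - y))"
          by (intro mult_left_mono \<rho>_frac_lap_bound_K[OF e x elim]) auto
        finally show ?case by (simp add: mult_ac)
      qed
    qed
    finally show ?thesis .
  qed
  also have "\<dots> = A\<rho> * nosc v y" by (simp add: regular_integrable'(2)[OF v])
  finally have 1: "\<bar>\<integral>z. v z * ?L z \<partial>lborel\<bar> \<le> A\<rho> * nosc v y" .
  have i\<rho>: "integrable lborel (\<lambda>z. \<rho> e (z - x))" "(\<integral>z. \<rho> e (z - x) \<partial>lborel) = c0"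
    using integrable_translate[of "\<rho> e" "-x"] integral_translate[of "\<rho> e" "-x"] \<rho>_integrable[OF e] \<rho>_integral[OF e]
    by (simp_all add: algebra_simps)
  have "\<bar>\<integral>z. b z * \<rho> e (z - x) \<partial>lborel\<bar> \<le> (\<integral>z. \<bar>b z * \<rho> e (z - x)\<bar> \<partial>lborel)" by (rule integral_abs_bound)
  also have "\<dots> \<le> (\<integral>z. M * \<rho> e (z - x) \<partial>lborel)"
  proof (rule integral_mono)
    show "integrable lborel (\<lambda>z. \<bar>b z * \<rho> e (z - x)\<bar>)"
      using tameD(2)[OF tt] by (intro integrable_abs weighted_integrable[OF b]) auto
    show "\<bar>b z * \<rho> e (z - x)\<bar> \<le> M * \<rho> e (z - x)" for z 
      using M[of z] by (simp add: abs_mult mult_right_mono)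
  qed (use i\<rho> in simp)
  also have "\<dots> = M * c0" using i\<rho> by simp
  finally show ?thesis using 1 unfolding moll_form_def by linarith
qed

lemma \<rho>_frac_lap_limit:
  assumes y: "y \<noteq> 0" and e: "\<And>n::nat. 0 < e n" "e \<longlonglongrightarrow> 0"
  shows "(\<lambda>n. frac_lap s (\<rho> (e n)) y) \<longlonglongrightarrow> - c0 * K y"
proof -
  have ny: "0 < norm y / 2" using y by simp
  have ev: "eventually (\<lambda>n. e n < norm y / 2) sequentially" using e(2) ny by (rule order_tendstoD(2))
  have eq: "frac_lap s (\<rho> (e n)) y = - (\<integral>z. \<rho> 1 z * K (e n *\<^sub>R z - y) \<partial>lborel)" if "e n < norm y / 2" for n
  proof -
    have "\<rho> (e n) y = 0" using e(1)[of n] that ny by (intro \<rho>_outside) auto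
    then have "frac_lap s (\<rho> (e n)) y = - (\<integral>y'. \<rho> (e n) (y + y') * K ((y + y') - y) \<partial>lborel)"
      unfolding frac_lap_K by simp
    also have "(\<integral>y'. \<rho> (e n) (y + y') * K ((y + y') - y) \<partial>lborel) = (\<integral>z. \<rho> (e n) z * K (z - y) \<partial>lborel)"
      by (rule integral_translate) measurable
    also have "\<dots> = (e n)\<^sup>2 * (\<integral>z. \<rho> (e n) (e n *\<^sub>R z) * K (e n *\<^sub>R z - y) \<partial>lborel)"
      using e(1)[of n] by (subst integral_affine[of _ "e n" 0]) auto
    also have "\<dots> = (\<integral>z. \<rho> 1 z * K (e n *\<^sub>R z - y) \<partial>lborel)"
      using e(1)[of n] by (simp add: \<rho>_scale[of "e n"])
    finally show ?thesis .
  qed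
  \<comment> \<open>Restricting to indices with \<open>e n < norm y / 2\<close> keeps the argument
    of the kernel at distance at least \<open>norm y / 2\<close> from 0, so one majorant serves
    every \<open>n\<close>; all large indices satisfy the condition.\<close>
  have "(\<lambda>n. \<integral>z. \<rho> 1 z * (if e n < norm y / 2 then K (e n *\<^sub>R z - y) else 0) \<partial>lborel) \<longlonglongrightarrow> (\<integral>z. \<rho> 1 z * K y \<partial>lborel)"
  proof (rule integral_dominated_convergence[where w="\<lambda>z. \<rho> 1 z * K ((1/2) *\<^sub>R y)"])
    show "integrable lborel (\<lambda>z. \<rho> 1 z * K ((1/2) *\<^sub>R y))" using \<rho>_integrable by simp
    show "AE z in lborel. norm (\<rho> 1 z * (if e n < norm y / 2 then K (e n *\<^sub>R z - y) else 0)) \<le> \<rho> 1 z * K ((1/2) *\<^sub>R y)" for n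
    proof (rule AE_I2)
      fix z
      show "norm (\<rho> 1 z * (if e n < norm y / 2 then K (e n *\<^sub>R z - y) else 0)) \<le> \<rho> 1 z * K ((1/2) *\<^sub>R y)"
      proof (cases "e n < norm y / 2 \<and> norm z < 1")
        case True
        have "norm (e n *\<^sub>R z) \<le> norm y / 2 * 1" using True e(1)[of n] unfolding norm_scaleR by (intro mult_mono) auto
        then have "norm ((1/2) *\<^sub>R y) \<le> norm (e n *\<^sub>R z - y)" 
          using norm_triangle_ineq2[of y "e n *\<^sub>R z"] by (simp add: norm_minus_commute)
        then have "K (e n *\<^sub>R z - y) \<le> K ((1/2) *\<^sub>R y)" using y by (intro K_mono) auto
        then show ?thesis using True by (simp add: mult_left_mono)
      qed (auto simp: \<rho>_outside)
    qed
    show "AE z in lborel. (\<lambda>n. \<rho> 1 z * (if e n < norm y / 2 then K (e n *\<^sub>R z - y) else 0)) \<longlonglongrightarrow> \<rho> 1 z * K y"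
    proof (rule AE_I2)
      fix z
      have "(\<lambda>n. K (e n *\<^sub>R z - y)) \<longlonglongrightarrow> K (0 *\<^sub>R z - y)"
        unfolding K_def using y by (intro tendsto_intros e) auto
      then have "(\<lambda>n. \<rho> 1 z * K (e n *\<^sub>R z - y)) \<longlonglongrightarrow> \<rho> 1 z * K y" by (intro tendsto_intros) simp
      then show "(\<lambda>n. \<rho> 1 z * (if e n < norm y / 2 then K (e n *\<^sub>R z - y) else 0)) \<longlonglongrightarrow> \<rho> 1 z * K y"
        by (rule Lim_transform_eventually) (use ev in \<open>eventually_elim, simp\<close>)
    qed
  qed measurable
  then have "(\<lambda>n. - (\<integral>z. \<rho> 1 z * (if e n < norm y / 2 then K (e n *\<^sub>R z - y) else 0) \<partial>lborel)) \<longlonglongrightarrow> - (\<integral>z. \<rho> 1 z * K y \<partial>lborel)"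
    by (rule tendsto_minus)
  then have "(\<lambda>n. frac_lap s (\<rho> (e n)) y) \<longlonglongrightarrow> - (\<integral>z. \<rho> 1 z * K y \<partial>lborel)"
    by (rule Lim_transform_eventually) (use ev in \<open>eventually_elim, simp add: eq\<close>)
  then show ?thesis by (simp add: c0_def)
qed

text \<open>With centre \<open>y = x\<close> the bound \<open>\<rho>_frac_lap_bound_K\<close> gives
  the majorant \<open>\<bar>v x - v z\<bar> * K (z - x)\<close>, integrable because \<open>v\<close>
  is regular; dominated convergence thus works at every point. For \<open>b\<close> the averaging
  error is at most \<open>e powr s * nosc b x\<close>.\<close>

lemma moll_form_limit:
  assumes v: "regular v" and b: "regular b" and e: "\<And>n::nat. 0 < e n" "e \<longlonglongrightarrow> 0"
  shows "(\<lambda>n. moll_form v b (e n) x) \<longlonglongrightarrow> c0 * (frac_lap s v x + b x)"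
proof -
  have [measurable]: "v \<in> borel_measurable borel" "b \<in> borel_measurable borel" by (rule regular_measurable, fact)+
  let ?L = "\<lambda>n z. frac_lap s (\<rho> (e n)) (z - x)"
  have tt: "\<exists>A. tame A (\<lambda>z. \<rho> (e n) (z - x))" for n
    using \<rho>_tame[OF e(1)[of n]] tame_translate by blast
  have 1: "(\<integral>z. v z * ?L n z \<partial>lborel) = (\<integral>z. (v z - v x) * ?L n z \<partial>lborel)" for n
  proof -
    obtain A where tt: "tame A (\<lambda>z. \<rho> (e n) (z - x))" using tt by blast
    have "integrable lborel (?L n)" "(\<integral>z. ?L n z \<partial>lborel) = 0"
      using tame_frac_lap_integrable[OF tt] tame_frac_lap_integral[OF tt] by (simp_all add: frac_lap_translate')
    moreover have "integrable lborel (\<lambda>z. v z * ?L n z)"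
      using tame_frac_lap[OF tt] by (intro weighted_integrable[OF v]) (auto simp: frac_lap_translate)
    ultimately show ?thesis by (simp add: left_diff_distrib)
  qed
  have "(\<lambda>n. \<integral>z. (v z - v x) * ?L n z \<partial>lborel) \<longlonglongrightarrow> (\<integral>z. (v z - v x) * (- c0 * K (z - x)) \<partial>lborel)"
  proof (rule integral_dominated_convergence[where w="\<lambda>z. A\<rho> * (\<bar>v x - v z\<bar> * K (z - x))"])
    show "integrable lborel (\<lambda>z. A\<rho> * (\<bar>v x - v z\<bar> * K (z - x)))" using regular_integrable'(1)[OF v] by simp
    show "AE z in lborel. norm ((v z - v x) * ?L n z) \<le> A\<rho> * (\<bar>v x - v z\<bar> * K (z - x))" for n
      using AE_nonzero[of x]
    proof eventually_elim
      case (elim z)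
      have "\<bar>v x - v z\<bar> * \<bar>?L n z\<bar> \<le> \<bar>v x - v z\<bar> * (A\<rho> * K (z - x))"
        using e(1)[of n] elim by (intro mult_left_mono \<rho>_frac_lap_bound_K) auto
      then show ?case by (simp add: abs_mult mult_ac abs_minus_commute)
    qed
    show "AE z in lborel. (\<lambda>n. (v z - v x) * ?L n z) \<longlonglongrightarrow> (v z - v x) * (- c0 * K (z - x))"
      using AE_nonzero[of x] by eventually_elim (intro tendsto_intros \<rho>_frac_lap_limit e, auto)
  qed measurable
  also have "(\<integral>z. (v z - v x) * (- c0 * K (z - x)) \<partial>lborel) = c0 * (\<integral>z. (v x - v z) * K (z - x) \<partial>lborel)"
    by (subst integral_mult_right_zero[symmetric]) (simp add: algebra_simps)
  also have "(\<integral>z. (v x - v z) * K (z - x) \<partial>lborel) = frac_lap s v x"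
    unfolding frac_lap_K by (subst integral_translate[of _ x, symmetric]) auto
  finally have L1: "(\<lambda>n. \<integral>z. v z * ?L n z \<partial>lborel) \<longlonglongrightarrow> c0 * frac_lap s v x" by (simp add: 1)
  have "(\<lambda>n. (\<integral>z. b z * \<rho> (e n) (z - x) \<partial>lborel) - c0 * b x) \<longlonglongrightarrow> 0"
  proof (rule Lim_null_comparison)
    show "(\<lambda>n. e n powr s * nosc b x) \<longlonglongrightarrow> 0"
      using e s0 by (intro tendsto_mult_left_zero tendsto_zero_powrI[where b=s]) (auto intro: less_imp_le always_eventually)
    show "\<forall>\<^sub>F n in sequentially. norm ((\<integral>z. b z * \<rho> (e n) (z - x) \<partial>lborel) - c0 * b x) \<le> e n powr s * nosc b x"
    proof (rule always_eventually, rule allI)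
      fix n
      have en: "0 < e n" by (rule e)
      obtain A where tt: "tame A (\<lambda>z. \<rho> (e n) (z - x))" using tt by blast
      have ib: "integrable lborel (\<lambda>z. b z * \<rho> (e n) (z - x))"
        using tameD(2)[OF tt] by (intro weighted_integrable[OF b]) auto
      have i\<rho>: "integrable lborel (\<lambda>z. \<rho> (e n) (z - x))" "(\<integral>z. \<rho> (e n) (z - x) \<partial>lborel) = c0"
        using integrable_translate[of "\<rho> (e n)" "-x"] integral_translate[of "\<rho> (e n)" "-x"] \<rho>_integrable[OF en] \<rho>_integral[OF en]
        by (simp_all add: algebra_simps)
      have "(\<integral>z. b z * \<rho> (e n) (z - x) \<partial>lborel) - c0 * b x = (\<integral>z. b z * \<rho> (e n) (z - x) - b x * \<rho> (e n) (z - x) \<partial>lborel)"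
        using ib i\<rho> by (simp add: mult.commute)
      also have "\<bar>\<dots>\<bar> \<le> (\<integral>z. \<bar>b z * \<rho> (e n) (z - x) - b x * \<rho> (e n) (z - x)\<bar> \<partial>lborel)" by (rule integral_abs_bound)
      also have "\<dots> \<le> (\<integral>z. e n powr s * (\<bar>b x - b z\<bar> * K (z - x)) \<partial>lborel)"
      proof (rule integral_mono_AE)
        show "integrable lborel (\<lambda>z. \<bar>b z * \<rho> (e n) (z - x) - b x * \<rho> (e n) (z - x)\<bar>)" using ib i\<rho> by auto
        show "integrable lborel (\<lambda>z. e n powr s * (\<bar>b x - b z\<bar> * K (z - x)))" using regular_integrable'(1)[OF b] by simp
        show "AE z in lborel. \<bar>b z * \<rho> (e n) (z - x) - b x * \<rho> (e n) (z - x)\<bar> \<le> e n powr s * (\<bar>b x - b z\<bar> * K (z - x))"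
          using AE_nonzero[of x]
        proof eventually_elim
          case (elim z)
          \<comment> \<open>Inside the support, \<open>1 / e^2 = e^s / e^(2+s)\<close>, and
            \<open>1 / e^(2+s)\<close> is at most the kernel.\<close>
          have "\<rho> (e n) (z - x) \<le> e n powr s * K (z - x)"
          proof (cases "norm (z - x) < e n")
            case True
            have "norm (z - x) powr (2 + s) \<le> e n powr (2 + s)" using True s0 by (intro powr_mono2) auto
            then have "e n powr s / e n powr (2 + s) \<le> e n powr s * K (z - x)"
              using elim en unfolding K_def times_divide_eq_right mult_1_right
              by (intro divide_left_mono mult_pos_pos) auto
            moreover have "e n powr s / e n powr (2 + s) = 1 / (e n)\<^sup>2" using en by (simp add: powr_add)
            ultimately show ?thesis using \<rho>_le[OF en, of "z - x"] by linarith
          qed (use en in \<open>simp add: \<rho>_outside\<close>)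
          then have "\<bar>b x - b z\<bar> * \<rho> (e n) (z - x) \<le> \<bar>b x - b z\<bar> * (e n powr s * K (z - x))"
            by (rule mult_left_mono) simp
          moreover have "\<bar>b z * \<rho> (e n) (z - x) - b x * \<rho> (e n) (z - x)\<bar> = \<bar>b x - b z\<bar> * \<rho> (e n) (z - x)"
            by (simp add: left_diff_distrib[symmetric] abs_mult abs_minus_commute)
          ultimately show ?case by (simp add: mult_ac)
        qed
      qed
      also have "\<dots> = e n powr s * nosc b x" by (simp add: regular_integrable'(2)[OF b])
      finally show "norm ((\<integral>z. b z * \<rho> (e n) (z - x) \<partial>lborel) - c0 * b x) \<le> e n powr s * nosc b x" by simp
    qed
  qed
  then have "(\<lambda>n. \<integral>z. b z * \<rho> (e n) (z - x) \<partial>lborel) \<longlonglongrightarrow> c0 * b x" by (simp add: LIM_zero_iff)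
  with L1 show ?thesis unfolding moll_form_def distrib_left by (rule tendsto_add)
qed

lemma c0_nonneg: "0 \<le> c0" using c0_pos by simp

section \<open>Convolution of test functions\<close>

definition moll :: "real \<Rightarrow> (real^2 \<Rightarrow> real) \<Rightarrow> real^2 \<Rightarrow> real" where
  "moll e \<eta> z = (\<integral>x. \<eta> x * \<rho> e (z - x) \<partial>lborel)"

lemma moll_shift:
  assumes [measurable]: "\<eta> \<in> borel_measurable borel"
  shows "moll e \<eta> z = (\<integral>y. \<eta> (z + y) * \<rho> e y \<partial>lborel)"
  unfolding moll_def by (subst integral_translate[of _ z, symmetric]) auto

lemma moll_integrable:
  assumes \<eta>: "tame A \<eta>" and e: "0 < e"
  shows "integrable lborel (\<lambda>y. \<eta> (z + y) * \<rho> e y)"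
proof (rule Bochner_Integration.integrable_bound[OF integrable_mult_right[OF \<rho>_integrable[OF e], of A]])
  have [measurable]: "\<eta> \<in> borel_measurable borel" by (rule tameD[OF \<eta>])
  show "(\<lambda>y. \<eta> (z + y) * \<rho> e y) \<in> borel_measurable lborel" by measurable
  show "AE y in lborel. norm (\<eta> (z + y) * \<rho> e y) \<le> norm (A * \<rho> e y)"
  proof (rule AE_I2)
    fix y
    have "\<bar>\<eta> (z + y)\<bar> \<le> A * 1"
      using tameD(2)[OF \<eta>, of "z + y"] tameD(4)[OF \<eta>] w_le_1[of "z + y"] by (meson mult_left_mono order_trans)
    then show "norm (\<eta> (z + y) * \<rho> e y) \<le> norm (A * \<rho> e y)" 
      using tameD(4)[OF \<eta>] by (simp add: abs_mult mult_right_mono)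
  qed
qed

lemma moll_measurable [measurable]:
  assumes [measurable]: "\<eta> \<in> borel_measurable borel"
  shows "moll e \<eta> \<in> borel_measurable borel"
  unfolding moll_def by measurable

lemma moll_bound:
  assumes e: "0 < e" "e \<le> 1" and [measurable]: "f \<in> borel_measurable borel" and i: "integrable lborel (\<lambda>y. f y * \<rho> e y)"
    and le: "\<And>y. norm y \<le> e \<Longrightarrow> \<bar>f y\<bar> \<le> B"
  shows "\<bar>\<integral>y. f y * \<rho> e y \<partial>lborel\<bar> \<le> B * c0"
proof -
  have "\<bar>\<integral>y. f y * \<rho> e y \<partial>lborel\<bar> \<le> (\<integral>y. \<bar>f y * \<rho> e y\<bar> \<partial>lborel)" by (rule integral_abs_bound)
  also have "\<dots> \<le> (\<integral>y. B * \<rho> e y \<partial>lborel)"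
  proof (rule integral_mono)
    show "\<bar>f y * \<rho> e y\<bar> \<le> B * \<rho> e y" for y
      using le[of y] \<rho>_outside[OF e(1), of y] by (cases "norm y \<le> e") (auto simp: abs_mult mult_right_mono)
  qed (use i \<rho>_integrable e in auto)
  also have "\<dots> = B * c0" using \<rho>_integral[OF e(1)] by simp
  finally show ?thesis .
qed

lemma moll_tame:
  assumes \<eta>: "tame A \<eta>" and e: "0 < e" "e \<le> 1"
  shows "tame (8 * A * c0) (moll e \<eta>)"
proof -
  have [measurable]: "\<eta> \<in> borel_measurable borel" by (rule tameD[OF \<eta>])
  have A: "0 \<le> A" by (rule tameD(4)[OF \<eta>])
  have wle: "A * w (x + y) \<le> 8 * A * w x" if "norm y \<le> e" for x y
    using mult_left_mono[OF w_near[of y x] A] that e by simp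
  show ?thesis
    unfolding tame_def
  proof (intro conjI allI impI)
    show "moll e \<eta> \<in> borel_measurable borel" by measurable
    show "\<bar>moll e \<eta> x\<bar> \<le> 8 * A * c0 * w x" for x
    proof -
      have "\<bar>moll e \<eta> x\<bar> \<le> (8 * A * w x) * c0"
        unfolding moll_shift[OF tameD(1)[OF \<eta>]]
        using wle tameD(2)[OF \<eta>] by (intro moll_bound e moll_integrable[OF \<eta>]) (auto intro: order_trans)
      then show ?thesis by (simp add: mult_ac)
    qed
    show "\<bar>moll e \<eta> x - moll e \<eta> (x + y)\<bar> \<le> 8 * A * c0 * w x * norm y" if y: "norm y \<le> 1" for x y
    proof -
      have eq: "moll e \<eta> x - moll e \<eta> (x + y) = (\<integral>h. (\<eta> (x + h) - \<eta> (x + y + h)) * \<rho> e h \<partial>lborel)"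
        unfolding moll_shift[OF tameD(1)[OF \<eta>]]
        by (subst Bochner_Integration.integral_diff[symmetric]) (auto intro!: moll_integrable[OF \<eta>] e simp: left_diff_distrib)
      have "\<bar>moll e \<eta> x - moll e \<eta> (x + y)\<bar> \<le> (8 * A * w x * norm y) * c0"
        unfolding eq
      proof (rule moll_bound[OF e])
        show "integrable lborel (\<lambda>h. (\<eta> (x + h) - \<eta> (x + y + h)) * \<rho> e h)"
          unfolding left_diff_distrib by (intro Bochner_Integration.integrable_diff moll_integrable[OF \<eta>] e)
        fix h :: "real^2" assume h: "norm h \<le> e"
        have "\<bar>\<eta> (x + h) - \<eta> (x + y + h)\<bar> \<le> A * w (x + h) * norm y"
          using tameD(3)[OF \<eta> y, of "x + h"] by (simp add: ac_simps)
        also have "\<dots> \<le> 8 * A * w x * norm y" by (intro mult_right_mono wle h) auto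
        finally show "\<bar>\<eta> (x + h) - \<eta> (x + y + h)\<bar> \<le> 8 * A * w x * norm y" .
      qed measurable
      then show ?thesis by (simp add: mult_ac)
    qed
  qed
qed

lemma moll_limit:
  assumes \<eta>: "tame A \<eta>" and e: "\<And>n::nat. 0 < e n" "\<And>n. e n \<le> 1" "e \<longlonglongrightarrow> 0"
  shows "(\<lambda>n. moll (e n) \<eta> x) \<longlonglongrightarrow> c0 * \<eta> x"
proof -
  have [measurable]: "\<eta> \<in> borel_measurable borel" by (rule tameD[OF \<eta>])
  have "(\<lambda>n. moll (e n) \<eta> x - c0 * \<eta> x) \<longlonglongrightarrow> 0"
  proof (rule Lim_null_comparison)
    show "(\<lambda>n. (A * w x * e n) * c0) \<longlonglongrightarrow> 0" by (rule tendsto_eq_intros e(3) refl)+ simp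
    show "\<forall>\<^sub>F n in sequentially. norm (moll (e n) \<eta> x - c0 * \<eta> x) \<le> (A * w x * e n) * c0"
    proof (rule always_eventually, rule allI)
      fix n
      have "moll (e n) \<eta> x - c0 * \<eta> x = (\<integral>y. (\<eta> (x + y) - \<eta> x) * \<rho> (e n) y \<partial>lborel)"
        unfolding moll_shift[OF tameD(1)[OF \<eta>]] left_diff_distrib
        using \<rho>_integrable[OF e(1)[of n]] \<rho>_integral[OF e(1)[of n]] moll_integrable[OF \<eta> e(1)[of n], of x]
        by (simp add: mult.commute[of c0])
      also have "\<bar>\<dots>\<bar> \<le> (A * w x * e n) * c0"
      proof (rule moll_bound)
        show "integrable lborel (\<lambda>y. (\<eta> (x + y) - \<eta> x) * \<rho> (e n) y)"
          unfolding left_diff_distrib using \<rho>_integrable[OF e(1)[of n]]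
          by (intro Bochner_Integration.integrable_diff moll_integrable[OF \<eta>] e integrable_mult_right)
        fix y :: "real^2" assume y: "norm y \<le> e n"
        have "\<bar>\<eta> (x + y) - \<eta> x\<bar> \<le> A * w x * norm y"
          using tameD(3)[OF \<eta>, of y x] y e(2)[of n] by (simp add: abs_minus_commute)
        also have "\<dots> \<le> A * w x * e n" using tameD(4)[OF \<eta>] by (intro mult_left_mono y) auto
        finally show "\<bar>\<eta> (x + y) - \<eta> x\<bar> \<le> A * w x * e n" .
      qed (use e in auto)
      finally show "norm (moll (e n) \<eta> x - c0 * \<eta> x) \<le> (A * w x * e n) * c0" by simp
    qed
  qed
  then show ?thesis by (simp add: LIM_zero_iff)
qed

lemma moll_frac_lap:
  assumes \<eta>: "tame A \<eta>" and e: "0 < e"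
  shows "frac_lap s (moll e \<eta>) z = (\<integral>x. \<eta> x * frac_lap s (\<rho> e) (z - x) \<partial>lborel)"
proof -
  have [measurable]: "\<eta> \<in> borel_measurable borel" by (rule tameD[OF \<eta>])
  obtain B where B: "tame B (\<rho> e)" using \<rho>_tame[OF e] by blast
  let ?f = "\<lambda>(x, y). \<eta> x * ((\<rho> e (z - x) - \<rho> e (z - x + y)) * K y)"
  have "integrable (lborel \<Otimes>\<^sub>M lborel) ?f"
  proof (rule lborel_pair.Fubini_integrable)
    show "?f \<in> borel_measurable (lborel \<Otimes>\<^sub>M lborel)" by measurable
    show "AE x in lborel. integrable lborel (\<lambda>y. ?f (x, y))" using tame_integrable[OF B] by simp
    show "integrable lborel (\<lambda>x. \<integral>y. norm (?f (x, y)) \<partial>lborel)"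
    proof (rule Bochner_Integration.integrable_bound[OF integrable_mult_right[OF integrable_norm[OF tame_integrable_self[OF \<eta>]], of "B * cL"]])
      show "AE x in lborel. norm (\<integral>y. norm (?f (x, y)) \<partial>lborel) \<le> norm (B * cL * norm (\<eta> x))"
      proof (rule AE_I2)
        fix x
        have "(\<integral>y. norm ((\<rho> e (z - x) - \<rho> e (z - x + y)) * K y) \<partial>lborel) \<le> (\<integral>y. B * w (z - x) * (9 * m y + 8 * w (z - x + y)) \<partial>lborel)"
          by (intro integral_mono integrable_norm integrable_kernel_majorant tame_integrable[OF B])
             (simp_all add: abs_mult tame_kernel_bound[OF B])
        also have "\<dots> = B * cL * w (z - x)" by (simp only: integral_kernel_majorant) (simp add: mult_ac)
        also have "\<dots> \<le> B * cL * 1" using tameD(4)[OF B] cL_nonneg by (intro mult_left_mono w_le_1) auto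
        finally have "\<bar>\<eta> x\<bar> * (\<integral>y. norm ((\<rho> e (z - x) - \<rho> e (z - x + y)) * K y) \<partial>lborel) \<le> \<bar>\<eta> x\<bar> * (B * cL * 1)"
          by (rule mult_left_mono) simp
        moreover have "(\<integral>y. norm (?f (x, y)) \<partial>lborel) = \<bar>\<eta> x\<bar> * (\<integral>y. norm ((\<rho> e (z - x) - \<rho> e (z - x + y)) * K y) \<partial>lborel)"
          by (simp add: norm_mult abs_mult)
        moreover have "0 \<le> (\<integral>y. norm (?f (x, y)) \<partial>lborel)" by (intro integral_nonneg_AE) auto
        ultimately show "norm (\<integral>y. norm (?f (x, y)) \<partial>lborel) \<le> norm (B * cL * norm (\<eta> x))"
          using tameD(4)[OF B] cL_nonneg by (simp add: mult_ac)
      qed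
    qed measurable
  qed
  then have F: "(\<integral>x. (\<integral>y. \<eta> x * ((\<rho> e (z - x) - \<rho> e (z - x + y)) * K y) \<partial>lborel) \<partial>lborel)
      = (\<integral>y. (\<integral>x. \<eta> x * ((\<rho> e (z - x) - \<rho> e (z - x + y)) * K y) \<partial>lborel) \<partial>lborel)"
    by (rule lborel_pair.Fubini_integral[symmetric])
  have int: "integrable lborel (\<lambda>x. \<eta> x * \<rho> e (a - x))" for a
  proof -
    have "integrable lborel (\<lambda>y. \<eta> (a + y) * \<rho> e (a - (a + y)))"
      using moll_integrable[OF \<eta> e, of a] by simp
    then show ?thesis by (subst (asm) integrable_translate[of "\<lambda>y. \<eta> y * \<rho> e (a - y)"]) auto
  qed
  have "frac_lap s (moll e \<eta>) z = (\<integral>y. (\<integral>x. \<eta> x * ((\<rho> e (z - x) - \<rho> e (z - x + y)) * K y) \<partial>lborel) \<partial>lborel)"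
    unfolding frac_lap_K
  proof (rule Bochner_Integration.integral_cong[OF refl])
    fix y
    have "moll e \<eta> z - moll e \<eta> (z + y) = (\<integral>x. \<eta> x * (\<rho> e (z - x) - \<rho> e (z + y - x)) \<partial>lborel)"
      unfolding moll_def right_diff_distrib by (subst Bochner_Integration.integral_diff[OF int int]) simp
    then have "(moll e \<eta> z - moll e \<eta> (z + y)) * K y = (\<integral>x. \<eta> x * (\<rho> e (z - x) - \<rho> e (z + y - x)) * K y \<partial>lborel)"
      by (simp only: integral_mult_left_zero)
    moreover have "z + y - x = z - x + y" for x by simp
    ultimately show "(moll e \<eta> z - moll e \<eta> (z + y)) * K y = (\<integral>x. \<eta> x * ((\<rho> e (z - x) - \<rho> e (z - x + y)) * K y) \<partial>lborel)"
      by (simp only: mult.assoc)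
  qed
  also have "\<dots> = (\<integral>x. \<eta> x * frac_lap s (\<rho> e) (z - x) \<partial>lborel)"
    unfolding F[symmetric] by (simp add: frac_lap_K)
  finally show ?thesis .
qed

text \<open>The support condition confines the shift \<open>x\<close>, so all translates of
  \<open>P\<close> have the common majorant \<open>D * w\<close>, and Fubini's theorem applies
  although \<open>v\<close> is controlled only through its weighted integral.\<close>

lemma swap_convolution:
  assumes v: "regular v" and \<eta>: "tame A \<eta>" and supp: "\<And>x. R < norm x \<Longrightarrow> \<eta> x = 0"
    and [measurable]: "P \<in> borel_measurable borel" and P: "\<And>z. \<bar>P z\<bar> \<le> C * w z" and R: "0 \<le> R"
  shows "(\<integral>z. v z * (\<integral>x. \<eta> x * P (z - x) \<partial>lborel) \<partial>lborel) = (\<integral>x. (\<integral>z. v z * P (z - x) \<partial>lborel) * \<eta> x \<partial>lborel)"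
    and "integrable lborel (\<lambda>x. (\<integral>z. v z * P (z - x) \<partial>lborel) * \<eta> x)"
proof -
  have [measurable]: "\<eta> \<in> borel_measurable borel" "v \<in> borel_measurable borel" 
    by (rule tameD[OF \<eta>], rule regular_measurable[OF v])
  have C: "0 \<le> C"
  proof -
    have "0 \<le> C * w 0" using P[of 0] by linarith
    then show ?thesis using w_pos[of 0] by (simp add: zero_le_mult_iff)
  qed
  define D where "D = C * (1 + R) powr (2 + s)"
  have D: "0 \<le> D" using C by (simp add: D_def)
  have PD: "\<bar>P (z - x)\<bar> \<le> D * w z" if "norm x \<le> R" for x z
  proof -
    have "(1 + norm x) powr (2 + s) * w z \<le> (1 + R) powr (2 + s) * w z"
      using that s0 by (intro mult_right_mono powr_mono2) auto
    then have "w (z - x) \<le> (1 + R) powr (2 + s) * w z" using w_translate[of z "-x"] by simp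
    then have "C * w (z - x) \<le> D * w z" unfolding D_def mult.assoc by (rule mult_left_mono[OF _ C])
    then show ?thesis using P[of "z - x"] by linarith
  qed
  have wi: "integrable lborel (\<lambda>z. v z * P (z - x))" if "norm x \<le> R" for x
    using PD[OF that] by (intro weighted_integrable[OF v]) auto
  let ?f = "\<lambda>(x, z). \<eta> x * (v z * P (z - x))"
  let ?W = "\<integral>z. \<bar>v z\<bar> * w z \<partial>lborel"
  have int: "integrable (lborel \<Otimes>\<^sub>M lborel) ?f"
  proof (rule lborel_pair.Fubini_integrable)
    show "?f \<in> borel_measurable (lborel \<Otimes>\<^sub>M lborel)" by measurable
    show "AE x in lborel. integrable lborel (\<lambda>z. ?f (x, z))"
    proof (rule AE_I2)
      fix x show "integrable lborel (\<lambda>z. ?f (x, z))"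
        using wi[of x] supp[of x] by (cases "norm x \<le> R") auto
    qed
    show "integrable lborel (\<lambda>x. \<integral>z. norm (?f (x, z)) \<partial>lborel)"
    proof (rule Bochner_Integration.integrable_bound[OF integrable_mult_right[OF integrable_norm[OF tame_integrable_self[OF \<eta>]], of "D * ?W"]])
      show "AE x in lborel. norm (\<integral>z. norm (?f (x, z)) \<partial>lborel) \<le> norm (D * ?W * norm (\<eta> x))"
      proof (rule AE_I2)
        fix x
        show "norm (\<integral>z. norm (?f (x, z)) \<partial>lborel) \<le> norm (D * ?W * norm (\<eta> x))"
        proof (cases "norm x \<le> R")
          case True
          have "(\<integral>z. norm (v z * P (z - x)) \<partial>lborel) \<le> (\<integral>z. D * (\<bar>v z\<bar> * w z) \<partial>lborel)"
          proof (rule integral_mono)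
            show "integrable lborel (\<lambda>z. norm (v z * P (z - x)))" using wi[OF True] by (rule integrable_norm)
            show "integrable lborel (\<lambda>z. D * (\<bar>v z\<bar> * w z))" using regular_weighted[OF v] by simp
            show "norm (v z * P (z - x)) \<le> D * (\<bar>v z\<bar> * w z)" for z
              using mult_left_mono[OF PD[OF True, of z], of "\<bar>v z\<bar>"] by (simp add: abs_mult mult_ac)
          qed
          also have "\<dots> = D * ?W" by simp
          finally have "\<bar>\<eta> x\<bar> * (\<integral>z. norm (v z * P (z - x)) \<partial>lborel) \<le> \<bar>\<eta> x\<bar> * (D * ?W)"
            by (rule mult_left_mono) simp
          moreover have "(\<integral>z. norm (?f (x, z)) \<partial>lborel) = \<bar>\<eta> x\<bar> * (\<integral>z. norm (v z * P (z - x)) \<partial>lborel)"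
            by (simp add: norm_mult abs_mult)
          moreover have "0 \<le> (\<integral>z. norm (?f (x, z)) \<partial>lborel)" by (intro integral_nonneg_AE) auto
          moreover have "0 \<le> ?W" by (intro integral_nonneg_AE) auto
          ultimately show ?thesis using D by (simp add: mult_ac)
        qed (simp add: supp)
      qed
    qed measurable
  qed
  have "(\<integral>z. v z * (\<integral>x. \<eta> x * P (z - x) \<partial>lborel) \<partial>lborel) = (\<integral>z. (\<integral>x. \<eta> x * (v z * P (z - x)) \<partial>lborel) \<partial>lborel)"
    by (subst integral_mult_right_zero[symmetric]) (simp add: mult_ac)
  also have "\<dots> = (\<integral>x. (\<integral>z. \<eta> x * (v z * P (z - x)) \<partial>lborel) \<partial>lborel)"
    by (rule lborel_pair.Fubini_integral[OF int])
  also have "\<dots> = (\<integral>x. (\<integral>z. v z * P (z - x) \<partial>lborel) * \<eta> x \<partial>lborel)" by (simp add: mult.commute)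
  finally show "(\<integral>z. v z * (\<integral>x. \<eta> x * P (z - x) \<partial>lborel) \<partial>lborel) = (\<integral>x. (\<integral>z. v z * P (z - x) \<partial>lborel) * \<eta> x \<partial>lborel)" .
  have "integrable lborel (\<lambda>x. \<integral>z. \<eta> x * (v z * P (z - x)) \<partial>lborel)"
    using lborel_pair.integrable_fst'[OF int] by simp
  then show "integrable lborel (\<lambda>x. (\<integral>z. v z * P (z - x) \<partial>lborel) * \<eta> x)" by (simp add: mult.commute)
qed

lemma weak_form_moll:
  assumes v: "regular v" and b: "regular b" and \<eta>: "tame A \<eta>" and supp: "\<And>x. R < norm x \<Longrightarrow> \<eta> x = 0" and R: "0 \<le> R" and e: "0 < e"
  shows "weak_form v b (moll e \<eta>) = (\<integral>x. moll_form v b e x * \<eta> x \<partial>lborel)" and "integrable lborel (\<lambda>x. moll_form v b e x * \<eta> x)"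
proof -
  obtain B where B: "tame B (\<rho> e)" using \<rho>_tame[OF e] by blast
  have 1: "\<bar>frac_lap s (\<rho> e) z\<bar> \<le> B * cL * w z" for z by (rule tame_frac_lap[OF B])
  have 2: "\<bar>\<rho> e z\<bar> \<le> B * w z" for z by (rule tameD[OF B])
  have m: "frac_lap s (\<rho> e) \<in> borel_measurable borel" by measurable
  note s1 = swap_convolution[OF v \<eta> supp m 1 R, simplified]
  note s2 = swap_convolution[OF b \<eta> supp \<rho>_measurable 2 R, simplified]
  have "weak_form v b (moll e \<eta>) = (\<integral>x. (\<integral>z. v z * frac_lap s (\<rho> e) (z - x) \<partial>lborel) * \<eta> x \<partial>lborel) + (\<integral>x. (\<integral>z. b z * \<rho> e (z - x) \<partial>lborel) * \<eta> x \<partial>lborel)"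
    unfolding weak_form_def moll_frac_lap[OF \<eta> e] by (simp only: s1 moll_def s2)
  also have "\<dots> = (\<integral>x. moll_form v b e x * \<eta> x \<partial>lborel)"
    unfolding moll_form_def distrib_right by (rule Bochner_Integration.integral_add[OF s1(2) s2(2), symmetric])
  finally show "weak_form v b (moll e \<eta>) = (\<integral>x. moll_form v b e x * \<eta> x \<partial>lborel)" .
  show "integrable lborel (\<lambda>x. moll_form v b e x * \<eta> x)"
    unfolding moll_form_def distrib_right by (rule Bochner_Integration.integrable_add[OF s1(2) s2(2)])
qed

lemma weak_form_cmult: "weak_form v b (\<lambda>x. c * \<eta> x) = c * weak_form v b \<eta>"
  unfolding weak_form_def frac_lap_cmult distrib_left
  by (subst (1 2) integral_mult_right_zero[symmetric]) (simp add: mult_ac)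

text \<open>Mollification is moved from \<open>v\<close> and \<open>b\<close> to the test function,
  where convergence holds with a uniform tame constant. In this way signs of
  \<open>moll_form\<close> become signs of \<open>weak_form\<close>.\<close>

lemma weak_form_moll_limit:
  assumes v: "regular v" and b: "regular b" and \<eta>: "tame A \<eta>" and supp: "\<And>x. R < norm x \<Longrightarrow> \<eta> x = 0" and R: "0 \<le> R"
    and e: "\<And>n::nat. 0 < e n" "\<And>n. e n \<le> 1" "e \<longlonglongrightarrow> 0"
  shows "(\<lambda>n. \<integral>x. moll_form v b (e n) x * \<eta> x \<partial>lborel) \<longlonglongrightarrow> c0 * weak_form v b \<eta>"
proof -
  have "(\<lambda>n. weak_form v b (moll (e n) \<eta>)) \<longlonglongrightarrow> weak_form v b (\<lambda>x. c0 * \<eta> x)"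
    by (rule weak_form_limit[OF v b moll_tame[OF \<eta> e(1,2)] moll_limit[OF \<eta> e]])
  then show ?thesis by (simp add: weak_form_moll(1)[OF v b \<eta> supp R e(1)] weak_form_cmult)
qed

text \<open>
  Local validity of the weak inequality. The set of points that are not good is closed; if it were
  nonempty, then by Baire \<^term>\<open>nosc v\<close> would be bounded on a portion of it. Near that portion the mollified form
  is bounded, because at distance \<open>\<le> e\<close> from a point \<open>y\<close> it is controlled by \<^term>\<open>nosc v y\<close>, and elsewhere it is
  nonpositive; since its pointwise limit is nonpositive too, Fatou's lemma makes the points of the portion good.
\<close>

definition good :: "(real^2 \<Rightarrow> real) \<Rightarrow> (real^2 \<Rightarrow> real) \<Rightarrow> real^2 \<Rightarrow> bool" where
  "good v b x \<longleftrightarrow> (\<exists>r>0. \<forall>\<eta> A. tame A \<eta> \<and> (\<forall>z. 0 \<le> \<eta> z) \<and> (\<forall>z. z \<notin> ball x r \<longrightarrow> \<eta> z = 0) \<longrightarrow> weak_form v b \<eta> \<le> 0)"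

section \<open>From pointwise to weak inequalities\<close>

lemma open_good: "open {x. good v b x}"
  unfolding open_contains_ball
proof
  fix x assume "x \<in> {x. good v b x}"
  then obtain r where r: "r > 0" "\<And>\<eta> A. tame A \<eta> \<Longrightarrow> (\<forall>z. 0 \<le> \<eta> z) \<Longrightarrow> (\<forall>z. z \<notin> ball x r \<longrightarrow> \<eta> z = 0) \<Longrightarrow> weak_form v b \<eta> \<le> 0"
    unfolding good_def by blast
  have "good v b y" if y: "y \<in> ball x (r / 2)" for y
  proof -
    have "ball y (r / 2) \<subseteq> ball x r"
    proof
      fix z assume "z \<in> ball y (r / 2)"
      then show "z \<in> ball x r" using y dist_triangle[of x z y] by simp
    qed
    then have "weak_form v b \<eta> \<le> 0" if "tame A \<eta>" "\<forall>z. 0 \<le> \<eta> z" "\<forall>z. z \<notin> ball y (r / 2) \<longrightarrow> \<eta> z = 0" for \<eta> A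
      using that by (intro r(2)) blast+
    then show ?thesis unfolding good_def using r(1) by (intro exI[of _ "r / 2"]) auto
  qed
  then show "\<exists>e>0. ball x e \<subseteq> {x. good v b x}" using r(1) by (intro exI[of _ "r / 2"]) auto
qed

text \<open>Below a Lebesgue number \<open>d\<close> of the cover of \<open>S\<close> by good discs,
  each mollifier centred in \<open>S\<close> is an admissible test function for one member of the
  cover. The local inequality becomes a pointwise sign on \<open>S\<close>, uniformly for small
  scales.\<close>

lemma good_compact:
  assumes "compact S" and good: "\<And>x. x \<in> S \<Longrightarrow> good v b x"
  shows "\<exists>d>0. \<forall>x\<in>S. \<forall>e. 0 < e \<and> e \<le> d \<longrightarrow> moll_form v b e x \<le> 0"
proof -
  define ok where "ok B \<longleftrightarrow> (\<forall>\<eta> A. tame A \<eta> \<and> (\<forall>z. 0 \<le> \<eta> z) \<and> (\<forall>z. z \<notin> B \<longrightarrow> \<eta> z = 0) \<longrightarrow> weak_form v b \<eta> \<le> 0)" for B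
  obtain d where d: "0 < d" "\<And>x. x \<in> S \<Longrightarrow> \<exists>B\<in>{B. open B \<and> ok B}. ball x d \<subseteq> B"
  proof (rule Heine_Borel_lemma[OF \<open>compact S\<close>, of "{B. open B \<and> ok B}"])
    show "S \<subseteq> \<Union> {B. open B \<and> ok B}"
    proof
      fix x assume "x \<in> S"
      then obtain r where "r > 0" "ok (ball x r)" using good[of x] unfolding good_def ok_def by blast
      then show "x \<in> \<Union> {B. open B \<and> ok B}" by (intro UnionI[of "ball x r"]) auto
    qed
  qed auto
  have "moll_form v b e x \<le> 0" if x: "x \<in> S" and e: "0 < e" "e \<le> d" for x e
  proof -
    obtain B where B: "ok B" "ball x d \<subseteq> B" using d(2)[OF x] by blast
    obtain A where A: "tame A (\<lambda>z. \<rho> e (z - x))" using \<rho>_tame[OF e(1)] tame_translate by blast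
    have "\<rho> e (z - x) = 0" if "z \<notin> B" for z
    proof -
      have "z \<notin> ball x d" using that B(2) by blast
      then show ?thesis using e by (intro \<rho>_outside) (auto simp: dist_norm norm_minus_commute)
    qed
    then show ?thesis
      using B(1) A unfolding moll_form_eq ok_def by auto
  qed
  with d(1) show ?thesis by blast
qed

lemma inverse_Suc_tendsto: "(\<lambda>n. 1 / real (Suc n)) \<longlonglongrightarrow> 0"
  using LIMSEQ_inverse_real_of_nat by (simp add: inverse_eq_divide)

text \<open>Local inequalities are glued through mollification: \<open>good_compact\<close> gives a
  sign on \<open>S\<close>, which is integrated against \<open>\<eta>\<close> before the scale tends
  to 0.\<close>

lemma good_glue:
  assumes v: "regular v" and b: "regular b" and "compact S" and good: "\<And>x. x \<in> S \<Longrightarrow> good v b x"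
    and \<eta>: "tame A \<eta>" "\<And>z. 0 \<le> \<eta> z" "\<And>z. z \<notin> S \<Longrightarrow> \<eta> z = 0"
  shows "weak_form v b \<eta> \<le> 0"
proof -
  obtain d where d: "d > 0" "\<And>x e. x \<in> S \<Longrightarrow> 0 < e \<Longrightarrow> e \<le> d \<Longrightarrow> moll_form v b e x \<le> 0"
    using good_compact[OF \<open>compact S\<close> good] by blast
  obtain R where R: "0 < R" "\<And>x. x \<in> S \<Longrightarrow> norm x \<le> R"
    using compact_imp_bounded[OF \<open>compact S\<close>] bounded_pos by metis
  have lim: "(\<lambda>n. \<integral>x. moll_form v b (1 / real (Suc n)) x * \<eta> x \<partial>lborel) \<longlonglongrightarrow> c0 * weak_form v b \<eta>"
  proof (rule weak_form_moll_limit[OF v b \<eta>(1), of R])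
    show "\<eta> x = 0" if "R < norm x" for x using R(2)[of x] that by (intro \<eta>(3)) auto
  qed (use R inverse_Suc_tendsto in auto)
  have "\<forall>\<^sub>F n in sequentially. 1 / real (Suc n) < d" using inverse_Suc_tendsto d(1) by (rule order_tendstoD(2))
  then have "\<forall>\<^sub>F n in sequentially. (\<integral>x. moll_form v b (1 / real (Suc n)) x * \<eta> x \<partial>lborel) \<le> 0"
  proof eventually_elim
    case (elim n)
    have "0 \<le> (\<integral>x. - (moll_form v b (1 / real (Suc n)) x * \<eta> x) \<partial>lborel)"
    proof (intro integral_nonneg_AE AE_I2)
      fix x
      have "moll_form v b (1 / real (Suc n)) x * \<eta> x \<le> 0"
        using d(2)[of x "1 / real (Suc n)"] elim \<eta>(2,3)[of x] by (cases "x \<in> S") (auto intro: mult_nonpos_nonneg)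
      then show "0 \<le> - (moll_form v b (1 / real (Suc n)) x * \<eta> x)" by simp
    qed
    then show ?case by simp
  qed
  then have "c0 * weak_form v b \<eta> \<le> 0" by (rule tendsto_upperbound[OF lim]) simp
  then show ?thesis using c0_pos by (simp add: mult_le_0_iff)
qed

lemma all_good:
  assumes v: "regular v" and b: "regular b" and M: "\<And>x. \<bar>b x\<bar> \<le> M" and sub: "\<And>x. frac_lap s v x + b x \<le> 0"
  shows "good v b x"
proof (rule ccontr)
  let ?C = "- {x. good v b x}"
  assume "\<not> good v b x"
  then have "?C \<noteq> {}" by auto
  moreover have "closed ?C" using open_good by (simp add: closed_Compl)
  ultimately obtain x0 r N where x0: "\<not> good v b x0" and r: "r > 0" and N: "\<And>y. \<not> good v b y \<Longrightarrow> y \<in> ball x0 r \<Longrightarrow> nosc v y \<le> N"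
    using regular_portion[OF v, of ?C] by (metis (mono_tags, lifting) ComplD ComplI IntI mem_Collect_eq)
  define B where "B = A\<rho> * max 0 N + M * c0"
  have M0: "0 \<le> M" using M[of 0] by linarith
  have B0: "0 \<le> B" unfolding B_def using A\<rho>_nonneg M0 c0_nonneg by (intro add_nonneg_nonneg mult_nonneg_nonneg) auto
  \<comment> \<open>If a bad point lies within distance \<open>e\<close> of \<open>x\<close>, it
    belongs to the portion where \<open>nosc v\<close> is at most \<open>N\<close>. Otherwise all of
    \<open>cball x e\<close> is good, and the glued inequality, tested with the mollifier itself,
    makes the form nonpositive.\<close>
  have TB: "moll_form v b e x \<le> B" if e: "0 < e" "e < r / 2" and x: "x \<in> ball x0 (r / 2)" for e x
  proof (cases "\<exists>y. \<not> good v b y \<and> norm (x - y) \<le> e")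
    case True
    then obtain y where y: "\<not> good v b y" "norm (x - y) \<le> e" by blast
    have "dist x0 y \<le> dist x0 x + dist x y" by (rule dist_triangle)
    then have "nosc v y \<le> N" using y x e by (intro N) (auto simp: dist_norm)
    then have "A\<rho> * nosc v y \<le> A\<rho> * max 0 N" using A\<rho>_nonneg by (intro mult_left_mono) auto
    then show ?thesis using moll_form_bound[OF v b M e(1) y(2)] unfolding B_def by linarith
  next
    case False
    obtain A where A: "tame A (\<lambda>z. \<rho> e (z - x))" using \<rho>_tame[OF e(1)] tame_translate by blast
    have "weak_form v b (\<lambda>z. \<rho> e (z - x)) \<le> 0"
    proof (rule good_glue[OF v b compact_cball[of x e] _ A])
      show "good v b y" if "y \<in> cball x e" for y using False that by (auto simp: dist_norm)
      show "\<rho> e (z - x) = 0" if "z \<notin> cball x e" for z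
        using that e by (intro \<rho>_outside) (auto simp: dist_norm norm_minus_commute)
    qed simp
    then show ?thesis using B0 by (simp add: moll_form_eq)
  qed
  have "good v b x0"
    unfolding good_def
  proof (intro exI[of _ "r / 2"] conjI allI impI)
    fix \<eta> A assume "tame A \<eta> \<and> (\<forall>z. 0 \<le> \<eta> z) \<and> (\<forall>z. z \<notin> ball x0 (r / 2) \<longrightarrow> \<eta> z = 0)"
    then have \<eta>: "tame A \<eta>" "\<forall>z. 0 \<le> \<eta> z" "\<forall>z. z \<notin> ball x0 (r / 2) \<longrightarrow> \<eta> z = 0" by blast+
    \<comment> \<open>Scales at most 1, as \<open>weak_form_moll_limit\<close> requires, and below
      \<open>r / 2\<close>, as \<open>TB\<close> requires.\<close>
    define e where "e n = min 1 (r / 4) / real (Suc n)" for n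
    have e: "0 < e n" "e n \<le> 1" "e n < r / 2" for n
    proof -
      have "e n \<le> min 1 (r / 4) / 1" unfolding e_def using r by (intro divide_left_mono) auto
      then show "e n \<le> 1" "e n < r / 2" using r by auto
      show "0 < e n" unfolding e_def using r by simp
    qed
    have elim: "e \<longlonglongrightarrow> 0" 
      using tendsto_mult_right_zero[OF inverse_Suc_tendsto, of "min 1 (r / 4)"] by (simp add: e_def[abs_def])
    let ?R = "norm x0 + r"
    have supp: "\<eta> x = 0" if "?R < norm x" for x
    proof -
      have "x \<notin> ball x0 (r / 2)" using that r norm_triangle_ineq2[of x x0] by (auto simp: dist_norm norm_minus_commute)
      then show ?thesis using \<eta>(3) by blast
    qed
    have R: "0 \<le> ?R" using r by (simp add: add_nonneg_nonneg)
    have [measurable]: "\<eta> \<in> borel_measurable borel" "v \<in> borel_measurable borel" "b \<in> borel_measurable borel"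
      by (rule tameD[OF \<eta>(1)], rule regular_measurable, fact, rule regular_measurable, fact)
    have [measurable]: "moll_form v b (e n) \<in> borel_measurable borel" for n unfolding moll_form_def by measurable
    have lim: "(\<lambda>n. \<integral>x. moll_form v b (e n) x * \<eta> x \<partial>lborel) \<longlonglongrightarrow> c0 * weak_form v b \<eta>"
      by (rule weak_form_moll_limit[OF v b \<eta>(1) supp R e(1,2) elim])
    have i\<eta>: "integrable lborel (\<lambda>x. B * \<eta> x)" using tame_integrable_self[OF \<eta>(1)] by simp
    have bnd: "norm (max 0 (moll_form v b (e n) x) * \<eta> x) \<le> B * \<eta> x" for n x
      using \<eta>(2,3) TB[OF e(1,3), of x n] B0 by (cases "x \<in> ball x0 (r / 2)") (auto intro!: mult_right_mono simp: abs_mult)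
    \<comment> \<open>Only an upper bound on the mollified form is known, so the limit is taken for
      its positive part, which tends to 0 by the pointwise inequality.\<close>
    have lim0: "(\<lambda>n. \<integral>x. max 0 (moll_form v b (e n) x) * \<eta> x \<partial>lborel) \<longlonglongrightarrow> (\<integral>x. max 0 (c0 * (frac_lap s v x + b x)) * \<eta> x \<partial>lborel)"
    proof (rule integral_dominated_convergence[OF _ _ i\<eta>])
      show "AE x in lborel. (\<lambda>n. max 0 (moll_form v b (e n) x) * \<eta> x) \<longlonglongrightarrow> max 0 (c0 * (frac_lap s v x + b x)) * \<eta> x"
        by (intro AE_I2 tendsto_intros moll_form_limit[OF v b e(1) elim])
    qed (use bnd in \<open>auto simp del: real_norm_def\<close>)
    have "c0 * weak_form v b \<eta> \<le> (\<integral>x. max 0 (c0 * (frac_lap s v x + b x)) * \<eta> x \<partial>lborel)"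
    proof (rule LIMSEQ_le[OF lim lim0], intro exI allI impI)
      fix n
      show "(\<integral>x. moll_form v b (e n) x * \<eta> x \<partial>lborel) \<le> (\<integral>x. max 0 (moll_form v b (e n) x) * \<eta> x \<partial>lborel)"
      proof (rule integral_mono)
        show "integrable lborel (\<lambda>x. moll_form v b (e n) x * \<eta> x)" by (rule weak_form_moll(2)[OF v b \<eta>(1) supp R e(1)])
        show "integrable lborel (\<lambda>x. max 0 (moll_form v b (e n) x) * \<eta> x)"
          by (intro Bochner_Integration.integrable_bound[OF i\<eta>] AE_I2)
             (auto intro: order_trans[OF bnd[unfolded real_norm_def] abs_ge_self])
        show "moll_form v b (e n) x * \<eta> x \<le> max 0 (moll_form v b (e n) x) * \<eta> x" for x using \<eta>(2) by (intro mult_right_mono) auto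
      qed
    qed
    also have "\<dots> = (\<integral>x. 0 \<partial>(lborel :: (real^2) measure))"
    proof (rule Bochner_Integration.integral_cong[OF refl])
      fix x
      have "c0 * (frac_lap s v x + b x) \<le> 0" using c0_nonneg sub[of x] by (rule mult_nonneg_nonpos)
      then show "max 0 (c0 * (frac_lap s v x + b x)) * \<eta> x = 0" by (simp add: max_def)
    qed
    finally show "weak_form v b \<eta> \<le> 0" using c0_pos by (simp add: mult_le_0_iff)
  qed (use r in simp)
  with x0 show False by blast
qed

text \<open>The cutoffs \<open>c n\<close> are 1-Lipschitz at every radius, so the truncated test
  functions are tame with the common constant \<open>9 * A\<close> (1 from the increments of
  \<open>\<eta>\<close>, 8 from \<open>w_near\<close>), and the weak form passes to the
  limit.\<close>

theorem weak_inequality: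
  assumes v: "regular v" and b: "regular b" and M: "\<And>x. \<bar>b x\<bar> \<le> M" and sub: "\<And>x. frac_lap s v x + b x \<le> 0"
    and \<eta>: "tame A \<eta>" "\<And>z. 0 \<le> \<eta> z"
  shows "weak_form v b \<eta> \<le> 0"
proof -
  define c :: "nat \<Rightarrow> real^2 \<Rightarrow> real" where "c n x = max 0 (min 1 (2 + real n - norm x))" for n x
  have c: "0 \<le> c n x" "c n x \<le> 1" for n x by (auto simp: c_def)
  have clip: "\<bar>c n x - c n (x + y)\<bar> \<le> norm y" for n x y
    using norm_triangle_ineq3[of x "x + y"] unfolding c_def by simp
  have [measurable]: "\<eta> \<in> borel_measurable borel" by (rule tameD[OF \<eta>(1)])
  have A: "0 \<le> A" by (rule tameD(4)[OF \<eta>(1)])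
  have t: "tame (9 * A) (\<lambda>x. c n x * \<eta> x)" for n
    unfolding tame_def
  proof (intro conjI allI impI)
    show "(\<lambda>x. c n x * \<eta> x) \<in> borel_measurable borel" unfolding c_def by measurable
    show "\<bar>c n x * \<eta> x\<bar> \<le> 9 * A * w x" for x
    proof -
      have "\<bar>c n x * \<eta> x\<bar> \<le> 1 * (A * w x)" unfolding abs_mult using c tameD(2)[OF \<eta>(1)] by (intro mult_mono) auto
      also have "\<dots> \<le> 9 * A * w x" using A by simp
      finally show ?thesis .
    qed
    fix x y :: "real^2" assume y: "norm y \<le> 1"
    have "c n x * \<eta> x - c n (x + y) * \<eta> (x + y) = c n x * (\<eta> x - \<eta> (x + y)) + (c n x - c n (x + y)) * \<eta> (x + y)"
      by (simp add: algebra_simps)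
    also have "\<bar>\<dots>\<bar> \<le> \<bar>c n x * (\<eta> x - \<eta> (x + y))\<bar> + \<bar>(c n x - c n (x + y)) * \<eta> (x + y)\<bar>"
      by (rule abs_triangle_ineq)
    also have "\<dots> \<le> 1 * (A * w x * norm y) + norm y * (A * (8 * w x))"
    proof (rule add_mono)
      show "\<bar>c n x * (\<eta> x - \<eta> (x + y))\<bar> \<le> 1 * (A * w x * norm y)"
        unfolding abs_mult using c tameD(3)[OF \<eta>(1) y] by (intro mult_mono) auto
      have "\<bar>\<eta> (x + y)\<bar> \<le> A * (8 * w x)"
        using tameD(2)[OF \<eta>(1), of "x + y"] mult_left_mono[OF w_near[OF y, of x] A] by linarith
      then show "\<bar>(c n x - c n (x + y)) * \<eta> (x + y)\<bar> \<le> norm y * (A * (8 * w x))"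
        unfolding abs_mult using clip by (intro mult_mono) auto
    qed
    also have "\<dots> = 9 * A * w x * norm y" by (simp add: algebra_simps)
    finally show "\<bar>c n x * \<eta> x - c n (x + y) * \<eta> (x + y)\<bar> \<le> 9 * A * w x * norm y" .
  qed
  have "weak_form v b (\<lambda>x. c n x * \<eta> x) \<le> 0" for n
  proof (rule good_glue[OF v b compact_cball[of 0 "2 + real n"] all_good[OF v b M sub] t])
    show "0 \<le> c n z * \<eta> z" for z using c \<eta>(2) by simp
    show "c n z * \<eta> z = 0" if "z \<notin> cball 0 (2 + real n)" for z using that by (simp add: c_def)
  qed
  moreover have "(\<lambda>n. weak_form v b (\<lambda>x. c n x * \<eta> x)) \<longlonglongrightarrow> weak_form v b \<eta>"
  proof (rule weak_form_limit[OF v b t])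
    fix x :: "real^2"
    obtain N where N: "norm x \<le> real N" using real_arch_simple by blast
    have "\<forall>\<^sub>F n in sequentially. \<eta> x = c n x * \<eta> x"
      using eventually_ge_at_top[of N] by eventually_elim (use N in \<open>simp add: c_def\<close>)
    then show "(\<lambda>n. c n x * \<eta> x) \<longlonglongrightarrow> \<eta> x" by (rule Lim_transform_eventually[OF tendsto_const])
  qed
  ultimately show ?thesis by (intro LIMSEQ_le_const2) auto
qed

subsection \<open>A priori bounds for solutions\<close>

text \<open>Measurability of \<open>u\<close> is itself extracted from the equation: integrability
  of the quotient at the point 0 contains measurability, and multiplying by
  \<open>norm y powr (2 + s)\<close> recovers \<open>u\<close>.\<close>

lemma solution_regular:
  assumes "is_solution s u"
  shows "regular u"
proof -
  have i: "integrable lborel (\<lambda>y. (u x - u (x + y)) / norm y powr (2 + s))" for x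
    using assms by (simp add: is_solution_def)
  have [measurable]: "(\<lambda>y. (u 0 - u (0 + y)) / norm y powr (2 + s)) \<in> borel_measurable borel"
    using borel_measurable_integrable[OF i[of 0]] by simp
  have "u = (\<lambda>y. u 0 - (u 0 - u (0 + y)) / norm y powr (2 + s) * norm y powr (2 + s))"
  proof
    fix y show "u y = u 0 - (u 0 - u (0 + y)) / norm y powr (2 + s) * norm y powr (2 + s)"
      by (cases "y = 0") auto
  qed
  moreover have "\<dots> \<in> borel_measurable borel" by measurable
  ultimately have [measurable]: "u \<in> borel_measurable borel" by simp
  have "enosc u x < \<infinity>" for x
  proof -
    have "integrable lborel (\<lambda>y. (u x - u (x + y)) * K y)" using i[of x] by (simp add: K_def)
    then show ?thesis by (simp add: integrable_iff_bounded enosc_shift abs_mult)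
  qed
  then show ?thesis by (simp add: regular_def)
qed

lemma solution_frac_lap: "is_solution s u \<Longrightarrow> frac_lap s u x = u x - (u x) ^ 3"
  by (simp add: is_solution_def)

text \<open>Averages of a regular function converge at every point: this is
  \<open>moll_form_limit\<close> with \<open>v = 0\<close>. A sign that holds almost everywhere
  passes to the averages and hence to each value.\<close>

lemma regular_AE_nonneg:
  assumes f: "regular f" and pos: "AE x in lborel. 0 \<le> f x"
  shows "0 \<le> f x"
proof -
  have z: "regular (\<lambda>_. 0)" by (simp add: regular_def enosc_def)
  have "(\<lambda>n. moll_form (\<lambda>_. 0) f (1 / real (Suc n)) x) \<longlonglongrightarrow> c0 * (frac_lap s (\<lambda>_. 0) x + f x)"
    by (rule moll_form_limit[OF z f _ inverse_Suc_tendsto]) simp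
  then have "(\<lambda>n. \<integral>z. f z * \<rho> (1 / real (Suc n)) (z - x) \<partial>lborel) \<longlonglongrightarrow> c0 * f x"
    by (simp add: moll_form_def frac_lap_def)
  moreover have "0 \<le> (\<integral>z. f z * \<rho> e (z - x) \<partial>lborel)" for e
    using pos by (intro integral_nonneg_AE) auto
  ultimately have "0 \<le> c0 * f x" by (intro LIMSEQ_le_const) auto
  then show ?thesis using c0_pos by (simp add: zero_le_mult_iff)
qed

text \<open>With \<open>r = (1 + norm x) / (1 + norm (x + y))\<close> one has
  \<open>w (x + y) = w x * r powr (2 + s)\<close>. The power is compared with \<open>r^3\<close>, as
  \<open>2 + s \<le> 3\<close>, and factoring \<open>1 - r^3\<close> leaves
  \<open>1 + r + r^2\<close>, at most 7 for \<open>r \<le> 2\<close>.\<close>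

lemma tame_w: "tame 7 w"
  unfolding tame_def
proof (intro conjI allI impI)
  fix x y :: "real^2" assume y: "norm y \<le> 1"
  define p where "p = 2 + s"
  have p: "0 < p" "p \<le> 3" using s0 s1 by (auto simp: p_def)
  define a b where "a = 1 + norm x" and "b = 1 + norm (x + y)"
  have ab: "1 \<le> a" "1 \<le> b" "\<bar>a - b\<bar> \<le> norm y" 
    using norm_triangle_ineq3[of x "x + y"] by (auto simp: a_def b_def)
  define r where "r = a / b"
  have r: "0 < r" "r \<le> 2" using ab y by (auto simp: r_def divide_le_eq)
  have r1: "\<bar>1 - r\<bar> \<le> norm y"
  proof -
    have "\<bar>1 - r\<bar> = \<bar>a - b\<bar> / b" using ab by (simp add: r_def field_simps abs_minus_commute)
    also have "\<dots> \<le> \<bar>a - b\<bar>" using ab by (simp add: divide_le_eq mult_le_cancel_left1)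
    finally show ?thesis using ab by simp
  qed
  have "\<bar>1 - r powr p\<bar> \<le> 7 * \<bar>1 - r\<bar>"
  proof (cases "r \<le> 1")
    case True
    have "r ^ 3 \<le> r powr p" using r True p powr_mono'[of p 3 r] by simp
    moreover have "r powr p \<le> 1" using r True p by (intro powr_le1) auto
    moreover have "1 - r ^ 3 = (1 - r) * (1 + r + r\<^sup>2)" by (simp add: power2_eq_square power3_eq_cube algebra_simps)
    moreover have "(1 - r) * (1 + r + r\<^sup>2) \<le> (1 - r) * 7" 
      using True r by (intro mult_left_mono) (auto intro: order_trans[OF add_mono[OF _ power_le_one]])
    ultimately show ?thesis using True by simp
  next
    case False
    have "r powr p \<le> r ^ 3" using r False p powr_mono[of p 3 r] by simp
    moreover have "1 \<le> r powr p" using False p by (intro ge_one_powr_ge_zero) auto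
    moreover have "r ^ 3 - 1 = (r - 1) * (1 + r + r\<^sup>2)" by (simp add: power2_eq_square power3_eq_cube algebra_simps)
    moreover have "r\<^sup>2 \<le> 4" using r power_mono[of r 2 2] by simp
    moreover have "(r - 1) * (1 + r + r\<^sup>2) \<le> (r - 1) * 7" 
      using False r \<open>r\<^sup>2 \<le> 4\<close> by (intro mult_left_mono) auto
    ultimately show ?thesis using False by simp
  qed
  moreover have "w (x + y) = w x * r powr p"
    using ab by (simp add: w_def r_def powr_divide p_def a_def b_def add_nonneg_eq_0_iff)
  then have "\<bar>w x - w (x + y)\<bar> = w x * \<bar>1 - r powr p\<bar>"
    using abs_mult[of "w x" "1 - r powr p"] by (simp add: algebra_simps)
  ultimately have "\<bar>w x - w (x + y)\<bar> \<le> w x * (7 * norm y)"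
    using r1 by (simp add: mult_left_mono)
  then show "\<bar>w x - w (x + y)\<bar> \<le> 7 * w x * norm y" by (simp add: mult_ac)
qed auto

section \<open>The dilated weight as a test function\<close>

definition W :: "real \<Rightarrow> real^2 \<Rightarrow> real" where
  "W R x = w ((1 / R) *\<^sub>R x)"

lemma W_measurable [measurable]: "W R \<in> borel_measurable borel" unfolding W_def by measurable
lemma W_pos: "0 < W R x" by (simp add: W_def w_pos)
lemma W_nonneg [simp]: "0 \<le> W R x" by (simp add: W_def)

lemma W_tame:
  assumes R: "1 \<le> R"
  shows "tame (7 * R powr (2 + s)) (W R)"
  unfolding tame_def
proof (intro conjI allI impI)
  have le: "W R x \<le> R powr (2 + s) * w x" for x
  proof -
    have "1 + norm x \<le> R * (1 + norm x / R)" using R by (simp add: algebra_simps)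
    then have "(1 + norm x) powr (2 + s) \<le> (R * (1 + norm x / R)) powr (2 + s)"
      using s0 by (intro powr_mono2) auto
    also have "\<dots> = R powr (2 + s) * (1 + norm x / R) powr (2 + s)" using R by (simp add: powr_mult)
    finally show ?thesis 
      using R unfolding W_def w_def by (simp add: divide_simps add_nonneg_eq_0_iff mult.commute)
  qed
  show "\<bar>W R x\<bar> \<le> 7 * R powr (2 + s) * w x" for x
  proof -
    have "1 * (R powr (2 + s) * w x) \<le> 7 * (R powr (2 + s) * w x)" by (intro mult_right_mono) auto
    then show ?thesis using le[of x] W_pos[of R x] by simp
  qed
  fix x y :: "real^2" assume y: "norm y \<le> 1"
  have yR: "norm ((1 / R) *\<^sub>R y) \<le> norm y" using R by (simp add: divide_le_eq mult_le_cancel_left1)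
  then have "\<bar>W R x - W R (x + y)\<bar> \<le> 7 * W R x * norm ((1 / R) *\<^sub>R y)"
    using tameD(3)[OF tame_w, of "(1 / R) *\<^sub>R y" "(1 / R) *\<^sub>R x"] y unfolding W_def by (simp add: scaleR_add_right)
  also have "\<dots> \<le> 7 * (R powr (2 + s) * w x) * norm y"
    using yR le[of x] by (intro mult_mono) auto
  finally show "\<bar>W R x - W R (x + y)\<bar> \<le> 7 * R powr (2 + s) * w x * norm y" by (simp add: mult_ac)
qed measurable

text \<open>The operator has order \<open>s\<close>, so dilation by \<open>R\<close> gains the
  factor \<open>1 / R powr s\<close>: relative to its own size, the weight is nearly annihilated
  when \<open>R\<close> is large.\<close>

lemma W_frac_lap:
  assumes R: "1 \<le> R"
  shows "\<bar>frac_lap s (W R) x\<bar> \<le> 7 * cL / R powr s * W R x"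
proof -
  have "frac_lap s (W R) x = frac_lap s w ((1 / R) *\<^sub>R x) / R powr s"
    unfolding W_def using R by (intro frac_lap_scale) auto
  also have "\<bar>\<dots>\<bar> = \<bar>frac_lap s w ((1 / R) *\<^sub>R x)\<bar> / R powr s" by simp
  also have "\<dots> \<le> 7 * cL * w ((1 / R) *\<^sub>R x) / R powr s"
    by (intro divide_right_mono tame_frac_lap[OF tame_w]) auto
  finally show ?thesis by (simp add: W_def)
qed

lemma W_integral: "1 \<le> R \<Longrightarrow> (\<integral>x. W R x \<partial>lborel) = R\<^sup>2 * (\<integral>x. w x \<partial>lborel)"
  by (subst integral_affine[of _ R 0]) (auto simp: W_def)

lemma W_integrable: "1 \<le> R \<Longrightarrow> integrable lborel (W R)"
  by (rule tame_integrable_self[OF W_tame])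

lemma W_weighted: "regular v \<Longrightarrow> 1 \<le> R \<Longrightarrow> integrable lborel (\<lambda>z. v z * W R z)"
  using tameD(2)[OF W_tame] by (intro weighted_integrable) auto

text \<open>After the operator has been moved to \<open>W R\<close>, the same weighted integral of
  \<open>v\<close> stands on the right, with a factor that is small for large \<open>R\<close>. It
  can be absorbed, or estimated when \<open>v\<close> is bounded.\<close>

lemma W_test:
  assumes v: "regular v" and b: "regular b" and M: "\<And>x. \<bar>b x\<bar> \<le> M" and sub: "\<And>x. frac_lap s v x + b x \<le> 0"
    and R: "1 \<le> R" and pos: "\<And>x. 0 \<le> v x"
  shows "(\<integral>x. b x * W R x \<partial>lborel) \<le> 7 * cL / R powr s * (\<integral>x. v x * W R x \<partial>lborel)"
proof -
  have "weak_form v b (W R) \<le> 0" by (rule weak_inequality[OF v b M sub W_tame[OF R]]) (use W_pos in \<open>auto intro: less_imp_le\<close>)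
  then have "(\<integral>x. b x * W R x \<partial>lborel) \<le> - (\<integral>x. v x * frac_lap s (W R) x \<partial>lborel)"
    unfolding weak_form_def by linarith
  also have "\<dots> \<le> \<bar>\<integral>x. v x * frac_lap s (W R) x \<partial>lborel\<bar>" by simp
  also have "\<dots> \<le> (\<integral>x. \<bar>v x * frac_lap s (W R) x\<bar> \<partial>lborel)" by (rule integral_abs_bound)
  also have "\<dots> \<le> (\<integral>x. 7 * cL / R powr s * (v x * W R x) \<partial>lborel)"
  proof (rule integral_mono)
    show "integrable lborel (\<lambda>x. \<bar>v x * frac_lap s (W R) x\<bar>)"
      using tame_frac_lap[OF W_tame[OF R]] by (intro integrable_abs weighted_integrable[OF v]) auto
    show "integrable lborel (\<lambda>x. 7 * cL / R powr s * (v x * W R x))"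
      using W_weighted[OF v R] by simp
    show "\<bar>v x * frac_lap s (W R) x\<bar> \<le> 7 * cL / R powr s * (v x * W R x)" for x
      using mult_left_mono[OF W_frac_lap[OF R, of x] pos[of x]] pos[of x] by (simp add: abs_mult mult_ac)
  qed
  finally show ?thesis by simp
qed

text \<open>Kato's inequality for the excess \<open>v\<close> of \<open>\<bar>u\<bar>\<close> over
  1: where \<open>\<bar>u x\<bar> > 1\<close>, the cubic term pushes back at rate
  \<open>2 * v x\<close>. At a radius where the factor in \<open>W_test\<close> is at most 1, the
  weighted integral of \<open>v\<close> satisfies \<open>2 * I \<le> I\<close>, hence
  \<open>v = 0\<close>.\<close>

theorem solution_bounded:
  assumes sol: "is_solution s u"
  shows "\<bar>u x\<bar> \<le> 1"
proof -
  have u: "regular u" by (rule solution_regular[OF sol])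
  have [measurable]: "u \<in> borel_measurable borel" by (rule regular_measurable[OF u])
  define v where "v x = max \<bar>u x\<bar> 1 - 1" for x
  have [measurable]: "v \<in> borel_measurable borel" unfolding v_def by measurable
  have v: "regular v" by (rule regular_dom1[OF _ u, of _ 1]) (auto simp: v_def)
  have vpos: "0 \<le> v x" for x by (simp add: v_def)
  have sub: "frac_lap s v x \<le> - 2 * v x" for x
  proof (cases "1 < \<bar>u x\<bar>")
    case True
    have "frac_lap s v x \<le> (\<integral>y. sgn (u x) * ((u x - u (x + y)) * K y) \<partial>lborel)"
      unfolding frac_lap_K
    proof (rule integral_mono)
      show "integrable lborel (\<lambda>y. (v x - v (x + y)) * K y)" by (rule regular_integrable[OF v])
      show "integrable lborel (\<lambda>y. sgn (u x) * ((u x - u (x + y)) * K y))" using regular_integrable[OF u] by simp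
      fix y
      have "v x - v (x + y) \<le> sgn (u x) * (u x - u (x + y))"
        using True by (auto simp: v_def sgn_if algebra_simps)
      then have "(v x - v (x + y)) * K y \<le> sgn (u x) * (u x - u (x + y)) * K y" by (rule mult_right_mono) simp
      then show "(v x - v (x + y)) * K y \<le> sgn (u x) * ((u x - u (x + y)) * K y)" by (simp add: mult.assoc)
    qed
    also have "\<dots> = sgn (u x) * (u x - (u x) ^ 3)"
      using solution_frac_lap[OF sol, of x] by (simp add: frac_lap_K)
    also have "\<dots> = \<bar>u x\<bar> - \<bar>u x\<bar> ^ 3" using True by (auto simp: sgn_if abs_if)
    \<comment> \<open>For \<open>t \<ge> 1\<close> the function \<open>t - t^3\<close> lies below
      its tangent at 1; the difference is \<open>(t - 1)^2 * (t + 2)\<close>.\<close>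
    also have "\<dots> \<le> - 2 * v x"
    proof -
      have "0 \<le> (\<bar>u x\<bar> - 1)\<^sup>2 * (\<bar>u x\<bar> + 2)" by simp
      also have "\<dots> = \<bar>u x\<bar> ^ 3 - 3 * \<bar>u x\<bar> + 2" by (simp add: power2_eq_square power3_eq_cube algebra_simps)
      finally show ?thesis using True by (simp add: v_def)
    qed
    finally show ?thesis .
  next
    case False
    then have "v x = 0" by (simp add: v_def)
    moreover have "frac_lap s v x \<le> (\<integral>y. 0 \<partial>(lborel :: (real^2) measure))"
      unfolding frac_lap_K using regular_integrable[OF v, of x] vpos \<open>v x = 0\<close>
      by (intro integral_mono) (auto intro: mult_nonpos_nonneg)
    ultimately show ?thesis by simp
  qed
  obtain R where R: "1 \<le> R" "7 * cL / R powr s \<le> 1"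
  proof
    let ?R = "max 1 (7 * cL) powr (1 / s)"
    show "1 \<le> ?R" using s0 by (intro ge_one_powr_ge_zero) auto
    have "?R powr s = max 1 (7 * cL)" using s0 by (simp add: powr_powr)
    then show "7 * cL / ?R powr s \<le> 1" by (simp add: divide_le_eq)
  qed
  let ?I = "\<integral>x. v x * W R x \<partial>lborel"
  have iv: "integrable lborel (\<lambda>x. v x * W R x)" by (rule W_weighted[OF v R(1)])
  have I0: "0 \<le> ?I" using vpos W_pos by (intro integral_nonneg_AE AE_I2) (auto intro: mult_nonneg_nonneg less_imp_le)
  \<comment> \<open>\<open>weak_inequality\<close> asks for a bounded zero-order term, and
    \<open>v\<close> has no a priori bound; the truncation at \<open>n\<close> is removed by
    dominated convergence below.\<close>
  have M: "(\<integral>x. 2 * min (v x) (real n) * W R x \<partial>lborel) \<le> ?I" for n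
  proof -
    have b: "regular (\<lambda>x. 2 * min (v x) (real n))" by (rule regular_dom1[OF _ v, of _ 2]) (auto simp: min_def abs_if)
    have "(\<integral>x. 2 * min (v x) (real n) * W R x \<partial>lborel) \<le> 7 * cL / R powr s * ?I"
    proof (rule W_test[OF v b _ _ R(1) vpos])
      show "\<bar>2 * min (v x) (real n)\<bar> \<le> 2 * real n" for x using vpos[of x] by auto
      show "frac_lap s v x + 2 * min (v x) (real n) \<le> 0" for x using sub[of x] by (simp add: min_def)
    qed
    also have "\<dots> \<le> 1 * ?I" by (rule mult_right_mono[OF R(2) I0])
    finally show ?thesis by simp
  qed
  have "(\<lambda>n. \<integral>x. 2 * min (v x) (real n) * W R x \<partial>lborel) \<longlonglongrightarrow> (\<integral>x. 2 * v x * W R x \<partial>lborel)"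
  proof (rule integral_dominated_convergence[where w="\<lambda>x. 2 * (v x * W R x)"])
    show "AE x in lborel. (\<lambda>n. 2 * min (v x) (real n) * W R x) \<longlonglongrightarrow> 2 * v x * W R x"
    proof (rule AE_I2)
      fix x
      obtain N where N: "v x \<le> real N" using real_arch_simple by blast
      have "\<forall>\<^sub>F n in sequentially. 2 * v x * W R x = 2 * min (v x) (real n) * W R x"
        using eventually_ge_at_top[of N] by eventually_elim (use N in \<open>simp add: min_def\<close>)
      then show "(\<lambda>n. 2 * min (v x) (real n) * W R x) \<longlonglongrightarrow> 2 * v x * W R x" by (rule Lim_transform_eventually[OF tendsto_const])
    qed
    show "AE x in lborel. norm (2 * min (v x) (real n) * W R x) \<le> 2 * (v x * W R x)" for n
      using vpos W_pos by (intro AE_I2) (auto simp: abs_mult mult.assoc less_imp_le intro!: mult_right_mono)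
  qed (use iv in auto)
  then have "(\<integral>x. 2 * v x * W R x \<partial>lborel) \<le> ?I" using M by (intro LIMSEQ_le_const2) auto
  moreover have "(\<integral>x. 2 * v x * W R x \<partial>lborel) = 2 * ?I" by (simp add: mult.assoc)
  ultimately have "?I = 0" using I0 by simp
  then have "AE x in lborel. v x * W R x = 0"
    using vpos W_pos by (subst (asm) integral_nonneg_eq_0_iff_AE[OF iv]) auto
  then have "AE x in lborel. 0 \<le> - v x"
  proof eventually_elim
    case (elim x) then show ?case using W_pos[of R x] by auto
  qed
  moreover have "regular (\<lambda>x. - v x)" by (rule regular_dom1[OF _ v, of _ 1]) auto
  ultimately have "0 \<le> - v x" by (rule regular_AE_nonneg[rotated])
  then show ?thesis by (simp add: v_def)
qed

section \<open>Quadratic growth of the energy\<close>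

definition Wk :: "real \<Rightarrow> real^2 \<Rightarrow> real" where
  "Wk r y = 1 / (r + norm y) powr (2 + s)"

lemma Wk_nonneg [simp]: "0 \<le> Wk r y" by (simp add: Wk_def)
lemma Wk_measurable [measurable]: "Wk r \<in> borel_measurable borel" unfolding Wk_def by measurable
lemma Wk_uminus [simp]: "Wk r (- y) = Wk r y" by (simp add: Wk_def)
lemma Wk_le_K: "0 < r \<Longrightarrow> y \<noteq> 0 \<Longrightarrow> Wk r y \<le> K y"
  unfolding K_def Wk_def using s0 
  by (intro divide_left_mono powr_mono2 mult_pos_pos) (auto simp: add_nonneg_eq_0_iff)

lemma W_small_tame: 
  assumes r: "0 < r" "r \<le> 1"
  shows "tame (9 / r) (W r)"
  unfolding tame_def
proof (intro conjI allI impI)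
  have le: "W r x \<le> w x" for x
  proof -
    have "norm x \<le> norm x / r" using r by (simp add: le_divide_eq mult_left_le)
    then show ?thesis unfolding W_def w_def using r s0
      by (intro divide_left_mono powr_mono2 mult_pos_pos) (auto simp: add_nonneg_eq_0_iff)
  qed
  have r1: "1 \<le> 1 / r" using r by simp
  show "\<bar>W r x\<bar> \<le> 9 / r * w x" for x
  proof -
    have "w x \<le> 9 * w x / r"
      using mult_mono[of 1 "9 / r" "w x" "w x"] r r1 by simp
    then show ?thesis using le[of x] by simp
  qed
  fix x y :: "real^2" assume y: "norm y \<le> 1"
  show "\<bar>W r x - W r (x + y)\<bar> \<le> 9 / r * w x * norm y"
  proof (cases "norm y \<le> r")
    case True
    then have "\<bar>W r x - W r (x + y)\<bar> \<le> 7 * W r x * norm ((1 / r) *\<^sub>R y)"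
      using tameD(3)[OF tame_w, of "(1 / r) *\<^sub>R y" "(1 / r) *\<^sub>R x"] r unfolding W_def by (simp add: scaleR_add_right)
    also have "\<dots> \<le> 9 * w x * norm ((1 / r) *\<^sub>R y)"
      using le[of x] by (intro mult_right_mono) (auto intro: order_trans[OF mult_left_mono mult_right_mono])
    finally show ?thesis using r by (simp add: mult_ac)
  next
    case False
    have "\<bar>W r x - W r (x + y)\<bar> \<le> w x + w (x + y)" using le[of x] le[of "x + y"] W_nonneg[of r x] W_nonneg[of r "x + y"] by linarith
    also have "\<dots> \<le> 9 * w x * 1" using w_near[OF y, of x] by simp
    also have "\<dots> \<le> 9 * w x * (norm y / r)" using False r by (intro mult_left_mono) auto
    finally show ?thesis by (simp add: mult_ac)
  qed
qed measurable

lemma Wk_eq_W: "0 < r \<Longrightarrow> Wk r y = W r y / r powr (2 + s)"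
proof -
  assume r: "0 < r"
  have "r + norm y = r * (1 + norm y / r)" using r by (simp add: distrib_left)
  then have "(r + norm y) powr (2 + s) = r powr (2 + s) * (1 + norm y / r) powr (2 + s)"
    using r by (simp only: powr_mult)
  then show ?thesis using r by (simp add: Wk_def W_def w_def)
qed

lemma tame_cmult: "tame A f \<Longrightarrow> tame (\<bar>c\<bar> * A) (\<lambda>x. c * f x)"
  unfolding tame_def
  by (auto simp: abs_mult right_diff_distrib[symmetric] mult.assoc intro!: mult_left_mono)

lemma Wk_tame:
  assumes "0 < r" "r \<le> 1"
  shows "\<exists>A. tame A (Wk r)"
proof -
  have "Wk r = (\<lambda>y. 1 / r powr (2 + s) * W r y)" using Wk_eq_W[OF assms(1)] by (intro ext) simp
  then show ?thesis using tame_cmult[OF W_small_tame[OF assms], of "1 / r powr (2 + s)"] by metis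
qed

text \<open>A bounded increment of Lipschitz type costs only \<open>m\<close>, which is integrable.
  Such increments occur in \<open>\<Gamma>\<close> when the base point of its kernel moves.\<close>

lemma regular_dom_m:
  assumes [measurable]: "f \<in> borel_measurable borel" and v: "regular v" and c: "0 \<le> c"
    and le: "\<And>x z. \<bar>f x - f z\<bar> \<le> c * (\<bar>v x - v z\<bar> + min (norm (z - x)) 1)"
  shows "regular f"
proof -
  have [measurable]: "v \<in> borel_measurable borel" by (rule regular_measurable[OF v])
  have "enosc f x < \<infinity>" for x
  proof -
    have "integrable lborel (\<lambda>z. m (z - x))"
      using integrable_m integrable_translate[of m "-x"] by simp
    then have "integrable lborel (\<lambda>z. c * (\<bar>v x - v z\<bar> * K (z - x) + m (z - x)))"
      using regular_integrable'(1)[OF v, of x] by simp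
    then have "integrable lborel (\<lambda>z. \<bar>f x - f z\<bar> * K (z - x))"
    proof (rule Bochner_Integration.integrable_bound)
      show "AE z in lborel. norm (\<bar>f x - f z\<bar> * K (z - x)) \<le> norm (c * (\<bar>v x - v z\<bar> * K (z - x) + m (z - x)))"
        using mult_right_mono[OF le K_nonneg] c by (intro AE_I2) (auto simp: m_def abs_mult algebra_simps)
    qed measurable
    then show ?thesis by (simp add: integrable_iff_bounded enosc_def abs_mult)
  qed
  then show ?thesis by (simp add: regular_def)
qed

text \<open>
  The energy density of \<open>u\<close> appears in the equation for \<open>u\<^sup>2\<close>. Truncating its kernel at scale \<open>r\<close> makes it a bounded
  regular function, so that \<open>W_test\<close> applies.
\<close>

definition \<Gamma> :: "real \<Rightarrow> (real^2 \<Rightarrow> real) \<Rightarrow> real^2 \<Rightarrow> real" where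
  "\<Gamma> r u x = (\<integral>z. (u x - u z)\<^sup>2 * Wk r (z - x) \<partial>lborel)"

lemma Wk_shift_integrable:
  assumes r: "0 < r" "r \<le> 1"
  shows "integrable lborel (\<lambda>z. Wk r (z - x))" "(\<integral>z. Wk r (z - x) \<partial>lborel) = (\<integral>z. Wk r z \<partial>lborel)"
proof -
  obtain A where "tame A (Wk r)" using Wk_tame[OF r] by blast
  then have "integrable lborel (Wk r)" by (rule tame_integrable_self)
  then show "integrable lborel (\<lambda>z. Wk r (z - x))" "(\<integral>z. Wk r (z - x) \<partial>lborel) = (\<integral>z. Wk r z \<partial>lborel)"
    using integrable_translate[of "Wk r" "-x"] integral_translate[of "Wk r" "-x"] by simp_all
qed

lemma square_kernel_diff:
  fixes a b c p q :: real
  shows "(a - c)\<^sup>2 * p - (b - c)\<^sup>2 * q = ((a + b - 2 * c) * (a - b)) * p + (b - c)\<^sup>2 * (p - q)"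
proof -
  have "(a - c)\<^sup>2 = (a + b - 2 * c) * (a - b) + (b - c)\<^sup>2" by (simp add: power2_eq_square algebra_simps)
  then show ?thesis by (simp only: distrib_right right_diff_distrib add_diff_eq)
qed

lemma square_diff_le:
  fixes a b :: real
  assumes "\<bar>a\<bar> \<le> 1" "\<bar>b\<bar> \<le> 1"
  shows "(a - b)\<^sup>2 \<le> 4" "(a - b)\<^sup>2 \<le> 2 * \<bar>a - b\<bar>"
proof -
  have ab: "\<bar>a - b\<bar> \<le> 2" using assms by linarith
  have "\<bar>a - b\<bar> * \<bar>a - b\<bar> \<le> 2 * \<bar>a - b\<bar>" using ab by (intro mult_right_mono) auto
  moreover have "(a - b)\<^sup>2 = \<bar>a - b\<bar> * \<bar>a - b\<bar>" by (simp add: power2_eq_square)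
  ultimately show "(a - b)\<^sup>2 \<le> 2 * \<bar>a - b\<bar>" by simp
  then show "(a - b)\<^sup>2 \<le> 4" by (rule order_trans) (use ab in simp)
qed

lemma \<Gamma>_integrable:
  assumes [measurable]: "u \<in> borel_measurable borel" and bd: "\<And>x. \<bar>u x\<bar> \<le> 1" and r: "0 < r" "r \<le> 1"
  shows "integrable lborel (\<lambda>z. (u y - u z)\<^sup>2 * Wk r (z - x))"
proof (rule Bochner_Integration.integrable_bound[OF integrable_mult_right[OF Wk_shift_integrable(1)[OF r, of x], of 4]])
  show "AE z in lborel. norm ((u y - u z)\<^sup>2 * Wk r (z - x)) \<le> norm (4 * Wk r (z - x))"
    using square_diff_le(1)[OF bd bd] by (intro AE_I2) (auto simp: abs_mult intro!: mult_right_mono)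
qed measurable

lemma \<Gamma>_bound:
  assumes [measurable]: "u \<in> borel_measurable borel" and bd: "\<And>x. \<bar>u x\<bar> \<le> 1" and r: "0 < r" "r \<le> 1"
  shows "0 \<le> \<Gamma> r u x" "\<Gamma> r u x \<le> 4 * (\<integral>z. Wk r z \<partial>lborel)"
proof -
  show "0 \<le> \<Gamma> r u x" unfolding \<Gamma>_def by (intro integral_nonneg_AE) auto
  have "\<Gamma> r u x \<le> (\<integral>z. 4 * Wk r (z - x) \<partial>lborel)"
    unfolding \<Gamma>_def using square_diff_le(1)[OF bd bd] Wk_shift_integrable[OF r]
    by (intro integral_mono \<Gamma>_integrable[OF _ bd r]) (auto intro!: mult_right_mono)
  then show "\<Gamma> r u x \<le> 4 * (\<integral>z. Wk r z \<partial>lborel)" using Wk_shift_integrable[OF r] by simp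
qed

text \<open>By \<open>square_kernel_diff\<close> an increment splits in two. Changing
  \<open>u x\<close> under a fixed kernel costs \<open>4 * \<bar>u x - u x'\<bar>\<close> times the
  mass of \<open>Wk r\<close>. Moving the kernel costs a multiple of its L1 modulus of continuity
  \<open>D\<close>, which is Lipschitz at short range because \<open>Wk r\<close> is tame, and
  bounded at long range.\<close>

lemma \<Gamma>_regular:
  assumes u: "regular u" and bd: "\<And>x. \<bar>u x\<bar> \<le> 1" and r: "0 < r" "r \<le> 1"
  shows "regular (\<Gamma> r u)"
proof -
  have [measurable]: "u \<in> borel_measurable borel" by (rule regular_measurable[OF u])
  obtain A where A: "tame A (Wk r)" using Wk_tame[OF r] by blast
  have A0: "0 \<le> A" by (rule tameD(4)[OF A])
  define I where "I = (\<integral>z. Wk r z \<partial>lborel)"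
  define J where "J = A * (\<integral>z. w z \<partial>lborel)"
  have I: "0 \<le> I" unfolding I_def by (intro integral_nonneg_AE) auto
  have J: "0 \<le> J" unfolding J_def using A0 by (intro mult_nonneg_nonneg integral_nonneg_AE) auto
  have wi: "integrable lborel (\<lambda>z. w (z - x))" "(\<integral>z. w (z - x) \<partial>lborel) = (\<integral>z. w z \<partial>lborel)" for x
    using integrable_w integrable_translate[of w "-x"] integral_translate[of w "-x"] by simp_all
  define D where "D x x' = (\<integral>z. \<bar>Wk r (z - x) - Wk r (z - x')\<bar> \<partial>lborel)" for x x'
  have Di: "integrable lborel (\<lambda>z. \<bar>Wk r (z - x) - Wk r (z - x')\<bar>)" for x x'
    using Wk_shift_integrable[OF r] by auto
  have D: "D x x' \<le> (2 * I + J) * min (norm (x' - x)) 1" for x x'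
  proof (cases "norm (x' - x) \<le> 1")
    case True
    have "D x x' \<le> (\<integral>z. A * norm (x' - x) * w (z - x) \<partial>lborel)"
      unfolding D_def
    proof (rule integral_mono[OF Di])
      show "\<bar>Wk r (z - x) - Wk r (z - x')\<bar> \<le> A * norm (x' - x) * w (z - x)" for z
        using tameD(3)[OF A, of "x - x'" "z - x"] True by (simp add: norm_minus_commute mult_ac)
    qed (use wi in simp)
    also have "\<dots> = J * norm (x' - x)" using wi by (simp add: J_def)
    also have "\<dots> \<le> (2 * I + J) * norm (x' - x)" using I by (intro mult_right_mono) auto
    finally show ?thesis using True by simp
  next
    case False
    have "D x x' \<le> (\<integral>z. Wk r (z - x) + Wk r (z - x') \<partial>lborel)"
      unfolding D_def using Wk_shift_integrable[OF r] by (intro integral_mono[OF Di]) (auto simp: abs_le_iff)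
    also have "\<dots> = 2 * I" using Wk_shift_integrable[OF r] by (simp add: I_def)
    finally show ?thesis using False J by simp
  qed
  show ?thesis
  proof (rule regular_dom_m[OF _ u, of _ "4 * I + 4 * (2 * I + J)"])
    show "\<Gamma> r u \<in> borel_measurable borel" unfolding \<Gamma>_def by measurable
    show "0 \<le> 4 * I + 4 * (2 * I + J)" using I J by simp
    fix x x'
    have eq: "\<Gamma> r u x - \<Gamma> r u x' = (\<integral>z. (u x - u z)\<^sup>2 * Wk r (z - x) - (u x' - u z)\<^sup>2 * Wk r (z - x') \<partial>lborel)"
      unfolding \<Gamma>_def by (rule Bochner_Integration.integral_diff[symmetric]) (intro \<Gamma>_integrable[OF _ bd r]; measurable)+
    have "\<bar>\<Gamma> r u x - \<Gamma> r u x'\<bar> \<le> (\<integral>z. \<bar>(u x - u z)\<^sup>2 * Wk r (z - x) - (u x' - u z)\<^sup>2 * Wk r (z - x')\<bar> \<partial>lborel)"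
      unfolding eq by (rule integral_abs_bound)
    also have "\<dots> \<le> (\<integral>z. 4 * \<bar>u x - u x'\<bar> * Wk r (z - x) + 4 * \<bar>Wk r (z - x) - Wk r (z - x')\<bar> \<partial>lborel)"
    proof (rule integral_mono)
      show "integrable lborel (\<lambda>z. \<bar>(u x - u z)\<^sup>2 * Wk r (z - x) - (u x' - u z)\<^sup>2 * Wk r (z - x')\<bar>)"
        by (intro integrable_abs Bochner_Integration.integrable_diff \<Gamma>_integrable[OF _ bd r]) measurable
      show "integrable lborel (\<lambda>z. 4 * \<bar>u x - u x'\<bar> * Wk r (z - x) + 4 * \<bar>Wk r (z - x) - Wk r (z - x')\<bar>)"
        using Wk_shift_integrable[OF r] Di by (intro Bochner_Integration.integrable_add integrable_mult_right)
      fix z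
      have "(u x - u z)\<^sup>2 * Wk r (z - x) - (u x' - u z)\<^sup>2 * Wk r (z - x')
          = ((u x + u x' - 2 * u z) * (u x - u x')) * Wk r (z - x) + (u x' - u z)\<^sup>2 * (Wk r (z - x) - Wk r (z - x'))"
        by (rule square_kernel_diff)
      also have "\<bar>\<dots>\<bar> \<le> \<bar>((u x + u x' - 2 * u z) * (u x - u x')) * Wk r (z - x)\<bar> + \<bar>(u x' - u z)\<^sup>2 * (Wk r (z - x) - Wk r (z - x'))\<bar>"
        by (rule abs_triangle_ineq)
      also have "\<dots> \<le> 4 * \<bar>u x - u x'\<bar> * Wk r (z - x) + 4 * \<bar>Wk r (z - x) - Wk r (z - x')\<bar>"
      proof (rule add_mono)
        have "\<bar>u x + u x' - 2 * u z\<bar> \<le> 4" using bd[of x] bd[of x'] bd[of z] by linarith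
        then show "\<bar>((u x + u x' - 2 * u z) * (u x - u x')) * Wk r (z - x)\<bar> \<le> 4 * \<bar>u x - u x'\<bar> * Wk r (z - x)"
          by (simp add: abs_mult mult_right_mono)
        show "\<bar>(u x' - u z)\<^sup>2 * (Wk r (z - x) - Wk r (z - x'))\<bar> \<le> 4 * \<bar>Wk r (z - x) - Wk r (z - x')\<bar>"
          using square_diff_le(1)[OF bd bd, of x' z] by (simp add: abs_mult mult_right_mono)
      qed
      finally show "\<bar>(u x - u z)\<^sup>2 * Wk r (z - x) - (u x' - u z)\<^sup>2 * Wk r (z - x')\<bar> \<le> 4 * \<bar>u x - u x'\<bar> * Wk r (z - x) + 4 * \<bar>Wk r (z - x) - Wk r (z - x')\<bar>" .
    qed
    also have "\<dots> = 4 * \<bar>u x - u x'\<bar> * I + 4 * D x x'"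
      using Wk_shift_integrable[OF r] Di unfolding D_def I_def
      by (subst Bochner_Integration.integral_add) auto
    also have "\<dots> \<le> (4 * I) * \<bar>u x - u x'\<bar> + (4 * (2 * I + J)) * min (norm (x' - x)) 1"
      using D[of x x'] by (simp add: algebra_simps)
    also have "\<dots> \<le> (4 * I + 4 * (2 * I + J)) * \<bar>u x - u x'\<bar> + (4 * I + 4 * (2 * I + J)) * min (norm (x' - x)) 1"
      using I J by (intro add_mono mult_right_mono) auto
    finally show "\<bar>\<Gamma> r u x - \<Gamma> r u x'\<bar> \<le> (4 * I + 4 * (2 * I + J)) * (\<bar>u x - u x'\<bar> + min (norm (x' - x)) 1)"
      by (simp only: distrib_left)
  qed
qed

text \<open>The identity \<open>a^2 - b^2 = 2 * a * (a - b) - (a - b)^2\<close> makes the energy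
  density a zero-order term in the equation for the square of \<open>u\<close>, next to the bounded
  source \<open>f\<close>. \<open>W_test\<close> then bounds it uniformly in \<open>r\<close>, and
  the mass of \<open>W R\<close> supplies the factor \<open>R^2\<close>.\<close>

lemma solution_\<Gamma>_weighted:
  assumes sol: "is_solution s u" and r: "0 < r" "r \<le> 1" and R: "1 \<le> R"
  shows "(\<integral>x. \<Gamma> r u x * W R x \<partial>lborel) \<le> (2 + 7 * cL) * (\<integral>x. w x \<partial>lborel) * R\<^sup>2"
proof -
  have u: "regular u" by (rule solution_regular[OF sol])
  have [measurable]: "u \<in> borel_measurable borel" by (rule regular_measurable[OF u])
  have bd: "\<bar>u x\<bar> \<le> 1" for x by (rule solution_bounded[OF sol])
  have u2: "(u x)\<^sup>2 \<le> 1" for x using bd[of x] by (simp add: abs_square_le_1)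
  have u4: "0 \<le> (u x) ^ 4" "(u x) ^ 4 \<le> (u x)\<^sup>2" for x
  proof -
    have "(u x) ^ 4 = (u x)\<^sup>2 * (u x)\<^sup>2" by (simp add: power2_eq_square power4_eq_xxxx)
    then show "0 \<le> (u x) ^ 4" "(u x) ^ 4 \<le> (u x)\<^sup>2" using mult_left_mono[OF u2[of x], of "(u x)\<^sup>2"] by simp_all
  qed
  have q: "regular (\<lambda>x. (u x)\<^sup>2)"
  proof (rule regular_dom1[OF _ u, of _ 2])
    fix x z
    have "(u x)\<^sup>2 - (u z)\<^sup>2 = (u x + u z) * (u x - u z)" by (simp add: power2_eq_square algebra_simps)
    moreover have "\<bar>u x + u z\<bar> \<le> 2" using bd[of x] bd[of z] by linarith
    ultimately show "\<bar>(u x)\<^sup>2 - (u z)\<^sup>2\<bar> \<le> 2 * \<bar>u x - u z\<bar>" by (simp add: abs_mult mult_right_mono)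
  qed auto
  define f where "f x = 2 * ((u x)\<^sup>2 - (u x) ^ 4)" for x
  have f: "regular f"
  proof (rule regular_dom1[OF _ q, of _ 2])
    fix x z
    have "f x - f z = 2 * ((1 - (u x)\<^sup>2 - (u z)\<^sup>2) * ((u x)\<^sup>2 - (u z)\<^sup>2))" 
      unfolding f_def by (simp add: power2_eq_square power4_eq_xxxx algebra_simps)
    moreover have "\<bar>1 - (u x)\<^sup>2 - (u z)\<^sup>2\<bar> \<le> 1" using u2[of x] u2[of z] by (simp add: abs_le_iff)
    ultimately show "\<bar>f x - f z\<bar> \<le> 2 * \<bar>(u x)\<^sup>2 - (u z)\<^sup>2\<bar>" by (simp add: abs_mult mult_left_le_one_le)
  qed (auto simp: f_def[abs_def])
  have fb: "0 \<le> f x" "f x \<le> 2" for x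
  proof -
    have "(u x)\<^sup>2 - (u x) ^ 4 \<le> 1" using u4(1)[of x] u2[of x] by linarith
    then show "f x \<le> 2" unfolding f_def by simp
    show "0 \<le> f x" using u4(2)[of x] by (simp add: f_def)
  qed
  note \<Gamma> = \<Gamma>_regular[OF u bd r] and \<Gamma>b = \<Gamma>_bound[OF \<open>u \<in> borel_measurable borel\<close> bd r]
  have b: "regular (\<lambda>x. \<Gamma> r u x - f x)"
    using regular_measurable[OF \<Gamma>] regular_measurable[OF f] by (intro regular_dom[OF _ \<Gamma> f, of _ 1]) auto
  have "(\<integral>x. (\<Gamma> r u x - f x) * W R x \<partial>lborel) \<le> 7 * cL / R powr s * (\<integral>x. (u x)\<^sup>2 * W R x \<partial>lborel)"
  proof (rule W_test[OF q b _ _ R])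
    show "\<bar>\<Gamma> r u x - f x\<bar> \<le> 4 * (\<integral>z. Wk r z \<partial>lborel) + 2" for x
      using \<Gamma>b[of x] fb[of x] by linarith
    show "frac_lap s (\<lambda>x. (u x)\<^sup>2) x + (\<Gamma> r u x - f x) \<le> 0" for x
    proof -
      have i1: "integrable lborel (\<lambda>y. (u x - u (x + y)) * K y)" by (rule regular_integrable[OF u])
      have i2: "integrable lborel (\<lambda>y. (u x - u (x + y))\<^sup>2 * K y)"
      proof (rule Bochner_Integration.integrable_bound[OF integrable_mult_right[OF integrable_abs[OF i1], of 2]])
        show "AE y in lborel. norm ((u x - u (x + y))\<^sup>2 * K y) \<le> norm (2 * \<bar>(u x - u (x + y)) * K y\<bar>)"
          using square_diff_le(2)[OF bd bd] by (intro AE_I2) (auto simp: abs_mult mult.assoc[symmetric] intro!: mult_right_mono)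
      qed measurable
      have "frac_lap s (\<lambda>x. (u x)\<^sup>2) x = (\<integral>y. 2 * u x * ((u x - u (x + y)) * K y) - (u x - u (x + y))\<^sup>2 * K y \<partial>lborel)"
        unfolding frac_lap_K by (intro Bochner_Integration.integral_cong refl) (simp add: power2_eq_square algebra_simps)
      also have "\<dots> = 2 * u x * (\<integral>y. (u x - u (x + y)) * K y \<partial>lborel) - (\<integral>y. (u x - u (x + y))\<^sup>2 * K y \<partial>lborel)"
        using i1 i2 by simp
      also have "(\<integral>y. (u x - u (x + y)) * K y \<partial>lborel) = u x - (u x) ^ 3"
        using solution_frac_lap[OF sol, of x] by (simp add: frac_lap_K)
      also have "2 * u x * (u x - (u x) ^ 3) = f x" by (simp add: f_def power2_eq_square power3_eq_cube power4_eq_xxxx algebra_simps)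
      finally have eq: "frac_lap s (\<lambda>x. (u x)\<^sup>2) x = f x - (\<integral>y. (u x - u (x + y))\<^sup>2 * K y \<partial>lborel)" .
      have "\<Gamma> r u x = (\<integral>y. (u x - u (x + y))\<^sup>2 * Wk r y \<partial>lborel)"
        unfolding \<Gamma>_def by (subst integral_translate[of _ x, symmetric]) auto
      also have "\<dots> \<le> (\<integral>y. (u x - u (x + y))\<^sup>2 * K y \<partial>lborel)"
      proof (rule integral_mono_AE[OF _ i2])
        have "integrable lborel (\<lambda>y. (u x - u (x + y))\<^sup>2 * Wk r (x + y - x))"
          by (subst integrable_translate[of "\<lambda>z. (u x - u z)\<^sup>2 * Wk r (z - x)"]) (auto intro: \<Gamma>_integrable bd r)
        then show "integrable lborel (\<lambda>y. (u x - u (x + y))\<^sup>2 * Wk r y)" by simp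
        show "AE y in lborel. (u x - u (x + y))\<^sup>2 * Wk r y \<le> (u x - u (x + y))\<^sup>2 * K y"
          using AE_nonzero[of 0] by eventually_elim (intro mult_left_mono Wk_le_K r, auto)
      qed
      finally show ?thesis using eq by linarith
    qed
  qed simp
  also have "\<dots> \<le> 7 * cL * (\<integral>x. W R x \<partial>lborel)"
  proof (rule mult_mono)
    have "1 \<le> R powr s" using R s0 by (intro ge_one_powr_ge_zero) auto
    then show "7 * cL / R powr s \<le> 7 * cL" using cL_nonneg by (simp add: divide_le_eq mult_le_cancel_left1)
    show "(\<integral>x. (u x)\<^sup>2 * W R x \<partial>lborel) \<le> (\<integral>x. W R x \<partial>lborel)"
      using u2 by (intro integral_mono W_weighted[OF q R] W_integrable[OF R]) (auto simp: mult_left_le_one_le)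
  qed (use cL_nonneg in \<open>auto intro!: integral_nonneg_AE\<close>)
  finally have 1: "(\<integral>x. (\<Gamma> r u x - f x) * W R x \<partial>lborel) \<le> 7 * cL * (\<integral>x. W R x \<partial>lborel)" .
  have "(\<integral>x. f x * W R x \<partial>lborel) \<le> (\<integral>x. 2 * W R x \<partial>lborel)"
    using fb by (intro integral_mono W_weighted[OF f R] integrable_mult_right W_integrable[OF R]) (auto intro!: mult_right_mono)
  moreover have "(\<integral>x. (\<Gamma> r u x - f x) * W R x \<partial>lborel) = (\<integral>x. \<Gamma> r u x * W R x \<partial>lborel) - (\<integral>x. f x * W R x \<partial>lborel)"
    unfolding left_diff_distrib by (intro Bochner_Integration.integral_diff W_weighted \<Gamma> f R)
  ultimately have "(\<integral>x. \<Gamma> r u x * W R x \<partial>lborel) \<le> (2 + 7 * cL) * (\<integral>x. W R x \<partial>lborel)"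
    using 1 by (simp add: algebra_simps)
  then show ?thesis using W_integral[OF R] by (simp add: mult_ac)
qed

definition cE :: real where "cE = 8 * ((2 + 7 * cL) * (\<integral>x. w x \<partial>lborel))"

lemma cE_nonneg: "0 \<le> cE"
  unfolding cE_def using cL_nonneg by (intro mult_nonneg_nonneg integral_nonneg_AE) auto

text \<open>The truncated bound does not depend on \<open>r\<close>, so Fatou's lemma, used once in
  \<open>z\<close> and once in \<open>x\<close>, removes the truncation. On \<open>ball 0 R\<close>
  the weight \<open>W R\<close> is at least 1/8, which is the 8 in \<open>cE\<close>. Finiteness of
  the energy is thus known before minimality is invoked.\<close>

theorem solution_energy_growth:
  assumes sol: "is_solution s u" and R: "1 \<le> R"
  shows "(\<integral>\<^sup>+x. (\<integral>\<^sup>+z. ennreal ((u x - u z)\<^sup>2 * K (x - z)) \<partial>lborel) * indicator (ball 0 R) x \<partial>lborel) \<le> ennreal (cE * R\<^sup>2)"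
proof -
  have u: "regular u" by (rule solution_regular[OF sol])
  have [measurable]: "u \<in> borel_measurable borel" by (rule regular_measurable[OF u])
  have bd: "\<bar>u x\<bar> \<le> 1" for x by (rule solution_bounded[OF sol])
  define r where "r n = 1 / real (Suc n)" for n
  have r: "0 < r n" "r n \<le> 1" for n by (auto simp: r_def)
  define C where "C = (2 + 7 * cL) * (\<integral>x. w x \<partial>lborel) * R\<^sup>2"
  have C0: "0 \<le> C" unfolding C_def using cL_nonneg by (intro mult_nonneg_nonneg integral_nonneg_AE) auto
  have \<Gamma>b: "0 \<le> \<Gamma> (r n) u x" for n x using \<Gamma>_bound(1)[OF _ bd r] by simp
  have inner: "(\<integral>\<^sup>+z. ennreal ((u x - u z)\<^sup>2 * K (x - z)) \<partial>lborel) \<le> liminf (\<lambda>n. ennreal (\<Gamma> (r n) u x))" for x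
  proof -
    have "(\<integral>\<^sup>+z. ennreal ((u x - u z)\<^sup>2 * K (x - z)) \<partial>lborel) = (\<integral>\<^sup>+z. liminf (\<lambda>n. ennreal ((u x - u z)\<^sup>2 * Wk (r n) (z - x))) \<partial>lborel)"
    proof (intro nn_integral_cong_AE)
      show "AE z in lborel. ennreal ((u x - u z)\<^sup>2 * K (x - z)) = liminf (\<lambda>n. ennreal ((u x - u z)\<^sup>2 * Wk (r n) (z - x)))"
        using AE_nonzero[of x]
      proof eventually_elim
        case (elim z)
        have "r \<longlonglongrightarrow> 0" unfolding r_def by (rule inverse_Suc_tendsto)
        then have "(\<lambda>n. Wk (r n) (z - x)) \<longlonglongrightarrow> 1 / (0 + norm (z - x)) powr (2 + s)"
          unfolding Wk_def using elim by (intro tendsto_intros) auto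
        then have "(\<lambda>n. (u x - u z)\<^sup>2 * Wk (r n) (z - x)) \<longlonglongrightarrow> (u x - u z)\<^sup>2 * K (x - z)"
          by (intro tendsto_intros) (simp add: K_def norm_minus_commute)
        then show ?case by (intro lim_imp_Liminf[symmetric] tendsto_ennrealI) auto
      qed
    qed
    also have "\<dots> \<le> liminf (\<lambda>n. \<integral>\<^sup>+z. ennreal ((u x - u z)\<^sup>2 * Wk (r n) (z - x)) \<partial>lborel)"
      by (rule nn_integral_liminf) measurable
    also have "\<dots> = liminf (\<lambda>n. ennreal (\<Gamma> (r n) u x))"
      unfolding \<Gamma>_def by (subst nn_integral_eq_integral[OF \<Gamma>_integrable[OF _ bd r]]) auto
    finally show ?thesis .
  qed
  have [measurable]: "\<Gamma> (r n) u \<in> borel_measurable borel" for n by (rule regular_measurable[OF \<Gamma>_regular[OF u bd r]])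
  have "(\<integral>\<^sup>+x. (\<integral>\<^sup>+z. ennreal ((u x - u z)\<^sup>2 * K (x - z)) \<partial>lborel) * indicator (ball 0 R) x \<partial>lborel)
      \<le> (\<integral>\<^sup>+x. liminf (\<lambda>n. ennreal (8 * (\<Gamma> (r n) u x * W R x))) \<partial>lborel)"
  proof (intro nn_integral_mono)
    fix x
    show "(\<integral>\<^sup>+z. ennreal ((u x - u z)\<^sup>2 * K (x - z)) \<partial>lborel) * indicator (ball 0 R) x \<le> liminf (\<lambda>n. ennreal (8 * (\<Gamma> (r n) u x * W R x)))"
    proof (cases "x \<in> ball 0 R")
      case True
      have "1 \<le> 2 powr (2 + s) * W R x"
        unfolding W_def using one_le_w[of "(1 / R) *\<^sub>R x" 1] True R by (simp add: divide_le_eq)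
      also have "\<dots> \<le> 8 * W R x" using two_powr_le by (intro mult_right_mono) auto
      finally have "\<Gamma> (r n) u x \<le> 8 * (\<Gamma> (r n) u x * W R x)" for n
        using mult_left_mono[OF _ \<Gamma>b, of 1 "8 * W R x" n x] by simp
      then have "liminf (\<lambda>n. ennreal (\<Gamma> (r n) u x)) \<le> liminf (\<lambda>n. ennreal (8 * (\<Gamma> (r n) u x * W R x)))"
        by (intro Liminf_mono always_eventually allI ennreal_leI)
      then show ?thesis using inner[of x] True by simp
    qed simp
  qed
  also have "\<dots> \<le> liminf (\<lambda>n. \<integral>\<^sup>+x. ennreal (8 * (\<Gamma> (r n) u x * W R x)) \<partial>lborel)"
    by (rule nn_integral_liminf) measurable
  also have "\<dots> \<le> liminf (\<lambda>n. ennreal (8 * C))"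
  proof (intro Liminf_mono always_eventually allI)
    fix n
    have "(\<integral>\<^sup>+x. ennreal (8 * (\<Gamma> (r n) u x * W R x)) \<partial>lborel) = ennreal (\<integral>x. 8 * (\<Gamma> (r n) u x * W R x) \<partial>lborel)"
      using \<Gamma>b by (intro nn_integral_eq_integral integrable_mult_right W_weighted \<Gamma>_regular[OF u bd r] R) auto
    also have "\<dots> \<le> ennreal (8 * C)"
      using solution_\<Gamma>_weighted[OF sol r R, of n] by (intro ennreal_leI) (simp add: C_def)
    finally show "(\<integral>\<^sup>+x. ennreal (8 * (\<Gamma> (r n) u x * W R x)) \<partial>lborel) \<le> ennreal (8 * C)" .
  qed
  also have "\<dots> = ennreal (cE * R\<^sup>2)" unfolding C_def cE_def by (simp only: Liminf_const trivial_limit_sequentially mult_ac not_False_eq_True)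
  finally show ?thesis .
qed

end

subsection \<open>A smooth mollifier\<close>

text \<open>\<open>flat 0\<close> is the classical smooth function that is flat at 0; the poles are
  included so that the family is closed, up to linear combinations, under differentiation.\<close>

definition flat :: "nat \<Rightarrow> real \<Rightarrow> real" where
  "flat k t = (if t \<le> 0 then 0 else exp (- 1 / t) / t ^ k)"

lemma power_le_exp:
  fixes x :: real
  assumes "0 \<le> x"
  shows "x ^ n / fact n \<le> exp x"
proof -
  have sm: "summable (\<lambda>n. x ^ n / fact n)" using summable_exp_generic[of x] by (simp add: divide_inverse mult.commute)
  have "(\<Sum>i\<in>{n}. x ^ i / fact i) \<le> (\<Sum>i. x ^ i / fact i)"
    using assms by (intro sum_le_suminf sm) auto
  also have "\<dots> = exp x" by (simp add: exp_def divide_inverse mult.commute)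
  finally show ?thesis by simp
qed

lemma flat_nonneg: "0 \<le> flat k t" by (simp add: flat_def)

text \<open>The term of order \<open>k + 1\<close> in the exponential series at \<open>1 / t\<close>
  beats the pole \<open>1 / t ^ k\<close> by one power of \<open>t\<close>.\<close>

lemma flat_le: "flat k t \<le> fact (Suc k) * \<bar>t\<bar>"
proof (cases "t \<le> 0")
  case False
  then have t: "0 < t" by simp
  have "(1 / t) ^ Suc k / fact (Suc k) \<le> exp (1 / t)" using t by (intro power_le_exp) auto
  then have "1 \<le> exp (1 / t) * (fact (Suc k) * t ^ Suc k)"
    using t by (simp add: power_divide divide_simps mult_ac del: fact_Suc power_Suc)
  then have "exp (- 1 / t) * 1 \<le> exp (- 1 / t) * (exp (1 / t) * (fact (Suc k) * t ^ Suc k))"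
    by (intro mult_left_mono) auto
  also have "\<dots> = (exp (- 1 / t) * exp (1 / t)) * (fact (Suc k) * t ^ Suc k)" by (simp only: mult.assoc)
  also have "exp (- 1 / t) * exp (1 / t) = 1" by (simp add: exp_add[symmetric])
  finally have "exp (- 1 / t) \<le> fact (Suc k) * t * t ^ k" by (simp add: mult_ac del: fact_Suc)
  then show ?thesis using t by (simp add: flat_def divide_le_eq del: fact_Suc)
next
  case True
  have "0 \<le> fact (Suc k) * \<bar>t\<bar>" by (intro mult_nonneg_nonneg) auto
  then show ?thesis using True by (simp only: flat_def if_True)
qed

lemma flat_has_derivative:
  "(flat k has_real_derivative flat (k + 2) t - real k * flat (k + 1) t) (at t)"
proof -
  consider "t < 0" | "t = 0" | "0 < t" by linarith
  then show ?thesis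
  proof cases
    case 1
    have "((\<lambda>t. 0) has_real_derivative 0) (at t)" by simp
    then have "(flat k has_real_derivative 0) (at t)"
      by (rule DERIV_cong_ev[THEN iffD1, rotated -1, OF _ refl _ refl])
         (use eventually_nhds_in_open[of "{..<0}" t] 1 in \<open>auto elim!: eventually_mono simp: flat_def\<close>)
    then show ?thesis using 1 by (simp add: flat_def)
  next
    case 2
    \<comment> \<open>The difference quotient at 0 is dominated by the next member of the family,
      \<open>flat (Suc k) h\<close>, which vanishes linearly by \<open>flat_le\<close>.\<close>
    have "(\<lambda>h. (flat k (0 + h) - flat k 0) / h) \<midarrow>0\<rightarrow> 0"
    proof (rule Lim_null_comparison)
      show "\<forall>\<^sub>F h in at 0. norm ((flat k (0 + h) - flat k 0) / h) \<le> fact (Suc (Suc k)) * \<bar>h\<bar>"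
      proof (rule always_eventually, rule allI)
        fix h :: real
        have "norm ((flat k (0 + h) - flat k 0) / h) \<le> flat (Suc k) h"
          using flat_nonneg[of "Suc k" h] by (auto simp: flat_def mult.commute)
        also have "\<dots> \<le> fact (Suc (Suc k)) * \<bar>h\<bar>" by (rule flat_le)
        finally show "norm ((flat k (0 + h) - flat k 0) / h) \<le> fact (Suc (Suc k)) * \<bar>h\<bar>" .
      qed
      show "(\<lambda>h. fact (Suc (Suc k)) * \<bar>h\<bar>) \<midarrow>0\<rightarrow> (0::real)" by (rule tendsto_eq_intros refl)+ simp
    qed
    then show ?thesis using 2 by (simp add: DERIV_def flat_def)
  next
    case 3
    have "((\<lambda>t. exp (- 1 / t) / t ^ k) has_real_derivative flat (k + 2) t - real k * flat (k + 1) t) (at t)"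
      using 3
      apply (auto intro!: derivative_eq_intros simp: flat_def)
      apply (cases k)
       apply (auto simp: field_simps power2_eq_square)
      done
    then show ?thesis
      by (rule DERIV_cong_ev[THEN iffD1, rotated -1, OF _ refl _ refl])
         (use eventually_nhds_in_open[of "{0<..}" t] 3 in \<open>auto elim!: eventually_mono simp: flat_def\<close>)
  qed
qed

text \<open>A class closed under directional derivatives; this is the invariant of the coinduction in \<open>bconv_smooth\<close>.\<close>

inductive bump_class :: "(real^2 \<Rightarrow> real) \<Rightarrow> bool" where
  flat: "bump_class (\<lambda>x. flat k (1 - x \<bullet> x))"
| cmult: "bump_class f \<Longrightarrow> bump_class (\<lambda>x. c * f x)"
| inner: "bump_class f \<Longrightarrow> bump_class (\<lambda>x. (x \<bullet> v) * f x)"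
| add: "bump_class f \<Longrightarrow> bump_class g \<Longrightarrow> bump_class (\<lambda>x. f x + g x)"

lemma bump_class_derivative:
  assumes "bump_class f"
  shows "\<exists>D. (\<forall>x. (f has_derivative D x) (at x)) \<and> (\<forall>v. bump_class (\<lambda>x. D x v))"
  using assms
proof induction
  case (flat k)
  let ?d = "\<lambda>t. flat (k + 2) t - real k * flat (k + 1) t"
  let ?D = "\<lambda>x v. ?d (1 - x \<bullet> x) * (- (x \<bullet> v + v \<bullet> x))"
  have "((\<lambda>x. flat k (1 - x \<bullet> x)) has_derivative ?D x) (at x)" for x :: "real^2"
  proof -
    have "((\<lambda>x. 1 - x \<bullet> x) has_derivative (\<lambda>v. - (x \<bullet> v + v \<bullet> x))) (at x)"
      by (auto intro!: derivative_eq_intros)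
    moreover have "(flat k has_derivative (\<lambda>t. ?d (1 - x \<bullet> x) * t)) (at (1 - x \<bullet> x))"
      using flat_has_derivative[of k "1 - x \<bullet> x"] by (simp add: has_field_derivative_def)
    ultimately show ?thesis by (rule has_derivative_compose)
  qed
  moreover have "bump_class (\<lambda>x. ?D x v)" for v
  proof -
    have "bump_class (\<lambda>x. (x \<bullet> v) * (-2 * (flat (k + 2) (1 - x \<bullet> x) + (- real k) * flat (k + 1) (1 - x \<bullet> x))))"
      by (intro bump_class.intros)
    also have "(\<lambda>x. (x \<bullet> v) * (-2 * (flat (k + 2) (1 - x \<bullet> x) + (- real k) * flat (k + 1) (1 - x \<bullet> x)))) = (\<lambda>x. ?D x v)"
      by (intro ext) (simp add: inner_commute algebra_simps)
    finally show ?thesis .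
  qed
  ultimately show ?case by (intro exI[of _ ?D]) blast
next
  case (cmult f c)
  then obtain D where D: "\<And>x. (f has_derivative D x) (at x)" "\<And>v. bump_class (\<lambda>x. D x v)" by blast
  show ?case
  proof (intro exI[of _ "\<lambda>x v. c * D x v"] conjI allI)
    show "((\<lambda>x. c * f x) has_derivative (\<lambda>v. c * D x v)) (at x)" for x by (intro has_derivative_mult_right D)
  qed (intro bump_class.intros D)
next
  case (inner f a)
  then obtain D where D: "\<And>x. (f has_derivative D x) (at x)" "\<And>v. bump_class (\<lambda>x. D x v)" by blast
  show ?case
  proof (intro exI[of _ "\<lambda>x v. (x \<bullet> a) * D x v + (v \<bullet> a) * f x"] conjI allI)
    show "((\<lambda>x. (x \<bullet> a) * f x) has_derivative (\<lambda>v. (x \<bullet> a) * D x v + (v \<bullet> a) * f x)) (at x)" for x 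
      by (rule has_derivative_mult[OF _ D(1)]) (auto intro!: derivative_eq_intros)
  qed (intro bump_class.intros D inner.hyps)
next
  case (add f g)
  then obtain D D' where D: "\<And>x. (f has_derivative D x) (at x)" "\<And>v. bump_class (\<lambda>x. D x v)" 
    "\<And>x. (g has_derivative D' x) (at x)" "\<And>v. bump_class (\<lambda>x. D' x v)" by blast
  show ?case
  proof (intro exI[of _ "\<lambda>x v. D x v + D' x v"] conjI allI)
    show "((\<lambda>x. f x + g x) has_derivative (\<lambda>v. D x v + D' x v)) (at x)" for x by (intro has_derivative_add D)
  qed (intro bump_class.intros D)
qed

lemma bump_class_bounded:
  assumes "bump_class f"
  shows "(\<forall>x. 1 \<le> norm x \<longrightarrow> f x = 0) \<and> (\<exists>M\<ge>0. \<forall>x. \<bar>f x\<bar> \<le> M)"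
  using assms
proof induction
  case (flat k)
  have z: "flat k (1 - x \<bullet> x) = 0" if "1 \<le> norm x" for x :: "real^2"
    using that by (simp add: flat_def dot_square_norm)
  have "\<bar>flat k (1 - x \<bullet> x)\<bar> \<le> fact (Suc k)" for x :: "real^2"
  proof (cases "1 \<le> norm x")
    case False
    then have "x \<bullet> x \<le> 1" by (simp add: dot_square_norm power_le_one)
    then have "\<bar>1 - x \<bullet> x\<bar> \<le> 1" by (simp add: abs_le_iff)
    then have "fact (Suc k) * \<bar>1 - x \<bullet> x\<bar> \<le> fact (Suc k) * 1" by (intro mult_left_mono) auto
    then show ?thesis using flat_le[of k "1 - x \<bullet> x"] flat_nonneg[of k "1 - x \<bullet> x"] by linarith
  qed (simp add: z del: fact_Suc)
  then show ?case using z by (intro conjI exI[of _ "fact (Suc k)"]) auto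
next
  case (cmult f c)
  then obtain M where "0 \<le> M" "\<And>x. \<bar>f x\<bar> \<le> M" by blast
  then show ?case using cmult.IH by (intro conjI exI[of _ "\<bar>c\<bar> * M"]) (auto simp: abs_mult mult_left_mono)
next
  case (inner f a)
  then obtain M where M: "0 \<le> M" "\<And>x. \<bar>f x\<bar> \<le> M" by blast
  have "\<bar>(x \<bullet> a) * f x\<bar> \<le> norm a * M" for x
  proof (cases "1 \<le> norm x")
    case False
    have "\<bar>x \<bullet> a\<bar> \<le> norm x * norm a" by (rule Cauchy_Schwarz_ineq2)
    also have "\<dots> \<le> 1 * norm a" using False by (intro mult_right_mono) auto
    finally show ?thesis unfolding abs_mult using M by (intro mult_mono) auto
  qed (use inner.IH M in auto)
  then show ?case using inner.IH M by (intro conjI exI[of _ "norm a * M"]) auto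
next
  case (add f g)
  then obtain M M' where "0 \<le> M" "\<And>x. \<bar>f x\<bar> \<le> M" "0 \<le> M'" "\<And>x. \<bar>g x\<bar> \<le> M'" by blast
  then show ?case using add.IH 
    by (intro conjI exI[of _ "M + M'"]) (auto intro: order_trans[OF abs_triangle_ineq add_mono])
qed

lemma derivative_bump_bounded:
  assumes D: "\<And>x. (f has_derivative D x) (at x)" "\<And>v. bump_class (\<lambda>x. D x v)"
  shows "\<exists>M\<ge>0. \<forall>x v. \<bar>D x v\<bar> \<le> M * norm v"
proof -
  have "\<forall>b. \<exists>M\<ge>0. \<forall>x. \<bar>D x b\<bar> \<le> M" using bump_class_bounded[OF D(2)] by blast
  then obtain M where M: "\<And>b. 0 \<le> M b" "\<And>b x. \<bar>D x b\<bar> \<le> M b" by metis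
  have "\<bar>D x v\<bar> \<le> (\<Sum>b\<in>Basis. M b) * norm v" for x v
  proof -
    have lin: "linear (D x)" using D(1)[of x] by (simp add: has_derivative_linear)
    have "D x v = D x (\<Sum>b\<in>Basis. (v \<bullet> b) *\<^sub>R b)" by (simp add: euclidean_representation)
    also have "\<dots> = (\<Sum>b\<in>Basis. (v \<bullet> b) * D x b)" by (simp add: linear_sum[OF lin] linear_cmul[OF lin])
    also have "\<bar>\<dots>\<bar> \<le> (\<Sum>b\<in>Basis. \<bar>(v \<bullet> b) * D x b\<bar>)" by (rule sum_abs)
    also have "\<dots> \<le> (\<Sum>b\<in>Basis. norm v * M b)"
      unfolding abs_mult using M by (intro sum_mono mult_mono) (auto simp: Basis_le_norm)
    finally show ?thesis unfolding sum_distrib_right by (simp only: mult.commute)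
  qed
  then show ?thesis using M(1) by (intro exI[of _ "\<Sum>b\<in>Basis. M b"]) (auto intro: sum_nonneg)
qed

lemma bump_class_lipschitz:
  assumes "bump_class f"
  shows "\<exists>L\<ge>0. \<forall>x y. \<bar>f x - f y\<bar> \<le> L * norm (x - y)"
proof -
  obtain D where D: "\<And>x. (f has_derivative D x) (at x)" "\<And>v. bump_class (\<lambda>x. D x v)" using bump_class_derivative[OF assms] by blast
  obtain M where M: "0 \<le> M" "\<And>x v. \<bar>D x v\<bar> \<le> M * norm v" using derivative_bump_bounded[OF D] by blast
  have "norm (f x - f y) \<le> M * norm (x - y)" for x y
  proof (rule differentiable_bound[of UNIV])
    show "(f has_derivative D x) (at x within UNIV)" for x by (rule D)
    show "onorm (D x) \<le> M" for x using M by (intro onorm_bound) auto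
  qed auto
  then show ?thesis using M(1) by auto
qed

text \<open>The mean value theorem along a segment, with a Lipschitz derivative, gives a remainder
  uniform in \<open>x\<close>. This uniformity permits differentiation under the integral against a
  merely integrable function.\<close>

lemma bump_class_taylor:
  assumes D: "\<And>x. (f has_derivative D x) (at x)" "\<And>v. bump_class (\<lambda>x. D x v)"
  shows "\<exists>C\<ge>0. \<forall>x h. \<bar>f (x + h) - f x - D x h\<bar> \<le> C * (norm h)\<^sup>2"
proof -
  have "\<forall>b. \<exists>L\<ge>0. \<forall>x y. \<bar>D x b - D y b\<bar> \<le> L * norm (x - y)" using bump_class_lipschitz[OF D(2)] by blast
  then obtain L where L: "\<And>b. 0 \<le> L b" "\<And>b x y. \<bar>D x b - D y b\<bar> \<le> L b * norm (x - y)" by metis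
  define C where "C = (\<Sum>b\<in>Basis. L b)"
  have C0: "0 \<le> C" unfolding C_def using L by (intro sum_nonneg) auto
  have lip: "\<bar>D x v - D y v\<bar> \<le> C * norm (x - y) * norm v" for x y v
  proof -
    have lin: "linear (D x)" for x using D(1)[of x] by (simp add: has_derivative_linear)
    have e: "D x v = (\<Sum>b\<in>Basis. (v \<bullet> b) * D x b)" for x
    proof -
      have "D x v = D x (\<Sum>b\<in>Basis. (v \<bullet> b) *\<^sub>R b)" by (simp add: euclidean_representation)
      then show ?thesis by (simp add: linear_sum[OF lin] linear_cmul[OF lin])
    qed
    have "D x v - D y v = (\<Sum>b\<in>Basis. (v \<bullet> b) * (D x b - D y b))"
      by (simp add: e[of x] e[of y] right_diff_distrib sum_subtractf)
    also have "\<bar>\<dots>\<bar> \<le> (\<Sum>b\<in>Basis. \<bar>(v \<bullet> b) * (D x b - D y b)\<bar>)" by (rule sum_abs)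
    also have "\<dots> \<le> (\<Sum>b\<in>Basis. norm v * (L b * norm (x - y)))"
      unfolding abs_mult using L by (intro sum_mono mult_mono) (auto simp: Basis_le_norm)
    also have "\<dots> = C * norm (x - y) * norm v" by (simp add: C_def sum_distrib_right sum_distrib_left mult_ac)
    finally show ?thesis .
  qed
  have "\<bar>f (x + h) - f x - D x h\<bar> \<le> C * (norm h)\<^sup>2" for x h
  proof -
    have lin: "linear (D x)" for x using D(1)[of x] by (simp add: has_derivative_linear)
    let ?g = "\<lambda>t::real. f (x + t *\<^sub>R h) - t * D x h"
    have "\<exists>t. 0 < t \<and> t < 1 \<and> ?g 1 - ?g 0 = (1 - 0) * (D (x + t *\<^sub>R h) h - D x h)"
    proof (rule MVT2)
      fix t :: real
      have "((\<lambda>t. x + t *\<^sub>R h) has_derivative (\<lambda>d. d *\<^sub>R h)) (at t)" by (auto intro!: derivative_eq_intros)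
      from has_derivative_compose[OF this D(1)]
      have "((\<lambda>t. f (x + t *\<^sub>R h)) has_derivative (\<lambda>d. D (x + t *\<^sub>R h) (d *\<^sub>R h))) (at t)" .
      then have "((\<lambda>t. f (x + t *\<^sub>R h)) has_real_derivative D (x + t *\<^sub>R h) h) (at t)"
        by (simp add: has_field_derivative_def linear_cmul[OF lin] mult.commute[of _ "D _ _"])
      then show "(?g has_real_derivative D (x + t *\<^sub>R h) h - D x h) (at t)"
        by (auto intro!: derivative_eq_intros)
    qed simp
    then obtain t where t: "0 < t" "t < 1" "?g 1 - ?g 0 = D (x + t *\<^sub>R h) h - D x h" by auto
    have "\<bar>f (x + h) - f x - D x h\<bar> = \<bar>D (x + t *\<^sub>R h) h - D x h\<bar>" using t(3) by simp
    also have "\<dots> \<le> C * norm (x + t *\<^sub>R h - x) * norm h" by (rule lip)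
    also have "\<dots> \<le> C * norm h * norm h"
      using t C0 by (intro mult_right_mono mult_left_mono) (auto simp: mult_left_le_one_le)
    finally show ?thesis by (simp add: power2_eq_square mult.assoc)
  qed
  then show ?thesis using C0 by blast
qed

lemma bump_class_measurable: "bump_class f \<Longrightarrow> f \<in> borel_measurable borel"
  using bump_class_derivative[of f]
  by (intro borel_measurable_continuous_onI continuous_at_imp_continuous_on) (auto intro: has_derivative_continuous)

section \<open>Convolution of an integrable function with a bump\<close>

definition bconv :: "(real^2 \<Rightarrow> real) \<Rightarrow> real \<Rightarrow> (real^2 \<Rightarrow> real) \<Rightarrow> real^2 \<Rightarrow> real" where
  "bconv \<phi> c g x = (\<integral>y. \<phi> y * g (c *\<^sub>R (x - y)) \<partial>lborel)"

lemma bconv_integrable: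
  assumes \<phi>: "integrable lborel \<phi>" and g: "bump_class g"
  shows "integrable lborel (\<lambda>y. \<phi> y * g (c *\<^sub>R (x - y)))"
proof -
  obtain M where M: "0 \<le> M" "\<And>x. \<bar>g x\<bar> \<le> M" using bump_class_bounded[OF g] by blast
  have [measurable]: "g \<in> borel_measurable borel" by (rule bump_class_measurable[OF g])
  have [measurable]: "\<phi> \<in> borel_measurable borel" using \<phi> by auto
  show ?thesis
    using M by (intro Bochner_Integration.integrable_bound[OF integrable_mult_right[OF \<phi>, of M]] AE_I2)
      (auto simp: abs_mult mult.commute[of M] intro!: mult_left_mono)
qed

lemma bconv_derivative:
  assumes \<phi>: "integrable lborel \<phi>" and g: "bump_class g"
    and D: "\<And>x. (g has_derivative D x) (at x)" "\<And>v. bump_class (\<lambda>x. D x v)"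
  shows "(bconv \<phi> c g has_derivative (\<lambda>v. bconv \<phi> c (\<lambda>x. c * D x v) x)) (at x)"
proof -
  obtain C where C: "0 \<le> C" "\<And>x h. \<bar>g (x + h) - g x - D x h\<bar> \<le> C * (norm h)\<^sup>2" using bump_class_taylor[OF D] by blast
  have lin: "linear (D x)" for x using D(1)[of x] by (simp add: has_derivative_linear)
  have bc: "bump_class (\<lambda>x. c * D x v)" for v by (intro bump_class.intros D)
  let ?B = "\<lambda>v. bconv \<phi> c (\<lambda>x. c * D x v) x"
  define I where "I = (\<integral>y. \<bar>\<phi> y\<bar> \<partial>lborel)"
  have "linear ?B"
  proof (rule linearI)
    show "?B (v + v') = ?B v + ?B v'" for v v'
      unfolding bconv_def using bconv_integrable[OF \<phi> bc, of c x]
      by (subst Bochner_Integration.integral_add[symmetric]) (auto simp: linear_add[OF lin] algebra_simps)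
    show "?B (r *\<^sub>R v) = r *\<^sub>R ?B v" for r v
      unfolding bconv_def by (subst real_scaleR_def, subst integral_mult_right_zero[symmetric]) (simp add: linear_cmul[OF lin] mult_ac)
  qed
  then have bl: "bounded_linear ?B" by (simp add: linear_conv_bounded_linear)
  have rem: "norm (bconv \<phi> c g (x + h) - bconv \<phi> c g x - ?B h) \<le> (I * C * c\<^sup>2) * (norm h)\<^sup>2" for h
  proof -
    have "bconv \<phi> c g (x + h) - bconv \<phi> c g x - ?B h = (\<integral>y. \<phi> y * (g (c *\<^sub>R (x + h - y)) - g (c *\<^sub>R (x - y)) - c * D (c *\<^sub>R (x - y)) h) \<partial>lborel)"
      unfolding bconv_def right_diff_distrib
      using bconv_integrable[OF \<phi> bc, of c x h] bconv_integrable[OF \<phi> g, of c x] bconv_integrable[OF \<phi> g, of c "x + h"] by simp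
    also have "norm \<dots> \<le> (\<integral>y. \<bar>\<phi> y\<bar> * (C * c\<^sup>2 * (norm h)\<^sup>2) \<partial>lborel)"
    proof (rule Bochner_Integration.integral_norm_bound_integral)
      show "integrable lborel (\<lambda>y. \<phi> y * (g (c *\<^sub>R (x + h - y)) - g (c *\<^sub>R (x - y)) - c * D (c *\<^sub>R (x - y)) h))"
        unfolding right_diff_distrib
        using bconv_integrable[OF \<phi> bc, of c x h] bconv_integrable[OF \<phi> g, of c x] bconv_integrable[OF \<phi> g, of c "x + h"] by simp
      show "integrable lborel (\<lambda>y. \<bar>\<phi> y\<bar> * (C * c\<^sup>2 * (norm h)\<^sup>2))" using \<phi> by auto
      fix y
      have "c *\<^sub>R (x + h - y) = c *\<^sub>R (x - y) + c *\<^sub>R h" by (simp add: algebra_simps)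
      then have "\<bar>g (c *\<^sub>R (x + h - y)) - g (c *\<^sub>R (x - y)) - c * D (c *\<^sub>R (x - y)) h\<bar> \<le> C * (norm (c *\<^sub>R h))\<^sup>2"
        using C(2)[of "c *\<^sub>R (x - y)" "c *\<^sub>R h"] by (simp only: linear_cmul[OF lin] real_scaleR_def)
      also have "\<dots> = C * c\<^sup>2 * (norm h)\<^sup>2" by (simp add: power_mult_distrib)
      finally show "norm (\<phi> y * (g (c *\<^sub>R (x + h - y)) - g (c *\<^sub>R (x - y)) - c * D (c *\<^sub>R (x - y)) h)) \<le> \<bar>\<phi> y\<bar> * (C * c\<^sup>2 * (norm h)\<^sup>2)"
        by (simp add: abs_mult mult_left_mono)
    qed
    also have "\<dots> = (I * C * c\<^sup>2) * (norm h)\<^sup>2" by (simp add: I_def)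
    finally show ?thesis .
  qed
  show ?thesis
    unfolding has_derivative_at
  proof (intro conjI bl)
    show "(\<lambda>h. norm (bconv \<phi> c g (x + h) - bconv \<phi> c g x - ?B h) / norm h) \<midarrow>0\<rightarrow> 0"
    proof (rule Lim_null_comparison)
      show "\<forall>\<^sub>F h in at 0. norm (norm (bconv \<phi> c g (x + h) - bconv \<phi> c g x - ?B h) / norm h) \<le> (I * C * c\<^sup>2) * norm h"
      proof (rule always_eventually, rule allI)
        fix h
        show "norm (norm (bconv \<phi> c g (x + h) - bconv \<phi> c g x - ?B h) / norm h) \<le> (I * C * c\<^sup>2) * norm h"
          using rem[of h] by (cases "h = 0") (auto simp: divide_le_eq power2_eq_square mult.assoc)
      qed
      show "(\<lambda>h. (I * C * c\<^sup>2) * norm h) \<midarrow>0\<rightarrow> 0" by (rule tendsto_eq_intros refl)+ simp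
    qed
  qed
qed

lemma bconv_smooth:
  assumes \<phi>: "integrable lborel \<phi>" and g: "bump_class g"
  shows "smooth_fun (bconv \<phi> c g)"
proof -
  define X where "X F \<longleftrightarrow> (\<exists>g. bump_class g \<and> F = bconv \<phi> c g)" for F
  have "X (bconv \<phi> c g)" using g by (auto simp: X_def)
  then show ?thesis
  proof (rule smooth_fun.coinduct[of X])
    fix F assume "X F"
    then obtain g where g: "bump_class g" "F = bconv \<phi> c g" by (auto simp: X_def)
    obtain D where D: "\<And>x. (g has_derivative D x) (at x)" "\<And>v. bump_class (\<lambda>x. D x v)" using bump_class_derivative[OF g(1)] by blast
    have F: "(F has_derivative (\<lambda>v. bconv \<phi> c (\<lambda>x. c * D x v) x)) (at x)" for x
      unfolding g(2) by (rule bconv_derivative[OF \<phi> g(1) D])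
    then have fd: "frechet_derivative F (at x) = (\<lambda>v. bconv \<phi> c (\<lambda>x. c * D x v) x)" for x
      using frechet_derivative_at[OF F] by simp
    have "X (\<lambda>x. frechet_derivative F (at x) v)" for v
      unfolding X_def fd by (intro exI[of _ "\<lambda>x. c * D x v"] conjI bump_class.intros D) (rule ext, simp)
    moreover have "F differentiable (at x)" for x using F by (auto simp: differentiable_def)
    ultimately show "\<exists>f. F = f \<and> (\<forall>x. f differentiable (at x)) \<and>
        (\<forall>v. X (\<lambda>x. frechet_derivative f (at x) v) \<or> smooth_fun (\<lambda>x. frechet_derivative f (at x) v))" by blast
  qed
qed

text \<open>Pointwise convergence without loss of norm: apply Fatou's lemma to \<open>(a n + b)\<^sup>2\<close> in the parallelogram identity.\<close>

lemma L2_strong_convergence: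
  fixes a :: "nat \<Rightarrow> 'p \<Rightarrow> real"
  assumes [measurable]: "\<And>n. a n \<in> borel_measurable M" "b \<in> borel_measurable M"
    and lim: "\<And>p. (\<lambda>n. a n p) \<longlonglongrightarrow> b p"
    and le: "\<And>n. (\<integral>\<^sup>+p. ennreal ((a n p)\<^sup>2) \<partial>M) \<le> (\<integral>\<^sup>+p. ennreal ((b p)\<^sup>2) \<partial>M)"
    and fin: "(\<integral>\<^sup>+p. ennreal ((b p)\<^sup>2) \<partial>M) < \<infinity>"
  shows "(\<lambda>n. \<integral>\<^sup>+p. ennreal ((a n p - b p)\<^sup>2) \<partial>M) \<longlonglongrightarrow> 0"
proof -
  define c where "c n = (\<integral>\<^sup>+p. ennreal ((a n p + b p)\<^sup>2) \<partial>M)" for n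
  define d where "d n = (\<integral>\<^sup>+p. ennreal ((a n p - b p)\<^sup>2) \<partial>M)" for n
  obtain S where S: "0 \<le> S" "(\<integral>\<^sup>+p. ennreal ((b p)\<^sup>2) \<partial>M) = ennreal S"
    using fin by (metis ennreal_cases infinity_ennreal_def less_irrefl)
  have cd: "d n + c n \<le> ennreal (4 * S)" for n
  proof -
    have "d n + c n = (\<integral>\<^sup>+p. ennreal ((a n p - b p)\<^sup>2) + ennreal ((a n p + b p)\<^sup>2) \<partial>M)"
      unfolding c_def d_def by (rule nn_integral_add[symmetric]) measurable
    also have "\<dots> = (\<integral>\<^sup>+p. 2 * ennreal ((a n p)\<^sup>2) + 2 * ennreal ((b p)\<^sup>2) \<partial>M)"
    proof (intro nn_integral_cong)
      fix p
      have "(a n p - b p)\<^sup>2 + (a n p + b p)\<^sup>2 = 2 * (a n p)\<^sup>2 + 2 * (b p)\<^sup>2" by (simp add: power2_eq_square algebra_simps)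
      then have "ennreal ((a n p - b p)\<^sup>2 + (a n p + b p)\<^sup>2) = ennreal (2 * (a n p)\<^sup>2 + 2 * (b p)\<^sup>2)" by simp
      then show "ennreal ((a n p - b p)\<^sup>2) + ennreal ((a n p + b p)\<^sup>2) = 2 * ennreal ((a n p)\<^sup>2) + 2 * ennreal ((b p)\<^sup>2)"
        by (simp add: ennreal_mult)
    qed
    also have "\<dots> = 2 * (\<integral>\<^sup>+p. ennreal ((a n p)\<^sup>2) \<partial>M) + 2 * (\<integral>\<^sup>+p. ennreal ((b p)\<^sup>2) \<partial>M)"
      by (simp add: nn_integral_add nn_integral_cmult)
    also have "\<dots> \<le> 2 * ennreal S + 2 * ennreal S"
      using le[of n] S(2) by (intro add_mono mult_left_mono) auto
    also have "\<dots> = ennreal (4 * S)" using S(1) 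
      by (simp add: ennreal_mult[symmetric] ennreal_plus[symmetric] ennreal_numeral[symmetric] del: ennreal_plus ennreal_numeral)
    finally show ?thesis .
  qed
  have "d n \<le> ennreal (4 * S)" "c n \<le> ennreal (4 * S)" for n
    using order_trans[OF add_increasing2[OF zero_le order_refl] cd] order_trans[OF add_increasing[OF zero_le order_refl] cd] by blast+
  then have fin': "d n < \<infinity>" "c n < \<infinity>" for n
    by (auto intro: le_less_trans[OF _ ennreal_less_top])
  have lc: "ennreal (4 * S) \<le> liminf c"
  proof -
    have "ennreal (4 * S) = 4 * (\<integral>\<^sup>+p. ennreal ((b p)\<^sup>2) \<partial>M)" using S by (simp add: ennreal_mult)
    also have "\<dots> = (\<integral>\<^sup>+p. 4 * ennreal ((b p)\<^sup>2) \<partial>M)" by (rule nn_integral_cmult[symmetric]) measurable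
    also have "\<dots> = (\<integral>\<^sup>+p. liminf (\<lambda>n. ennreal ((a n p + b p)\<^sup>2)) \<partial>M)"
    proof (intro nn_integral_cong)
      fix p
      have "(\<lambda>n. (a n p + b p)\<^sup>2) \<longlonglongrightarrow> (b p + b p)\<^sup>2" by (intro tendsto_intros lim)
      then have "liminf (\<lambda>n. ennreal ((a n p + b p)\<^sup>2)) = ennreal ((b p + b p)\<^sup>2)"
        by (intro lim_imp_Liminf tendsto_ennrealI) auto
      also have "(b p + b p)\<^sup>2 = 4 * (b p)\<^sup>2" by (simp add: power2_eq_square)
      finally show "4 * ennreal ((b p)\<^sup>2) = liminf (\<lambda>n. ennreal ((a n p + b p)\<^sup>2))" by (simp add: ennreal_mult)
    qed
    also have "\<dots> \<le> liminf c" unfolding c_def by (rule nn_integral_liminf) measurable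
    finally show ?thesis .
  qed
  have "(\<lambda>n. enn2real (d n)) \<longlonglongrightarrow> 0"
  proof (rule LIMSEQ_I)
    fix e :: real assume e: "0 < e"
    have "\<forall>\<^sub>F n in sequentially. enn2real (d n) < e"
    \<comment> \<open>For \<open>S = 0\<close> the strict comparison of
      \<open>ennreal (4 * S - e)\<close> with \<open>ennreal (4 * S)\<close> would fail, both being
      0.\<close>
    proof (cases "S = 0")
      case True
      then have "d n = 0" for n using cd[of n] by (simp add: add_nonneg_eq_0_iff)
      then show ?thesis using e by simp
    next
      case False
      have "ennreal (4 * S - e) < ennreal (4 * S)" using False S(1) e by (intro ennreal_lessI) auto
      also note lc
      finally have "\<forall>\<^sub>F n in sequentially. ennreal (4 * S - e) < c n" by (rule less_LiminfD)
      then show ?thesis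
      proof eventually_elim
        case (elim n)
        have c: "c n = ennreal (enn2real (c n))" and d: "d n = ennreal (enn2real (d n))" using fin'[of n] by auto
        have "4 * S - e < enn2real (c n)" using elim c by (metis ennreal_leI not_le)
        moreover have "enn2real (d n) + enn2real (c n) \<le> 4 * S"
        proof -
          have "ennreal (enn2real (d n) + enn2real (c n)) \<le> ennreal (4 * S)" using cd[of n] c d by (subst ennreal_plus) auto
          then show ?thesis by (subst (asm) ennreal_le_iff) (use S(1) in auto)
        qed
        ultimately show ?case by simp
      qed
    qed
    then show "\<exists>no. \<forall>n\<ge>no. norm (enn2real (d n) - 0) < e" by (auto simp: eventually_sequentially)
  qed
  then have "(\<lambda>n. ennreal (enn2real (d n))) \<longlonglongrightarrow> ennreal 0" by (rule tendsto_ennrealI)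
  moreover have "ennreal (enn2real (d n)) = d n" for n using fin'(1)[of n] by simp
  ultimately show ?thesis by (simp add: d_def)
qed

context fractional_order begin

subsection \<open>Minimality against rough competitors\<close>

definition g0 :: "real^2 \<Rightarrow> real" where "g0 x = flat 0 (1 - x \<bullet> x)"
definition \<kappa> :: real where "\<kappa> = (\<integral>x. g0 x \<partial>lborel)"
text \<open>The parameter \<open>c\<close> is an inverse width: the mass is 1 and the support lies
  in the disc of radius \<open>1 / c\<close>, so mollifications converge as \<open>c\<close> tends
  to infinity.\<close>

definition \<psi> :: "real \<Rightarrow> real^2 \<Rightarrow> real" where "\<psi> c h = c\<^sup>2 / \<kappa> * g0 (c *\<^sub>R h)"

lemma g0_bump: "bump_class g0" unfolding g0_def by (rule bump_class.flat)
lemma g0_measurable [measurable]: "g0 \<in> borel_measurable borel" by (rule bump_class_measurable[OF g0_bump])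
lemma g0_nonneg [simp]: "0 \<le> g0 x" by (simp add: g0_def flat_nonneg)
lemma g0_outside: "1 \<le> norm x \<Longrightarrow> g0 x = 0" using bump_class_bounded[OF g0_bump] by blast
lemma g0_le: "g0 x \<le> 1" by (auto simp: g0_def flat_def)
lemma g0_uminus [simp]: "g0 (- x) = g0 x" by (simp add: g0_def)

lemma g0_integrable: "integrable lborel g0"
proof (rule Bochner_Integration.integrable_bound)
  show "integrable lborel (indicator (cball 0 1) :: real^2 \<Rightarrow> real)"
    by (rule integrable_real_indicator) (auto simp: emeasure_cball_plane)
  show "AE x in lborel. norm (g0 x) \<le> norm (indicator (cball 0 1) x :: real)"
    using g0_le g0_outside by (intro AE_I2) (auto simp: indicator_def)
qed measurable

lemma \<kappa>_pos: "0 < \<kappa>"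
proof -
  have "\<kappa> \<noteq> 0"
  proof
    assume "\<kappa> = 0"
    then have "AE x in lborel. g0 x = 0"
      unfolding \<kappa>_def by (subst (asm) integral_nonneg_eq_0_iff_AE[OF g0_integrable]) auto
    then have "AE x in lborel. x \<notin> ball (0::real^2) 1"
    proof eventually_elim
      case (elim x)
      have "1 - x \<bullet> x > 0" if "norm x < 1"
        using that by (simp add: dot_square_norm power_less_one_iff abs_square_less_1)
      then show ?case using elim by (auto simp: g0_def flat_def)
    qed
    then have "emeasure lborel {x \<in> space lborel. x \<in> ball (0::real^2) 1} = 0"
      by (rule emeasure_eq_0_AE)
    moreover have "{x \<in> space lborel. x \<in> ball (0::real^2) 1} = ball 0 1" by auto
    ultimately show False by (simp add: emeasure_cball_plane)
  qed
  moreover have "0 \<le> \<kappa>" unfolding \<kappa>_def by (intro integral_nonneg_AE) auto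
  ultimately show ?thesis by simp
qed

lemma \<psi>_measurable [measurable]: "\<psi> c \<in> borel_measurable borel" unfolding \<psi>_def by measurable
lemma \<psi>_nonneg [simp]: "0 \<le> \<psi> c h" using \<kappa>_pos by (simp add: \<psi>_def)
lemma \<psi>_uminus [simp]: "\<psi> c (- h) = \<psi> c h" by (simp add: \<psi>_def)
lemma \<psi>_outside: "0 < c \<Longrightarrow> 1 / c \<le> norm h \<Longrightarrow> \<psi> c h = 0"
  unfolding \<psi>_def by (subst g0_outside) (auto simp: field_simps)

lemma \<psi>_integrable: "0 < c \<Longrightarrow> integrable lborel (\<psi> c)"
  unfolding \<psi>_def using integrable_affine_iff[of g0 c 0] g0_integrable by simp

lemma \<psi>_integral: "0 < c \<Longrightarrow> (\<integral>h. \<psi> c h \<partial>lborel) = 1"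
  unfolding \<psi>_def using integral_affine[of g0 c 0] \<kappa>_pos by (simp add: \<kappa>_def[symmetric])

lemma \<psi>_nn_integral: "0 < c \<Longrightarrow> (\<integral>\<^sup>+h. ennreal (\<psi> c h) \<partial>lborel) = 1"
  by (subst nn_integral_eq_integral[OF \<psi>_integrable]) (auto simp: \<psi>_integral)

definition smo :: "real \<Rightarrow> (real^2 \<Rightarrow> real) \<Rightarrow> real^2 \<Rightarrow> real" where
  "smo c \<phi> x = (\<integral>h. \<phi> (x - h) * \<psi> c h \<partial>lborel)"

lemma smo_measurable [measurable]:
  assumes [measurable]: "\<phi> \<in> borel_measurable borel"
  shows "smo c \<phi> \<in> borel_measurable borel"
  unfolding smo_def by measurable

lemma smo_integrable:
  assumes [measurable]: "f \<in> borel_measurable borel" and M: "\<And>x. \<bar>f x\<bar> \<le> M" and c: "0 < c"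
  shows "integrable lborel (\<lambda>h. f h * \<psi> c h)"
proof (rule Bochner_Integration.integrable_bound[OF integrable_mult_right[OF \<psi>_integrable[OF c], of M]])
  show "AE h in lborel. norm (f h * \<psi> c h) \<le> norm (M * \<psi> c h)"
    using M by (intro AE_I2) (auto simp: abs_mult intro!: mult_right_mono order_trans[OF M abs_ge_self])
qed measurable

lemma smo_smooth:
  assumes \<phi>: "integrable lborel \<phi>"
  shows "smooth_fun (smo c \<phi>)"
proof -
  have [measurable]: "\<phi> \<in> borel_measurable borel" using \<phi> by auto
  have "smo c \<phi> = bconv \<phi> c (\<lambda>x. c\<^sup>2 / \<kappa> * g0 x)"
  proof
    fix x
    have "smo c \<phi> x = (\<integral>h. \<phi> (x + h) * \<psi> c (x - (x + h)) \<partial>lborel)"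
      unfolding smo_def by (subst integral_affine[of _ "-1" 0]) auto
    also have "\<dots> = (\<integral>y. \<phi> y * \<psi> c (x - y) \<partial>lborel)"
      by (rule integral_translate) measurable
    finally show "smo c \<phi> x = bconv \<phi> c (\<lambda>x. c\<^sup>2 / \<kappa> * g0 x) x" by (simp add: bconv_def \<psi>_def)
  qed
  then show ?thesis by (simp only: bconv_smooth[OF \<phi> bump_class.cmult[OF g0_bump]])
qed

lemma smo_bound:
  assumes [measurable]: "\<phi> \<in> borel_measurable borel" and M: "\<And>x. \<bar>\<phi> x\<bar> \<le> M" and c: "0 < c"
  shows "\<bar>smo c \<phi> x\<bar> \<le> M"
proof -
  have "\<bar>smo c \<phi> x\<bar> \<le> (\<integral>h. \<bar>\<phi> (x - h) * \<psi> c h\<bar> \<partial>lborel)" unfolding smo_def by (rule integral_abs_bound)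
  also have "\<dots> \<le> (\<integral>h. M * \<psi> c h \<partial>lborel)"
  proof (rule integral_mono)
    show "integrable lborel (\<lambda>h. \<bar>\<phi> (x - h) * \<psi> c h\<bar>)"
      by (intro integrable_abs smo_integrable[OF _ _ c, of _ M]) (auto intro: M)
    show "\<bar>\<phi> (x - h) * \<psi> c h\<bar> \<le> M * \<psi> c h" for h using M by (auto simp: abs_mult intro!: mult_right_mono)
  qed (use \<psi>_integrable[OF c] in simp)
  also have "\<dots> = M" using \<psi>_integral[OF c] by simp
  finally show ?thesis .
qed

lemma smo_support:
  assumes c: "0 < c" and supp: "\<And>x. \<phi> x \<noteq> 0 \<Longrightarrow> norm x \<le> r" and x: "smo c \<phi> x \<noteq> 0"
  shows "norm x \<le> r + 1 / c"
proof (rule ccontr)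
  assume neg: "\<not> ?thesis"
  have "smo c \<phi> x = (\<integral>h. 0 \<partial>(lborel :: (real^2) measure))"
    unfolding smo_def
  proof (rule Bochner_Integration.integral_cong[OF refl])
    fix h
    show "\<phi> (x - h) * \<psi> c h = 0"
    proof (cases "norm h < 1 / c")
      case True
      then have "r < norm (x - h)" using neg norm_triangle_ineq2[of x h] by linarith
      then have "\<phi> (x - h) = 0" using supp[of "x - h"] by fastforce
      then show ?thesis by simp
    qed (simp add: \<psi>_outside[OF c])
  qed
  then show False using x by simp
qed

text \<open>As for the cone, \<open>\<psi>\<close> is at most
  \<open>(1 / c) powr s / \<kappa>\<close> times the kernel, so finiteness of
  \<open>nosc \<phi> x\<close> gives a rate of convergence at \<open>x\<close>.\<close>

lemma smo_limit:
  assumes \<phi>: "regular \<phi>" and M: "\<And>x. \<bar>\<phi> x\<bar> \<le> M" and c: "\<And>n::nat. 0 < c n" "filterlim c at_top sequentially"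
  shows "(\<lambda>n. smo (c n) \<phi> x) \<longlonglongrightarrow> \<phi> x"
proof -
  have [measurable]: "\<phi> \<in> borel_measurable borel" by (rule regular_measurable[OF \<phi>])
  have e0: "(\<lambda>n. 1 / c n) \<longlonglongrightarrow> 0" using tendsto_inverse_0_at_top[OF c(2)] by (simp add: inverse_eq_divide)
  have "(\<lambda>n. smo (c n) \<phi> x - \<phi> x) \<longlonglongrightarrow> 0"
  proof (rule Lim_null_comparison)
    show "(\<lambda>n. (1 / c n) powr s * (nosc \<phi> x / \<kappa>)) \<longlonglongrightarrow> 0"
      using c(1) s0 by (intro tendsto_mult_left_zero tendsto_zero_powrI[OF e0 tendsto_const]) (auto intro: less_imp_le always_eventually)
    show "\<forall>\<^sub>F n in sequentially. norm (smo (c n) \<phi> x - \<phi> x) \<le> (1 / c n) powr s * (nosc \<phi> x / \<kappa>)"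
    proof (rule always_eventually, rule allI)
      fix n
      define e where "e = 1 / c n"
      have e: "0 < e" "c n = 1 / e" using c(1)[of n] by (auto simp: e_def)
      have i1: "integrable lborel (\<lambda>h. \<phi> (x - h) * \<psi> (c n) h)" by (intro smo_integrable[of _ M]) (auto intro: M c)
      have i2: "integrable lborel (\<lambda>h. \<phi> x * \<psi> (c n) h)" using \<psi>_integrable[OF c(1)] by simp
      have eq: "smo (c n) \<phi> x - \<phi> x = (\<integral>h. \<phi> (x - h) * \<psi> (c n) h - \<phi> x * \<psi> (c n) h \<partial>lborel)"
        using i1 i2 \<psi>_integral[OF c(1)] by (simp add: smo_def)
      have iK: "integrable lborel (\<lambda>h. \<bar>\<phi> x - \<phi> (x - h)\<bar> * K h)" "(\<integral>h. \<bar>\<phi> x - \<phi> (x - h)\<bar> * K h \<partial>lborel) = nosc \<phi> x"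
        using regular_integrable'[OF \<phi>, of x]
          integrable_affine_iff[of "\<lambda>z. \<bar>\<phi> x - \<phi> z\<bar> * K (z - x)" "-1" x] integral_affine[of "\<lambda>z. \<bar>\<phi> x - \<phi> z\<bar> * K (z - x)" "-1" x]
        by simp_all
      have "\<bar>smo (c n) \<phi> x - \<phi> x\<bar> \<le> (\<integral>h. \<bar>\<phi> (x - h) * \<psi> (c n) h - \<phi> x * \<psi> (c n) h\<bar> \<partial>lborel)"
        unfolding eq by (rule integral_abs_bound)
      also have "\<dots> \<le> (\<integral>h. e powr s / \<kappa> * (\<bar>\<phi> x - \<phi> (x - h)\<bar> * K h) \<partial>lborel)"
      proof (rule integral_mono_AE)
        show "integrable lborel (\<lambda>h. \<bar>\<phi> (x - h) * \<psi> (c n) h - \<phi> x * \<psi> (c n) h\<bar>)" using i1 i2 by auto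
        show "integrable lborel (\<lambda>h. e powr s / \<kappa> * (\<bar>\<phi> x - \<phi> (x - h)\<bar> * K h))" using iK by simp
        show "AE h in lborel. \<bar>\<phi> (x - h) * \<psi> (c n) h - \<phi> x * \<psi> (c n) h\<bar> \<le> e powr s / \<kappa> * (\<bar>\<phi> x - \<phi> (x - h)\<bar> * K h)"
          using AE_nonzero[of 0]
        proof eventually_elim
          case (elim h)
          have "\<psi> (c n) h \<le> e powr s / \<kappa> * K h"
          proof (cases "norm h < e")
            case True
            have "norm h powr (2 + s) \<le> e powr (2 + s)" using True s0 by (intro powr_mono2) auto
            then have "e powr s / e powr (2 + s) \<le> e powr s * K h"
              using elim e unfolding K_def times_divide_eq_right mult_1_right
              by (intro divide_left_mono mult_pos_pos) auto
            moreover have "e powr s / e powr (2 + s) = (c n)\<^sup>2" using e by (simp add: powr_add power_divide)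
            ultimately have "(c n)\<^sup>2 / \<kappa> \<le> e powr s * K h / \<kappa>" using \<kappa>_pos by (simp add: divide_right_mono)
            moreover have "\<psi> (c n) h \<le> (c n)\<^sup>2 / \<kappa> * 1" unfolding \<psi>_def using \<kappa>_pos by (intro mult_left_mono g0_le) auto
            ultimately show ?thesis by simp
          next
            case False
            then have "\<psi> (c n) h = 0" by (intro \<psi>_outside c) (auto simp: e_def)
            then show ?thesis using \<kappa>_pos by simp
          qed
          then have "\<bar>\<phi> x - \<phi> (x - h)\<bar> * \<psi> (c n) h \<le> \<bar>\<phi> x - \<phi> (x - h)\<bar> * (e powr s / \<kappa> * K h)"
            by (rule mult_left_mono) simp
          moreover have "\<bar>\<phi> (x - h) * \<psi> (c n) h - \<phi> x * \<psi> (c n) h\<bar> = \<bar>\<phi> x - \<phi> (x - h)\<bar> * \<psi> (c n) h"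
            by (simp add: left_diff_distrib[symmetric] abs_mult abs_minus_commute)
          ultimately show ?case by (simp add: mult_ac)
        qed
      qed
      also have "\<dots> = e powr s / \<kappa> * nosc \<phi> x" using iK(2) by simp
      finally show "norm (smo (c n) \<phi> x - \<phi> x) \<le> (1 / c n) powr s * (nosc \<phi> x / \<kappa>)" by (simp add: e_def)
    qed
  qed
  then show ?thesis by (simp add: LIM_zero_iff)
qed

lemma E_Dir_K:
  "E_Dir s f \<Omega> = (\<integral>\<^sup>+ p. indicator (UNIV - (- \<Omega>) \<times> (- \<Omega>)) p * ennreal ((f (fst p) - f (snd p))\<^sup>2 * K (fst p - snd p)) \<partial>lborel)"
  unfolding E_Dir_def lborel_prod by (simp add: K_def)

lemma E_Dir_UNIV:
  "E_Dir s f UNIV = (\<integral>\<^sup>+ p. ennreal ((f (fst p) - f (snd p))\<^sup>2 * K (fst p - snd p)) \<partial>lborel)"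
  unfolding E_Dir_K by simp

text \<open>Convexity and translation invariance: an increment of the mollified function is a
  weighted mean of increments of translates, and every translate has the same energy on the whole
  plane.\<close>

lemma smo_energy:
  assumes [measurable]: "\<phi> \<in> borel_measurable borel" and M: "\<And>x. \<bar>\<phi> x\<bar> \<le> M" and c: "0 < c"
  shows "E_Dir s (smo c \<phi>) UNIV \<le> E_Dir s \<phi> UNIV"
proof -
  let ?F = "\<lambda>p h. ennreal ((\<phi> (fst p - h) - \<phi> (snd p - h))\<^sup>2 * K (fst p - snd p)) * ennreal (\<psi> c h)"
  have "ennreal ((smo c \<phi> (fst p) - smo c \<phi> (snd p))\<^sup>2 * K (fst p - snd p)) \<le> (\<integral>\<^sup>+h. ?F p h \<partial>lborel)" for p
  proof -
    obtain x y where p: "p = (x, y)" by (cases p)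
    define f where "f h = \<phi> (x - h) - \<phi> (y - h)" for h
    have [measurable]: "f \<in> borel_measurable borel" unfolding f_def by measurable
    have fM: "\<bar>f h\<bar> \<le> 2 * M" for h using M[of "x - h"] M[of "y - h"] unfolding f_def by linarith
    have f2M: "\<bar>(f h)\<^sup>2\<bar> \<le> (2 * M)\<^sup>2" for h using power_mono[OF fM[of h], of 2] by simp
    have i1: "integrable lborel (\<lambda>h. f h * \<psi> c h)" by (rule smo_integrable[OF _ fM c]) measurable
    have i2: "integrable lborel (\<lambda>h. (f h)\<^sup>2 * \<psi> c h)" by (rule smo_integrable[OF _ f2M c]) measurable
    define a where "a = (\<integral>h. f h * \<psi> c h \<partial>lborel)"
    have "smo c \<phi> x - smo c \<phi> y = a"
      unfolding smo_def a_def f_def left_diff_distrib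
      by (intro Bochner_Integration.integral_diff[symmetric] smo_integrable[OF _ _ c, of _ M]) (auto intro: M)
    \<comment> \<open>The square of a mean is at most the mean of the squares, because the variance
      is nonnegative.\<close>
    have "0 \<le> (\<integral>h. (f h - a)\<^sup>2 * \<psi> c h \<partial>lborel)" by (intro integral_nonneg_AE) auto
    also have "\<dots> = (\<integral>h. (f h)\<^sup>2 * \<psi> c h - 2 * a * (f h * \<psi> c h) + a\<^sup>2 * \<psi> c h \<partial>lborel)"
      by (intro Bochner_Integration.integral_cong refl) (simp add: power2_eq_square algebra_simps)
    also have "\<dots> = (\<integral>h. (f h)\<^sup>2 * \<psi> c h \<partial>lborel) - 2 * a * a + a\<^sup>2"
      using i1 i2 \<psi>_integrable[OF c] \<psi>_integral[OF c] by (simp add: a_def)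
    finally have "a\<^sup>2 \<le> (\<integral>h. (f h)\<^sup>2 * \<psi> c h \<partial>lborel)" by (simp add: power2_eq_square)
    then have "a\<^sup>2 * K (x - y) \<le> (\<integral>h. (f h)\<^sup>2 * \<psi> c h \<partial>lborel) * K (x - y)" by (rule mult_right_mono) simp
    then have "ennreal (a\<^sup>2 * K (x - y)) \<le> ennreal (\<integral>h. (f h)\<^sup>2 * \<psi> c h * K (x - y) \<partial>lborel)" by (intro ennreal_leI) simp
    also have "\<dots> = (\<integral>\<^sup>+h. ennreal ((f h)\<^sup>2 * \<psi> c h * K (x - y)) \<partial>lborel)"
      using i2 by (intro nn_integral_eq_integral[symmetric]) auto
    also have "\<dots> = (\<integral>\<^sup>+h. ?F p h \<partial>lborel)"
      by (intro nn_integral_cong) (simp add: p f_def ennreal_mult[symmetric] mult_ac)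
    finally show ?thesis using \<open>smo c \<phi> x - smo c \<phi> y = a\<close> p by simp
  qed
  then have "E_Dir s (smo c \<phi>) UNIV \<le> (\<integral>\<^sup>+p. (\<integral>\<^sup>+h. ?F p h \<partial>lborel) \<partial>lborel)"
    unfolding E_Dir_UNIV by (rule nn_integral_mono)
  also have "\<dots> = (\<integral>\<^sup>+h. (\<integral>\<^sup>+p. ?F p h \<partial>lborel) \<partial>lborel)"
    by (rule lborel_pair.Fubini') (unfold lborel_prod[symmetric], measurable)
  also have "\<dots> = (\<integral>\<^sup>+h. E_Dir s \<phi> UNIV * ennreal (\<psi> c h) \<partial>lborel)"
  proof (rule nn_integral_cong)
    fix h
    have "(\<integral>\<^sup>+p. ?F p h \<partial>lborel) = (\<integral>\<^sup>+p. ennreal ((\<phi> (fst p - h) - \<phi> (snd p - h))\<^sup>2 * K (fst p - snd p)) \<partial>lborel) * ennreal (\<psi> c h)"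
      by (rule nn_integral_multc) (unfold lborel_prod[symmetric], measurable)
    also have "(\<integral>\<^sup>+p. ennreal ((\<phi> (fst p - h) - \<phi> (snd p - h))\<^sup>2 * K (fst p - snd p)) \<partial>lborel) = E_Dir s \<phi> UNIV"
      unfolding E_Dir_UNIV by (subst (2) nn_integral_translate[of _ "(-h, -h)", symmetric]) (auto simp: borel_prod[symmetric])
    finally show "(\<integral>\<^sup>+p. ?F p h \<partial>lborel) = E_Dir s \<phi> UNIV * ennreal (\<psi> c h)" .
  qed
  also have "\<dots> = E_Dir s \<phi> UNIV * (\<integral>\<^sup>+h. ennreal (\<psi> c h) \<partial>lborel)"
    by (rule nn_integral_cmult) measurable
  finally show ?thesis using \<psi>_nn_integral[OF c] by simp
qed

text \<open>Increments multiplied by the square root of the kernel form an L2 function on pairs.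
  Pointwise convergence and \<open>smo_energy\<close> are the two inputs of
  \<open>L2_strong_convergence\<close>.\<close>

lemma smo_strong:
  assumes \<phi>: "regular \<phi>" and M: "\<And>x. \<bar>\<phi> x\<bar> \<le> M" and c: "\<And>n::nat. 0 < c n" "filterlim c at_top sequentially"
    and fin: "E_Dir s \<phi> UNIV < \<infinity>"
  shows "(\<lambda>n. E_Dir s (\<lambda>x. smo (c n) \<phi> x - \<phi> x) UNIV) \<longlonglongrightarrow> 0"
proof -
  have [measurable]: "\<phi> \<in> borel_measurable borel" by (rule regular_measurable[OF \<phi>])
  let ?a = "\<lambda>f (p :: (real^2) \<times> (real^2)). (f (fst p) - f (snd p)) * sqrt (K (fst p - snd p))"
  have sq: "(?a f p)\<^sup>2 = (f (fst p) - f (snd p))\<^sup>2 * K (fst p - snd p)" for f p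
    by (simp add: power_mult_distrib)
  have "(\<lambda>n. \<integral>\<^sup>+p. ennreal ((?a (smo (c n) \<phi>) p - ?a \<phi> p)\<^sup>2) \<partial>lborel) \<longlonglongrightarrow> 0"
  proof (rule L2_strong_convergence)
    show "(\<lambda>n. ?a (smo (c n) \<phi>) p) \<longlonglongrightarrow> ?a \<phi> p" for p
      by (intro tendsto_intros smo_limit[OF \<phi> M c])
    show "(\<integral>\<^sup>+p. ennreal ((?a (smo (c n) \<phi>) p)\<^sup>2) \<partial>lborel) \<le> (\<integral>\<^sup>+p. ennreal ((?a \<phi> p)\<^sup>2) \<partial>lborel)" for n
      unfolding sq E_Dir_UNIV[symmetric] by (rule smo_energy[OF _ M c(1)]) measurable
    show "(\<integral>\<^sup>+p. ennreal ((?a \<phi> p)\<^sup>2) \<partial>lborel) < \<infinity>" unfolding sq E_Dir_UNIV[symmetric] by (rule fin)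
  qed (unfold lborel_prod[symmetric], measurable)
  moreover have "?a (smo (c n) \<phi>) p - ?a \<phi> p = ?a (\<lambda>x. smo (c n) \<phi> x - \<phi> x) p" for n p
    by (simp add: algebra_simps)
  moreover have "(t * sqrt (K y))\<^sup>2 = t\<^sup>2 * K y" for t y by (simp add: power_mult_distrib)
  ultimately show ?thesis by (simp only: E_Dir_UNIV)
qed

lemma E_Dir_iterated:
  assumes [measurable]: "f \<in> borel_measurable borel" "\<Omega> \<in> sets borel"
  shows "E_Dir s f \<Omega> = (\<integral>\<^sup>+x. (\<integral>\<^sup>+y. indicator (UNIV - (- \<Omega>) \<times> (- \<Omega>)) (x, y) * ennreal ((f x - f y)\<^sup>2 * K (x - y)) \<partial>lborel) \<partial>lborel)"
  unfolding E_Dir_K lborel_prod[symmetric] by (subst lborel.nn_integral_fst[symmetric]) auto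

lemma solution_E_Dir:
  assumes sol: "is_solution s u" and R: "1 \<le> R"
  shows "E_Dir s u (ball 0 R) \<le> ennreal (2 * cE * R\<^sup>2)"
proof -
  have [measurable]: "u \<in> borel_measurable borel" by (rule regular_measurable[OF solution_regular[OF sol]])
  let ?F = "\<lambda>p. ennreal ((u (fst p) - u (snd p))\<^sup>2 * K (fst p - snd p))"
  have 1: "(\<integral>\<^sup>+p. ?F p * indicator (ball 0 R) (fst p) \<partial>(lborel \<Otimes>\<^sub>M lborel)) \<le> ennreal (cE * R\<^sup>2)"
  proof -
    have "(\<integral>\<^sup>+p. ?F p * indicator (ball 0 R) (fst p) \<partial>(lborel \<Otimes>\<^sub>M lborel)) = (\<integral>\<^sup>+x. (\<integral>\<^sup>+z. ennreal ((u x - u z)\<^sup>2 * K (x - z)) * indicator (ball 0 R) x \<partial>lborel) \<partial>lborel)"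
      by (subst lborel.nn_integral_fst[symmetric]) auto
    also have "\<dots> = (\<integral>\<^sup>+x. (\<integral>\<^sup>+z. ennreal ((u x - u z)\<^sup>2 * K (x - z)) \<partial>lborel) * indicator (ball 0 R) x \<partial>lborel)"
      by (simp add: nn_integral_multc)
    finally show ?thesis using solution_energy_growth[OF sol R] by simp
  qed
  have 2: "(\<integral>\<^sup>+p. ?F p * indicator (ball 0 R) (snd p) \<partial>(lborel \<Otimes>\<^sub>M lborel)) \<le> ennreal (cE * R\<^sup>2)"
  proof -
    have "(\<integral>\<^sup>+p. ?F p * indicator (ball 0 R) (snd p) \<partial>(lborel \<Otimes>\<^sub>M lborel)) = (\<integral>\<^sup>+x. (\<integral>\<^sup>+z. ennreal ((u z - u x)\<^sup>2 * K (z - x)) * indicator (ball 0 R) x \<partial>lborel) \<partial>lborel)"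
      by (subst lborel_pair.nn_integral_snd[symmetric]) auto
    also have "\<dots> = (\<integral>\<^sup>+x. (\<integral>\<^sup>+z. ennreal ((u x - u z)\<^sup>2 * K (x - z)) \<partial>lborel) * indicator (ball 0 R) x \<partial>lborel)"
      by (simp add: nn_integral_multc power2_commute K_minus)
    finally show ?thesis using solution_energy_growth[OF sol R] by simp
  qed
  have "E_Dir s u (ball 0 R) \<le> (\<integral>\<^sup>+p. ?F p * indicator (ball 0 R) (fst p) + ?F p * indicator (ball 0 R) (snd p) \<partial>(lborel \<Otimes>\<^sub>M lborel))"
    unfolding E_Dir_K lborel_prod[symmetric] by (intro nn_integral_mono) (auto simp: indicator_def)
  also have "\<dots> = (\<integral>\<^sup>+p. ?F p * indicator (ball 0 R) (fst p) \<partial>(lborel \<Otimes>\<^sub>M lborel)) + (\<integral>\<^sup>+p. ?F p * indicator (ball 0 R) (snd p) \<partial>(lborel \<Otimes>\<^sub>M lborel))"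
    by (rule nn_integral_add) measurable
  also have "\<dots> \<le> ennreal (cE * R\<^sup>2) + ennreal (cE * R\<^sup>2)" by (rule add_mono[OF 1 2])
  also have "\<dots> = ennreal (2 * cE * R\<^sup>2)" using cE_nonneg by (subst ennreal_plus[symmetric]) auto
  finally show ?thesis .
qed

text \<open>Young's inequality \<open>2 * a * b \<le> l * a^2 + b^2 / l\<close> with
  \<open>l\<close> kept free: the factor \<open>1 + l\<close> of the main term is brought to 1 only
  after the energy of \<open>g\<close> has tended to 0.\<close>

lemma E_Dir_le:
  assumes [measurable]: "f \<in> borel_measurable borel" "g \<in> borel_measurable borel" "\<Omega> \<in> sets borel"
    and l: "0 < l"
  shows "E_Dir s (\<lambda>x. f x + g x) \<Omega> \<le> ennreal (1 + l) * E_Dir s f \<Omega> + ennreal (1 + 1 / l) * E_Dir s g \<Omega>"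
proof -
  let ?I = "indicator (UNIV - (- \<Omega>) \<times> (- \<Omega>)) :: (real^2) \<times> (real^2) \<Rightarrow> ennreal"
  let ?F = "\<lambda>f p. ennreal ((f (fst p) - f (snd p))\<^sup>2 * K (fst p - snd p))"
  have "E_Dir s (\<lambda>x. f x + g x) \<Omega> \<le> (\<integral>\<^sup>+p. ennreal (1 + l) * (?I p * ?F f p) + ennreal (1 + 1 / l) * (?I p * ?F g p) \<partial>(lborel \<Otimes>\<^sub>M lborel))"
    unfolding E_Dir_K lborel_prod[symmetric]
  proof (rule nn_integral_mono)
    fix p :: "(real^2) \<times> (real^2)"
    define a where "a = f (fst p) - f (snd p)"
    define b where "b = g (fst p) - g (snd p)"
    have "0 \<le> (l * a - b)\<^sup>2 / l" using l by simp
    also have "\<dots> = l * a\<^sup>2 - 2 * a * b + b\<^sup>2 / l" using l by (simp add: power2_eq_square field_simps)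
    finally have "(a + b)\<^sup>2 \<le> (1 + l) * a\<^sup>2 + (1 + 1 / l) * b\<^sup>2" by (simp add: power2_eq_square algebra_simps)
    then have "(a + b)\<^sup>2 * K (fst p - snd p) \<le> ((1 + l) * a\<^sup>2 + (1 + 1 / l) * b\<^sup>2) * K (fst p - snd p)"
      by (rule mult_right_mono) simp
    also have "\<dots> = (1 + l) * (a\<^sup>2 * K (fst p - snd p)) + (1 + 1 / l) * (b\<^sup>2 * K (fst p - snd p))"
      by (simp add: algebra_simps)
    finally have "ennreal ((a + b)\<^sup>2 * K (fst p - snd p)) \<le> ennreal (1 + l) * ?F f p + ennreal (1 + 1 / l) * ?F g p"
      unfolding a_def[symmetric] b_def[symmetric]
    proof -
      assume "(a + b)\<^sup>2 * K (fst p - snd p) \<le> (1 + l) * (a\<^sup>2 * K (fst p - snd p)) + (1 + 1 / l) * (b\<^sup>2 * K (fst p - snd p))"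
      then have "ennreal ((a + b)\<^sup>2 * K (fst p - snd p)) \<le> ennreal ((1 + l) * (a\<^sup>2 * K (fst p - snd p)) + (1 + 1 / l) * (b\<^sup>2 * K (fst p - snd p)))"
        by (rule ennreal_leI)
      also have "\<dots> = ennreal ((1 + l) * (a\<^sup>2 * K (fst p - snd p))) + ennreal ((1 + 1 / l) * (b\<^sup>2 * K (fst p - snd p)))"
        using l by (intro ennreal_plus) auto
      also have "\<dots> = ennreal (1 + l) * ennreal (a\<^sup>2 * K (fst p - snd p)) + ennreal (1 + 1 / l) * ennreal (b\<^sup>2 * K (fst p - snd p))"
        using l by (simp add: ennreal_mult)
      finally show "ennreal ((a + b)\<^sup>2 * K (fst p - snd p)) \<le> ennreal (1 + l) * ennreal (a\<^sup>2 * K (fst p - snd p)) + ennreal (1 + 1 / l) * ennreal (b\<^sup>2 * K (fst p - snd p))" .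
    qed
    moreover have "f (fst p) + g (fst p) - (f (snd p) + g (snd p)) = a + b" by (simp add: a_def b_def)
    ultimately show "?I p * ?F (\<lambda>x. f x + g x) p \<le> ennreal (1 + l) * (?I p * ?F f p) + ennreal (1 + 1 / l) * (?I p * ?F g p)"
      by (simp add: indicator_def)
  qed
  also have "\<dots> = ennreal (1 + l) * E_Dir s f \<Omega> + ennreal (1 + 1 / l) * E_Dir s g \<Omega>"
    unfolding E_Dir_K lborel_prod[symmetric] by (simp add: nn_integral_add nn_integral_cmult)
  finally show ?thesis .
qed

lemma E_Dir_mono: "\<Omega> \<subseteq> \<Omega>' \<Longrightarrow> E_Dir s f \<Omega> \<le> E_Dir s f \<Omega>'"
  unfolding E_Dir_K by (intro nn_integral_mono mult_right_mono) (auto simp: indicator_def)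

definition V :: "(real^2 \<Rightarrow> real) \<Rightarrow> (real^2) set \<Rightarrow> ennreal" where
  "V f \<Omega> = (\<integral>\<^sup>+ x. indicator \<Omega> x * ennreal ((1 - (f x)\<^sup>2)\<^sup>2) \<partial>lborel)"

lemma E_energy_V: "E_energy s f \<Omega> = E_Dir s f \<Omega> + V f \<Omega>" by (simp add: E_energy_def V_def)

lemma well_le: "\<bar>t\<bar> \<le> 3 \<Longrightarrow> (1 - t\<^sup>2)\<^sup>2 \<le> (64::real)"
proof -
  assume "\<bar>t\<bar> \<le> 3"
  then have "t\<^sup>2 \<le> 3\<^sup>2" by (metis abs_ge_zero power2_abs power_mono)
  then have "t\<^sup>2 \<le> 9" by simp
  then have "\<bar>1 - t\<^sup>2\<bar> \<le> 8" using zero_le_power2[of t] by linarith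
  then have "\<bar>1 - t\<^sup>2\<bar>\<^sup>2 \<le> 8\<^sup>2" by (intro power_mono) auto
  then show ?thesis by simp
qed

text \<open>\<open>smo (c n) \<phi>\<close> is an admissible smooth perturbation. The Dirichlet
  error vanishes by \<open>smo_strong\<close> and the potential converges by domination, with
  \<open>n\<close> to infinity for fixed \<open>l\<close>, then \<open>l\<close> to 0. The bound 2
  on \<open>\<phi>\<close> is the largest difference of two functions with values between -1 and
  1.\<close>

theorem minimizer_extended:
  assumes sol: "is_solution s u" and min: "is_minimizer s u"
    and \<phi>: "regular \<phi>" "\<And>x. \<bar>\<phi> x\<bar> \<le> 2" "\<And>x. \<phi> x \<noteq> 0 \<Longrightarrow> norm x \<le> r'" and r: "r' < r" "1 \<le> r"
    and fin: "E_Dir s (\<lambda>x. u x + \<phi> x) (ball 0 r) < \<infinity>"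
  shows "E_energy s u (ball 0 r) \<le> E_energy s (\<lambda>x. u x + \<phi> x) (ball 0 r)"
proof -
  let ?B = "ball (0::real^2) r"
  have [measurable]: "u \<in> borel_measurable borel" by (rule regular_measurable[OF solution_regular[OF sol]])
  have [measurable]: "\<phi> \<in> borel_measurable borel" by (rule regular_measurable[OF \<phi>(1)])
  have bd: "\<bar>u x\<bar> \<le> 1" for x by (rule solution_bounded[OF sol])
  \<comment> \<open>Mollification radii \<open>1 / c n\<close> are then at most half of the margin
    \<open>r - r'\<close>, which keeps the supports compactly inside the ball.\<close>
  define k where "k = 2 / (r - r')"
  define c where "c n = k + real n" for n
  have k: "0 < k" "1 / k < r - r'" using r by (auto simp: k_def)
  have c: "0 < c n" for n using k by (simp add: c_def add_pos_nonneg)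
  have ck: "1 / c n \<le> 1 / k" for n using k unfolding c_def by (intro divide_left_mono) (auto intro: mult_pos_pos add_pos_nonneg)
  have cinf: "filterlim c at_top sequentially"
    unfolding c_def by (rule filterlim_tendsto_add_at_top[OF tendsto_const filterlim_real_sequentially])
  have i\<phi>: "integrable lborel \<phi>"
  proof (rule Bochner_Integration.integrable_bound)
    show "integrable lborel (\<lambda>x. 2 * (indicator (cball (0::real^2) (max 0 r')) x :: real))"
      by (intro integrable_mult_right integrable_real_indicator) (auto simp: emeasure_cball_plane)
    show "AE x in lborel. norm (\<phi> x) \<le> norm (2 * (indicator (cball (0::real^2) (max 0 r')) x :: real))"
      using \<phi>(2,3) by (intro AE_I2) (auto simp: indicator_def le_max_iff_disj)
  qed measurable
  have C: "smo (c n) \<phi> \<in> Cinf0 ?B" for n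
  proof -
    have sub: "closure {x. smo (c n) \<phi> x \<noteq> 0} \<subseteq> cball 0 (r' + 1 / c n)"
    proof (rule closure_minimal)
      show "{x. smo (c n) \<phi> x \<noteq> 0} \<subseteq> cball 0 (r' + 1 / c n)"
      proof
        fix x assume "x \<in> {x. smo (c n) \<phi> x \<noteq> 0}"
        then show "x \<in> cball 0 (r' + 1 / c n)" using smo_support[OF c, where \<phi>=\<phi>] \<phi>(3) by auto
      qed
    qed simp
    moreover have "cball (0::real^2) (r' + 1 / c n) \<subseteq> ?B" using k ck[of n] by (auto simp: cball_subset_ball_iff)
    moreover have "compact (closure {x. smo (c n) \<phi> x \<noteq> 0})"
      using bounded_subset[OF bounded_cball sub] by (simp add: compact_eq_bounded_closed)
    ultimately show ?thesis by (auto simp: Cinf0_def smo_smooth[OF i\<phi>])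
  qed
  have fu: "E_Dir s u ?B < \<infinity>" using solution_E_Dir[OF sol r(2)] by (rule le_less_trans) simp
  \<comment> \<open>\<open>\<phi>\<close> vanishes outside the ball, so only pairs that meet the
    ball contribute; on these it is the difference of two functions of finite energy.\<close>
  have f\<phi>: "E_Dir s \<phi> UNIV < \<infinity>"
  proof -
    have "E_Dir s \<phi> UNIV = E_Dir s \<phi> ?B"
      unfolding E_Dir_K
    proof (intro nn_integral_cong)
      fix p :: "(real^2) \<times> (real^2)"
      have z: "\<phi> x = 0" if "x \<notin> ?B" for x using \<phi>(3)[of x] r(1) that by fastforce
      show "indicator (UNIV - (- UNIV) \<times> (- UNIV)) p * ennreal ((\<phi> (fst p) - \<phi> (snd p))\<^sup>2 * K (fst p - snd p)) =
          indicator (UNIV - (- ?B) \<times> (- ?B)) p * ennreal ((\<phi> (fst p) - \<phi> (snd p))\<^sup>2 * K (fst p - snd p))"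
        using z[of "fst p"] z[of "snd p"] by (cases "fst p \<in> ?B \<or> snd p \<in> ?B") (auto simp: indicator_def mem_Times_iff)
    qed
    also have "E_Dir s \<phi> ?B = E_Dir s (\<lambda>x. (u x + \<phi> x) + - u x) ?B" by simp
    also have "\<dots> \<le> ennreal (1 + 1) * E_Dir s (\<lambda>x. u x + \<phi> x) ?B + ennreal (1 + 1 / 1) * E_Dir s (\<lambda>x. - u x) ?B"
      by (rule E_Dir_le) auto
    also have "E_Dir s (\<lambda>x. - u x) ?B = E_Dir s u ?B"
      unfolding E_Dir_K by (simp add: power2_commute)
    also have "ennreal (1 + 1) * E_Dir s (\<lambda>x. u x + \<phi> x) ?B + ennreal (1 + 1 / 1) * E_Dir s u ?B < \<infinity>"
      using fin fu by (simp add: ennreal_mult_less_top)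
    finally show ?thesis .
  qed
  have strong: "(\<lambda>n. E_Dir s (\<lambda>x. smo (c n) \<phi> x - \<phi> x) UNIV) \<longlonglongrightarrow> 0"
    by (rule smo_strong[OF \<phi>(1,2) c cinf f\<phi>])
  have VV: "(\<lambda>n. V (\<lambda>x. u x + smo (c n) \<phi> x) ?B) \<longlonglongrightarrow> V (\<lambda>x. u x + \<phi> x) ?B"
    unfolding V_def
  proof (rule nn_integral_dominated_convergence[where w="\<lambda>x. indicator ?B x * ennreal 64"])
    show "(\<integral>\<^sup>+x. indicator ?B x * ennreal 64 \<partial>lborel) < \<infinity>"
      using r(2) by (simp add: nn_integral_multc emeasure_cball_plane ennreal_mult_less_top)
    show "AE x in lborel. indicator ?B x * ennreal ((1 - (u x + smo (c n) \<phi> x)\<^sup>2)\<^sup>2) \<le> indicator ?B x * ennreal 64" for n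
    proof (intro AE_I2 mult_left_mono ennreal_leI well_le)
      fix x show "\<bar>u x + smo (c n) \<phi> x\<bar> \<le> 3" using bd[of x] smo_bound[of \<phi> 2 "c n" x] \<phi>(2) c[of n] by simp
    qed simp
    show "AE x in lborel. (\<lambda>n. indicator ?B x * ennreal ((1 - (u x + smo (c n) \<phi> x)\<^sup>2)\<^sup>2)) \<longlonglongrightarrow> indicator ?B x * ennreal ((1 - (u x + \<phi> x)\<^sup>2)\<^sup>2)"
    proof (rule AE_I2)
      fix x
      have "(\<lambda>n. (1 - (u x + smo (c n) \<phi> x)\<^sup>2)\<^sup>2) \<longlonglongrightarrow> (1 - (u x + \<phi> x)\<^sup>2)\<^sup>2"
        by (intro tendsto_intros smo_limit[OF \<phi>(1,2) c cinf])
      then have "(\<lambda>n. ennreal ((1 - (u x + smo (c n) \<phi> x)\<^sup>2)\<^sup>2)) \<longlonglongrightarrow> ennreal ((1 - (u x + \<phi> x)\<^sup>2)\<^sup>2)"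
        by (rule tendsto_ennrealI)
      then show "(\<lambda>n. indicator ?B x * ennreal ((1 - (u x + smo (c n) \<phi> x)\<^sup>2)\<^sup>2)) \<longlonglongrightarrow> indicator ?B x * ennreal ((1 - (u x + \<phi> x)\<^sup>2)\<^sup>2)"
        by (cases "x \<in> ?B") auto
    qed
  qed measurable
  obtain q where q: "0 \<le> q" "E_Dir s (\<lambda>x. u x + \<phi> x) ?B = ennreal q"
    using fin by (metis ennreal_cases infinity_ennreal_def less_irrefl)
  have step: "E_energy s u ?B \<le> ennreal (1 + l) * ennreal q + V (\<lambda>x. u x + \<phi> x) ?B" if l: "0 < l" for l
  proof -
    have "(\<lambda>n. ennreal (1 + l) * ennreal q + ennreal (1 + 1 / l) * E_Dir s (\<lambda>x. smo (c n) \<phi> x - \<phi> x) UNIV + V (\<lambda>x. u x + smo (c n) \<phi> x) ?B)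
        \<longlonglongrightarrow> ennreal (1 + l) * ennreal q + ennreal (1 + 1 / l) * 0 + V (\<lambda>x. u x + \<phi> x) ?B"
      by (intro tendsto_add tendsto_const VV ennreal_tendsto_cmult strong) simp
    then have "E_energy s u ?B \<le> ennreal (1 + l) * ennreal q + ennreal (1 + 1 / l) * 0 + V (\<lambda>x. u x + \<phi> x) ?B"
    proof (rule LIMSEQ_le_const, intro exI allI impI)
      fix n
      have "E_energy s u ?B \<le> E_energy s (\<lambda>x. u x + smo (c n) \<phi> x) ?B"
        using min C unfolding is_minimizer_def by blast
      also have "\<dots> = E_Dir s (\<lambda>x. (u x + \<phi> x) + (smo (c n) \<phi> x - \<phi> x)) ?B + V (\<lambda>x. u x + smo (c n) \<phi> x) ?B"
        unfolding E_energy_V by simp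
      also have "E_Dir s (\<lambda>x. (u x + \<phi> x) + (smo (c n) \<phi> x - \<phi> x)) ?B
          \<le> ennreal (1 + l) * E_Dir s (\<lambda>x. u x + \<phi> x) ?B + ennreal (1 + 1 / l) * E_Dir s (\<lambda>x. smo (c n) \<phi> x - \<phi> x) ?B"
        by (rule E_Dir_le[OF _ _ _ l]) measurable
      also have "\<dots> \<le> ennreal (1 + l) * ennreal q + ennreal (1 + 1 / l) * E_Dir s (\<lambda>x. smo (c n) \<phi> x - \<phi> x) UNIV"
        unfolding q(2) by (intro add_left_mono mult_left_mono E_Dir_mono) auto
      finally show "E_energy s u ?B \<le> ennreal (1 + l) * ennreal q + ennreal (1 + 1 / l) * E_Dir s (\<lambda>x. smo (c n) \<phi> x - \<phi> x) UNIV + V (\<lambda>x. u x + smo (c n) \<phi> x) ?B"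
        by (simp add: add_right_mono)
    qed
    then show ?thesis by simp
  qed
  have "(\<lambda>n. ennreal ((1 + 1 / real (Suc n)) * q) + V (\<lambda>x. u x + \<phi> x) ?B) \<longlonglongrightarrow> ennreal ((1 + 0) * q) + V (\<lambda>x. u x + \<phi> x) ?B"
    by (intro tendsto_add tendsto_const tendsto_ennrealI tendsto_mult inverse_Suc_tendsto)
  then have "E_energy s u ?B \<le> ennreal ((1 + 0) * q) + V (\<lambda>x. u x + \<phi> x) ?B"
  proof (rule LIMSEQ_le_const, intro exI allI impI)
    fix n show "E_energy s u ?B \<le> ennreal ((1 + 1 / real (Suc n)) * q) + V (\<lambda>x. u x + \<phi> x) ?B"
      using step[of "1 / real (Suc n)"] q(1) by (simp add: ennreal_mult)
  qed
  then show ?thesis by (simp add: E_energy_V q(2))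
qed

end

subsection \<open>Displacements of the plane\<close>

text \<open>The range 9/16 fits a displacement of relative size \<open>a \<le> 1/4\<close>: the
  relative change of a squared distance is at most \<open>2 * a + a^2\<close>. Hence
  \<open>1 + X\<close> stays above 7/16, away from the singularity, which bounds the Taylor
  remainder.\<close>

lemma powr_second_order:
  fixes m :: real
  assumes m: "0 \<le> m"
  shows "\<exists>C\<ge>0. \<forall>X. \<bar>X\<bar> \<le> 9/16 \<longrightarrow> \<bar>(1 + X) powr (- m) - 1 + m * X\<bar> \<le> C * X\<^sup>2"
proof -
  define C where "C = m * (m + 1) * (7/16) powr (- m - 2) / 2"
  have "\<bar>(1 + X) powr (- m) - 1 + m * X\<bar> \<le> C * X\<^sup>2" if X: "\<bar>X\<bar> \<le> 9/16" for X
  proof (cases "X = 0")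
    case False
    define diff where "diff n X = (if n = 0 then (1 + X) powr (- m) else if n = 1 then - m * (1 + X) powr (- m - 1)
       else m * (m + 1) * (1 + X) powr (- m - 2))" for n :: nat and X
    have "\<exists>t. (if X < 0 then X < t \<and> t < 0 else 0 < t \<and> t < X) \<and>
        (1 + X) powr (- m) = (\<Sum>k<2. diff k 0 / fact k * (X - 0) ^ k) + diff 2 t / fact 2 * (X - 0) ^ 2"
    proof (rule Taylor[where a="-9/16" and b="9/16"])
      show "\<forall>k t. k < 2 \<and> -9/16 \<le> t \<and> t \<le> 9/16 \<longrightarrow> (diff k has_real_derivative diff (Suc k) t) (at t)"
      proof (intro allI impI)
        fix k :: nat and t :: real assume kt: "k < 2 \<and> -9/16 \<le> t \<and> t \<le> 9/16"
        have d: "((\<lambda>X. (1 + X) powr a) has_real_derivative a * (1 + t) powr (a - 1)) (at t)" for a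
          using kt by (auto intro!: derivative_eq_intros)
        consider "k = 0" | "k = 1" using kt by linarith
        then show "(diff k has_real_derivative diff (Suc k) t) (at t)"
        proof cases
          case 1
          then show ?thesis using d[of "- m"] by (simp add: diff_def[abs_def])
        next
          case 2
          have "((\<lambda>X. - m * (1 + X) powr (- m - 1)) has_real_derivative - m * ((- m - 1) * (1 + t) powr (- m - 1 - 1))) (at t)"
            by (rule DERIV_cmult[OF d])
          then show ?thesis using 2 by (simp add: diff_def[abs_def] algebra_simps)
        qed
      qed
    qed (use X False in \<open>auto simp: diff_def\<close>)
    then obtain t where t': "if X < 0 then X < t \<and> t < 0 else 0 < t \<and> t < X"
      and t2: "(1 + X) powr (- m) = (\<Sum>k<2. diff k 0 / fact k * (X - 0) ^ k) + diff 2 t / fact 2 * (X - 0) ^ 2"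
      by blast
    have t1: "\<bar>t\<bar> \<le> 9/16" using t' X by (auto split: if_splits)
    have eq: "(1 + X) powr (- m) - 1 + m * X = m * (m + 1) * (1 + t) powr (- m - 2) / 2 * X\<^sup>2"
      using t2 by (simp add: diff_def numeral_2_eq_2)
    have "\<bar>(1 + X) powr (- m) - 1 + m * X\<bar> = m * (m + 1) * (1 + t) powr (- m - 2) / 2 * X\<^sup>2"
      unfolding eq using m by simp
    also have "\<dots> \<le> C * X\<^sup>2"
      unfolding C_def using t1 m by (intro mult_right_mono divide_right_mono mult_left_mono powr_mono2') auto
    finally show ?thesis .
  qed simp
  moreover have "0 \<le> C" using m by (simp add: C_def)
  ultimately show ?thesis by blast
qed

context fractional_order begin

definition cT0 :: real where
  "cT0 = (SOME C. 0 \<le> C \<and> (\<forall>X. \<bar>X\<bar> \<le> 9/16 \<longrightarrow> \<bar>(1 + X) powr (- ((2 + s) / 2)) - 1 + (2 + s) / 2 * X\<bar> \<le> C * X\<^sup>2))"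

lemma cT0: "0 \<le> cT0" "\<bar>X\<bar> \<le> 9/16 \<Longrightarrow> \<bar>(1 + X) powr (- ((2 + s) / 2)) - 1 + (2 + s) / 2 * X\<bar> \<le> cT0 * X\<^sup>2"
proof -
  have "\<exists>C. 0 \<le> C \<and> (\<forall>X. \<bar>X\<bar> \<le> 9/16 \<longrightarrow> \<bar>(1 + X) powr (- ((2 + s) / 2)) - 1 + (2 + s) / 2 * X\<bar> \<le> C * X\<^sup>2)"
    using powr_second_order[of "(2 + s) / 2"] s0 by auto
  from someI_ex[OF this] show "0 \<le> cT0" "\<bar>X\<bar> \<le> 9/16 \<Longrightarrow> \<bar>(1 + X) powr (- ((2 + s) / 2)) - 1 + (2 + s) / 2 * X\<bar> \<le> cT0 * X\<^sup>2"
    unfolding cT0_def by blast+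
qed

text \<open>Room for three multiples of \<open>a^2\<close> in \<open>kernel_second_order\<close>: 2
  from the product \<open>p * q\<close>, 17 from the linear term of the kernel expansion, and
  \<open>24 * cT0\<close> from two Taylor remainders of at most \<open>2 * (6 * cT0)\<close>
  each.\<close>

definition cT :: real where "cT = 20 + 24 * cT0"

text \<open>The terms of first order cancel in the sum over the displacements \<open>h\<close> and \<open>-h\<close>.\<close>

lemma kernel_second_order:
  assumes z: "z \<noteq> 0" and a: "a \<le> 1/4" and d: "norm d \<le> a * norm z" and p: "\<bar>p\<bar> \<le> a" and q: "\<bar>q\<bar> \<le> a"
  shows "K (z + d) * ((1 + p) * (1 + q)) + K (z - d) * ((1 - p) * (1 - q)) \<le> K z * (2 + cT * a\<^sup>2)"
proof -
  define m where "m = (2 + s) / 2"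
  have m: "0 \<le> m" "m \<le> 3/2" using s0 s1 by (auto simp: m_def)
  have nz: "0 < norm z" using z by simp
  have two_m: "2 * m = 2 + s" by (simp add: m_def)
  have a0: "0 \<le> a" using p by linarith
  have aa: "a\<^sup>2 \<le> a / 4" using mult_left_mono[OF a a0] by (simp add: power2_eq_square)
  \<comment> \<open>Chosen so that the squared norms of \<open>z + d\<close> and
    \<open>z - d\<close> are that of \<open>z\<close> times
    \<open>1 + \<beta> + 2 * \<alpha>\<close> and \<open>1 + \<beta> - 2 * \<alpha>\<close>:
    \<open>\<alpha>\<close> is of first order and odd in \<open>d\<close>, \<open>\<beta>\<close> of
    second order and even.\<close>
  define \<alpha> where "\<alpha> = (z \<bullet> d) / (norm z)\<^sup>2"
  define \<beta> where "\<beta> = (norm d)\<^sup>2 / (norm z)\<^sup>2"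
  have "\<bar>z \<bullet> d\<bar> \<le> norm z * norm d" by (rule Cauchy_Schwarz_ineq2)
  also have "\<dots> \<le> norm z * (a * norm z)" using d by (intro mult_left_mono) auto
  finally have \<alpha>: "\<bar>\<alpha>\<bar> \<le> a" using nz by (simp add: \<alpha>_def divide_le_eq power2_eq_square mult_ac)
  have "(norm d)\<^sup>2 \<le> (a * norm z)\<^sup>2" using d by (intro power_mono) auto
  then have \<beta>: "0 \<le> \<beta>" "\<beta> \<le> a\<^sup>2" using nz by (auto simp: \<beta>_def divide_le_eq power_mult_distrib)
  have Keq: "K (z + e) = K z * (1 + X) powr (- m)" 
    if e: "(norm (z + e))\<^sup>2 = (norm z)\<^sup>2 * (1 + X)" and X: "\<bar>X\<bar> \<le> 9/16" for e X
  proof -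
    have n: "norm y powr (2 + s) = ((norm y)\<^sup>2) powr m" if "0 < norm y" for y :: "real^2"
    proof -
      have "((norm y)\<^sup>2) powr m = (norm y powr 2) powr m" using that by simp
      also have "\<dots> = norm y powr (2 + s)" unfolding powr_powr by (simp only: two_m)
      finally show ?thesis by simp
    qed
    have "0 < (norm z)\<^sup>2 * (1 + X)" using nz X by (intro mult_pos_pos) auto
    then have "0 < (norm (z + e))\<^sup>2" using e by simp
    then have "0 < norm (z + e)" by simp
    then show ?thesis using nz X unfolding K_def by (simp add: n e powr_mult powr_minus divide_simps)
  qed
  have e1: "(norm (z + d))\<^sup>2 = (norm z)\<^sup>2 * (1 + (\<beta> + 2 * \<alpha>))"
    unfolding \<alpha>_def \<beta>_def using nz by (simp add: power2_norm_eq_inner inner_simps inner_commute field_simps)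
  have e2: "(norm (z + - d))\<^sup>2 = (norm z)\<^sup>2 * (1 + (\<beta> - 2 * \<alpha>))"
    unfolding \<alpha>_def \<beta>_def using nz by (simp add: power2_norm_eq_inner inner_simps inner_commute field_simps)
  define X where "X = \<beta> + 2 * \<alpha>"
  define Y where "Y = \<beta> - 2 * \<alpha>"
  have X: "\<bar>X\<bar> \<le> 9/4 * a" and Y: "\<bar>Y\<bar> \<le> 9/4 * a" using \<alpha> \<beta> aa unfolding X_def Y_def by linarith+
  have X': "\<bar>X\<bar> \<le> 9/16" and Y': "\<bar>Y\<bar> \<le> 9/16" using X Y a by linarith+
  define E where "E = (1 + X) powr (- m) - 1 + m * X"
  define F where "F = (1 + Y) powr (- m) - 1 + m * Y"
  have sq: "t\<^sup>2 \<le> 6 * a\<^sup>2" if "\<bar>t\<bar> \<le> 9/4 * a" for t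
  proof -
    have "\<bar>t\<bar>\<^sup>2 \<le> (9/4 * a)\<^sup>2" using that by (intro power_mono) auto
    then have "16 * (t * t) \<le> 81 * (a * a)" by (simp add: power2_eq_square)
    then show ?thesis using zero_le_square[of a] unfolding power2_eq_square by linarith
  qed
  have E: "\<bar>E\<bar> \<le> cT0 * (6 * a\<^sup>2)" and F: "\<bar>F\<bar> \<le> cT0 * (6 * a\<^sup>2)"
    using cT0(2)[OF X'] cT0(2)[OF Y'] mult_left_mono[OF sq[OF X] cT0(1)] mult_left_mono[OF sq[OF Y] cT0(1)]
    unfolding E_def F_def m_def by linarith+
  define P where "P = (1 + p) * (1 + q)"
  define Q where "Q = (1 - p) * (1 - q)"
  have pq: "\<bar>p * q\<bar> \<le> a\<^sup>2" unfolding abs_mult power2_eq_square using p q a0 by (intro mult_mono) auto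
  have PQ: "P + Q = 2 + 2 * (p * q)" "P - Q = 2 * (p + q)" by (auto simp: P_def Q_def algebra_simps)
  have a16: "a\<^sup>2 \<le> 1/16" using aa a by linarith
  have P: "0 \<le> P" "P \<le> 2" and Q: "0 \<le> Q" "Q \<le> 2"
  proof -
    show "0 \<le> P" "0 \<le> Q" unfolding P_def Q_def using p q a by (auto intro!: mult_nonneg_nonneg)
    have "p * q \<le> 1/16" "p \<le> 1/4" "q \<le> 1/4" "- p \<le> 1/4" "- q \<le> 1/4" using pq p q a a16 by (auto simp: abs_le_iff)
    then show "P \<le> 2" "Q \<le> 2" using PQ by simp_all
  qed
  \<comment> \<open>The cancellation: \<open>\<alpha>\<close> enters only multiplied by
    \<open>P - Q\<close>, itself of order \<open>a\<close>, and the part with \<open>\<beta>\<close>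
    has the favourable sign.\<close>
  have lin: "- m * (P * X + Q * Y) \<le> 17 * a\<^sup>2"
  proof -
    have "P * X + Q * Y = (P + Q) * \<beta> + 2 * ((P - Q) * \<alpha>)" unfolding X_def Y_def by (simp add: algebra_simps)
    also have "(P - Q) * \<alpha> = 2 * ((p + q) * \<alpha>)" by (simp add: PQ)
    finally have eq: "P * X + Q * Y = (P + Q) * \<beta> + 4 * ((p + q) * \<alpha>)" by simp
    have "\<bar>(p + q) * \<alpha>\<bar> \<le> (2 * a) * a" unfolding abs_mult using p q \<alpha> a0 by (intro mult_mono) auto
    then have "- (P * X + Q * Y) \<le> 8 * a\<^sup>2"
      unfolding eq using mult_nonneg_nonneg[OF add_nonneg_nonneg[OF P(1) Q(1)] \<beta>(1)] by (simp add: power2_eq_square abs_le_iff)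
    then have "m * (- (P * X + Q * Y)) \<le> m * (8 * a\<^sup>2)" using m by (intro mult_left_mono)
    also have "\<dots> \<le> 3/2 * (8 * a\<^sup>2)" using m by (intro mult_right_mono) auto
    finally have "m * (- (P * X + Q * Y)) \<le> 17 * a\<^sup>2" using zero_le_power2[of a] by linarith
    then show ?thesis by (simp only: mult_minus_left mult_minus_right)
  qed
  have PE: "P * E \<le> 2 * (cT0 * (6 * a\<^sup>2))" "Q * F \<le> 2 * (cT0 * (6 * a\<^sup>2))"
  proof -
    have "P * E \<le> P * \<bar>E\<bar>" "Q * F \<le> Q * \<bar>F\<bar>" using P Q by (auto intro!: mult_left_mono)
    moreover have "P * \<bar>E\<bar> \<le> 2 * (cT0 * (6 * a\<^sup>2))" "Q * \<bar>F\<bar> \<le> 2 * (cT0 * (6 * a\<^sup>2))"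
      by (rule mult_mono[OF P(2) E], simp, simp, rule mult_mono[OF Q(2) F], simp, simp)
    ultimately show "P * E \<le> 2 * (cT0 * (6 * a\<^sup>2))" "Q * F \<le> 2 * (cT0 * (6 * a\<^sup>2))" by linarith+
  qed
  have "(1 + X) powr (- m) * P + (1 + Y) powr (- m) * Q = (P + Q) + (- m * (P * X + Q * Y)) + (P * E + Q * F)"
    unfolding E_def F_def by (simp add: algebra_simps)
  also have "\<dots> \<le> (2 + 2 * a\<^sup>2) + 17 * a\<^sup>2 + (24 * cT0 * a\<^sup>2)"
    using PQ(1) pq lin PE unfolding abs_le_iff by linarith
  also have "\<dots> \<le> 2 + cT * a\<^sup>2" using zero_le_power2[of a] by (simp add: cT_def algebra_simps)
  finally have "K z * ((1 + X) powr (- m) * P + (1 + Y) powr (- m) * Q) \<le> K z * (2 + cT * a\<^sup>2)"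
    by (rule mult_left_mono) simp
  moreover have "K (z + d) = K z * (1 + X) powr (- m)" using Keq[OF e1] X' by (simp add: X_def)
  moreover have "K (z - d) = K z * (1 + Y) powr (- m)" using Keq[OF e2] Y' by (simp add: Y_def)
  ultimately show ?thesis by (simp add: P_def Q_def algebra_simps)
qed

end

text \<open>The bound 1/4 makes \<open>\<tau>\<close> a perturbation of the identity by a
  contraction: it is a bijection with Lipschitz inverse, and its Jacobian stays between 3/4 and
  5/4.\<close>

locale displacement =
  fixes \<Phi> :: "real^2 \<Rightarrow> real" and D :: "real^2 \<Rightarrow> real^2 \<Rightarrow> real" and h :: "real^2" and l R :: real
  assumes D: "\<And>x. (\<Phi> has_derivative D x) (at x)"
    and Dcont: "\<And>v. continuous_on UNIV (\<lambda>x. D x v)"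
    and lip: "\<And>x y. \<bar>\<Phi> x - \<Phi> y\<bar> \<le> l * norm (x - y)"
    and Dbound: "\<And>x v. \<bar>D x v\<bar> \<le> l * norm v"
    and small: "l * norm h \<le> 1 / 4" and l0: "0 \<le> l"
    and supp: "\<And>x. R \<le> norm x \<Longrightarrow> \<Phi> x = 0"
begin

definition \<tau> :: "real^2 \<Rightarrow> real^2" where "\<tau> x = x + \<Phi> x *\<^sub>R h"
definition J :: "real^2 \<Rightarrow> real" where "J x = 1 + D x h"

lemma displacement_small: "norm (\<Phi> x *\<^sub>R h - \<Phi> y *\<^sub>R h) \<le> 1 / 4 * norm (x - y)"
proof -
  have "norm (\<Phi> x *\<^sub>R h - \<Phi> y *\<^sub>R h) = \<bar>\<Phi> x - \<Phi> y\<bar> * norm h" by (simp add: scaleR_left_diff_distrib[symmetric])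
  also have "\<dots> \<le> l * norm (x - y) * norm h" by (intro mult_right_mono lip) auto
  also have "\<dots> = (l * norm h) * norm (x - y)" by simp
  also have "\<dots> \<le> 1 / 4 * norm (x - y)" by (intro mult_right_mono small) auto
  finally show ?thesis .
qed

lemma \<tau>_lower: "3 / 4 * norm (x - y) \<le> norm (\<tau> x - \<tau> y)"
proof -
  have "norm (x - y) - norm (\<Phi> y *\<^sub>R h - \<Phi> x *\<^sub>R h) \<le> norm ((x - y) - (\<Phi> y *\<^sub>R h - \<Phi> x *\<^sub>R h))" by (rule norm_triangle_ineq2)
  also have "(x - y) - (\<Phi> y *\<^sub>R h - \<Phi> x *\<^sub>R h) = \<tau> x - \<tau> y" by (simp add: \<tau>_def)
  finally show ?thesis using displacement_small[of y x] by (simp add: norm_minus_commute)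
qed

lemma \<tau>_inj: "inj \<tau>"
proof (rule injI)
  fix x y assume "\<tau> x = \<tau> y"
  then show "x = y" using \<tau>_lower[of x y] by simp
qed

text \<open>Solving \<open>y = \<tau> x\<close> is the fixed point problem for the contraction that
  sends \<open>x\<close> to \<open>y - \<Phi> x *\<^sub>R h\<close>.\<close>

lemma \<tau>_surj: "surj \<tau>"
  unfolding surj_def
proof
  fix y
  have "\<exists>!x\<in>UNIV. y - \<Phi> x *\<^sub>R h = x"
  proof (rule Banach_fix[of UNIV "1 / 4"])
    show "dist (y - \<Phi> x *\<^sub>R h) (y - \<Phi> x' *\<^sub>R h) \<le> 1 / 4 * dist x x'" for x x'
      using displacement_small[of x' x] by (simp add: dist_norm norm_minus_commute)
  qed (auto simp: complete_UNIV)
  then obtain x where "y - \<Phi> x *\<^sub>R h = x" by blast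
  then have "y = \<tau> x" by (metis \<tau>_def diff_add_cancel)
  then show "\<exists>x. y = \<tau> x" by blast
qed

lemma \<tau>_derivative: "(\<tau> has_derivative (\<lambda>v. v + D x v *\<^sub>R h)) (at x)"
  unfolding \<tau>_def by (auto intro!: derivative_eq_intros D)

lemma \<tau>_continuous: "continuous_on S \<tau>"
  by (intro continuous_at_imp_continuous_on ballI has_derivative_continuous[OF \<tau>_derivative])

lemma \<tau>_measurable [measurable]: "\<tau> \<in> borel_measurable borel"
  by (intro borel_measurable_continuous_onI \<tau>_continuous)

lemma inv_\<tau>: "inv \<tau> (\<tau> x) = x" "\<tau> (inv \<tau> y) = y"
  using \<tau>_inj \<tau>_surj by (simp_all add: surj_f_inv_f)

lemma inv_\<tau>_measurable [measurable]: "inv \<tau> \<in> borel_measurable borel"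
proof (intro borel_measurable_continuous_onI)
  have "norm (inv \<tau> x - inv \<tau> y) \<le> 4 / 3 * norm (x - y)" for x y
    using \<tau>_lower[of "inv \<tau> x" "inv \<tau> y"] by (simp add: inv_\<tau>)
  then have "(4 / 3)-lipschitz_on UNIV (inv \<tau>)" by (intro lipschitz_onI) (auto simp: dist_norm)
  then show "continuous_on UNIV (inv \<tau>)" by (rule lipschitz_on_continuous_on)
qed

lemma J_measurable [measurable]: "J \<in> borel_measurable borel"
  unfolding J_def by (intro borel_measurable_continuous_onI continuous_intros Dcont)

lemma J_bounds: "3 / 4 \<le> J x" "J x \<le> 5 / 4"
  using Dbound[of x h] small unfolding J_def abs_le_iff by linarith+

lemma J_nonneg [simp]: "0 \<le> J x" using J_bounds(1)[of x] by simp

text \<open>A rank-one perturbation of the identity has determinant 1 plus its trace, so the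
  Jacobian is exactly affine in \<open>h\<close>. The Jacobians for \<open>h\<close> and
  \<open>-h\<close> therefore add up to 2 without a remainder.\<close>

lemma det_\<tau>: "det (matrix (\<lambda>v. v + D x v *\<^sub>R h)) = J x"
proof -
  have lin: "linear (D x)" using D[of x] by (rule has_derivative_linear)
  have "D x h = D x (\<Sum>i\<in>UNIV. h $ i *\<^sub>R axis i 1)" using basis_expansion[of h] by (simp add: scalar_mult_eq_scaleR)
  also have "\<dots> = h $ 1 * D x (axis 1 1) + h $ 2 * D x (axis 2 1)"
    by (simp add: linear_sum[OF lin] linear_cmul[OF lin] sum_2 linear_add[OF lin])
  finally have "D x h = h $ 1 * D x (axis 1 1) + h $ 2 * D x (axis 2 1)" .
  then show ?thesis by (simp add: det_2 matrix_def J_def axis_def algebra_simps)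
qed

text \<open>Lebesgue measure is determined by boxes. The preimage of a box is open and bounded, so
  the change of variables formula for injective differentiable maps applies to it; as an identity of
  measures the result serves every nonnegative measurable integrand.\<close>

lemma lborel_\<tau>: "lborel = distr (density lborel (\<lambda>x. ennreal (J x))) borel \<tau>"
proof (rule lborel_eqI)
  fix a b :: "real^2" assume le: "\<And>i. i \<in> Basis \<Longrightarrow> a \<bullet> i \<le> b \<bullet> i"
  define S where "S = \<tau> -` box a b"
  have opS: "open S" unfolding S_def using continuous_on_open_vimage[of UNIV \<tau>] \<tau>_continuous by auto
  have im: "\<tau> ` S = box a b" unfolding S_def using \<tau>_surj by (simp add: surj_image_vimage_eq)
  have bS: "bounded S"
  proof -
    obtain M where M: "\<And>y. y \<in> box a b \<Longrightarrow> norm y \<le> M" using bounded_box[of a b] unfolding bounded_iff by blast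
    have "norm x \<le> 4 / 3 * (M + norm (\<tau> 0))" if "x \<in> S" for x
      using \<tau>_lower[of x 0] M[of "\<tau> x"] norm_triangle_ineq4[of "\<tau> x" "\<tau> 0"] that by (simp add: S_def)
    then show ?thesis unfolding bounded_iff by blast
  qed
  have mS: "S \<in> lmeasurable" using bS opS by (intro bounded_set_imp_lmeasurable) auto
  have mS': "S \<in> sets lborel" using opS by auto
  have fS: "emeasure lborel S < \<infinity>" using mS opS by (simp add: fmeasurable_def)
  have bi: "set_integrable lborel S J"
    unfolding set_integrable_def
  proof (rule Bochner_Integration.integrable_bound[of _ "\<lambda>x. 5 / 4 * indicator S x"])
    show "integrable lborel (\<lambda>x. 5 / 4 * (indicator S x :: real))" using fS mS' by (intro integrable_mult_right integrable_real_indicator) auto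
    show "AE x in lborel. norm (indicator S x *\<^sub>R J x) \<le> norm (5 / 4 * (indicator S x :: real))"
      using J_bounds by (intro AE_I2) (auto simp: indicator_def)
  qed (use mS' in measurable)
  note hi = set_borel_integral_eq_integral[OF bi]
  have "measure lebesgue (\<tau> ` S) = integral S (\<lambda>x. \<bar>det (matrix (\<lambda>v. v + D x v *\<^sub>R h))\<bar>)"
  proof (rule measure_differentiable_image_eq)
    show "S \<in> sets lebesgue" using mS by auto
    show "(\<tau> has_derivative (\<lambda>v. v + D x v *\<^sub>R h)) (at x within S)" for x by (rule has_derivative_at_withinI[OF \<tau>_derivative])
    show "inj_on \<tau> S" using \<tau>_inj by (rule inj_on_subset) simp
    show "(\<lambda>x. \<bar>det (matrix (\<lambda>v. v + D x v *\<^sub>R h))\<bar>) integrable_on S" unfolding det_\<tau> using hi(1) by simp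
  qed
  also have "\<dots> = (LINT x:S|lborel. J x)" unfolding det_\<tau> using hi(2) by simp
  finally have "measure lebesgue (box a b) = (LINT x:S|lborel. J x)" unfolding im .
  moreover have "(\<integral>\<^sup>+x. ennreal (J x) * indicator S x \<partial>lborel) = ennreal (LINT x:S|lborel. J x)"
    using bi unfolding set_integrable_def set_lebesgue_integral_def
    by (subst nn_integral_eq_integral[symmetric]) (auto intro!: nn_integral_cong simp: indicator_def)
  ultimately have "(\<integral>\<^sup>+x. ennreal (J x) * indicator S x \<partial>lborel) = ennreal (\<Prod>i\<in>Basis. (b - a) \<bullet> i)"
    using le by (simp add: measure_lborel_box_eq inner_diff_left)
  then show "emeasure (distr (density lborel (\<lambda>x. ennreal (J x))) borel \<tau>) (box a b) = ennreal (\<Prod>i\<in>Basis. (b - a) \<bullet> i)"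
  proof -
    assume int: "(\<integral>\<^sup>+x. ennreal (J x) * indicator S x \<partial>lborel) = ennreal (\<Prod>i\<in>Basis. (b - a) \<bullet> i)"
    have "emeasure (distr (density lborel (\<lambda>x. ennreal (J x))) borel \<tau>) (box a b) = emeasure (density lborel (\<lambda>x. ennreal (J x))) S"
      by (subst emeasure_distr) (auto simp: S_def)
    also have "\<dots> = (\<integral>\<^sup>+x. ennreal (J x) * indicator S x \<partial>lborel)"
      using mS' by (intro emeasure_density) auto
    finally show ?thesis by (simp only: int)
  qed
qed simp

lemma nn_integral_\<tau>:
  assumes [measurable]: "f \<in> borel_measurable borel"
  shows "(\<integral>\<^sup>+y. f y \<partial>lborel) = (\<integral>\<^sup>+x. f (\<tau> x) * ennreal (J x) \<partial>lborel)"
  by (subst lborel_\<tau>) (simp add: nn_integral_distr nn_integral_density mult.commute)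

lemma \<tau>_outside: "R \<le> norm x \<Longrightarrow> \<tau> x = x" by (simp add: \<tau>_def supp)

text \<open>Points of norm at least \<open>R\<close> are fixed, and by injectivity no other point is
  sent to one of them. The region of integration is thus unchanged by the displacement.\<close>

lemma \<tau>_ball:
  assumes "R \<le> r"
  shows "\<tau> x \<in> ball 0 r \<longleftrightarrow> x \<in> ball 0 r"
proof (cases "x \<in> ball 0 r")
  case False
  then show ?thesis using \<tau>_outside[of x] assms by simp
next
  case True
  have "\<tau> x \<in> ball 0 r"
  proof (rule ccontr)
    assume "\<tau> x \<notin> ball 0 r"
    then have "\<tau> (\<tau> x) = \<tau> x" using assms by (intro \<tau>_outside) auto
    then have "\<tau> x = x" using \<tau>_inj by (simp add: inj_def)
    then show False using True \<open>\<tau> x \<notin> ball 0 r\<close> by simp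
  qed
  then show ?thesis using True by simp
qed

end

subsection \<open>The cutoff\<close>

lemma pos_square_derivative: "((\<lambda>y. (max 0 y)\<^sup>2) has_real_derivative 2 * max 0 y) (at y)"
proof -
  consider "y < 0" | "y = 0" | "0 < y" by linarith
  then show ?thesis
  proof cases
    case 1
    have "((\<lambda>t. 0) has_real_derivative 0) (at y)" by simp
    then have "((\<lambda>y. (max 0 y)\<^sup>2) has_real_derivative 0) (at y)"
      by (rule DERIV_cong_ev[THEN iffD1, rotated -1, OF _ refl _ refl])
         (use eventually_nhds_in_open[of "{..<0}" y] 1 in \<open>auto elim!: eventually_mono\<close>)
    then show ?thesis using 1 by simp
  next
    case 2
    have "(\<lambda>h. ((max 0 (0 + h))\<^sup>2 - (max 0 0)\<^sup>2) / h) \<midarrow>0\<rightarrow> (0::real)"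
    proof (rule Lim_null_comparison)
      show "\<forall>\<^sub>F h in at 0. norm (((max 0 (0 + h))\<^sup>2 - (max 0 0)\<^sup>2) / h) \<le> \<bar>h::real\<bar>"
        by (rule always_eventually) (auto simp: max_def power2_eq_square)
      show "(\<lambda>h. \<bar>h\<bar>) \<midarrow>0\<rightarrow> (0::real)" by (rule tendsto_eq_intros refl)+ simp
    qed
    then show ?thesis using 2 by (simp add: DERIV_def)
  next
    case 3
    have "((\<lambda>y. y\<^sup>2) has_real_derivative 2 * y) (at y)" by (auto intro!: derivative_eq_intros)
    then have "((\<lambda>y. (max 0 y)\<^sup>2) has_real_derivative 2 * y) (at y)"
      by (rule DERIV_cong_ev[THEN iffD1, rotated -1, OF _ refl _ refl])
         (use eventually_nhds_in_open[of "{0<..}" y] 3 in \<open>auto elim!: eventually_mono\<close>)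
    then show ?thesis using 3 by simp
  qed
qed

text \<open>A cutoff with an explicit continuous derivative, built from squared positive parts: 1 on
  the unit disc, and 0 once \<open>x \<bullet> x\<close> reaches 2.\<close>

definition base :: "real^2 \<Rightarrow> real" where
  "base x = (max 0 (1 - (max 0 (x \<bullet> x - 1))\<^sup>2))\<^sup>2"

definition dbase :: "real^2 \<Rightarrow> real^2 \<Rightarrow> real" where
  "dbase x v = - 8 * max 0 (1 - (max 0 (x \<bullet> x - 1))\<^sup>2) * max 0 (x \<bullet> x - 1) * (x \<bullet> v)"

lemma base_derivative: "(base has_derivative dbase x) (at x)"
proof -
  have 1: "((\<lambda>x. x \<bullet> x - 1) has_derivative (\<lambda>v. x \<bullet> v + v \<bullet> x)) (at x)"
    by (auto intro!: derivative_eq_intros)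
  have p: "((\<lambda>y. (max 0 y)\<^sup>2) has_derivative (\<lambda>t. 2 * max 0 y * t)) (at y)" for y :: real
    using pos_square_derivative[of y] by (simp add: has_field_derivative_def)
  have 2: "((\<lambda>x. 1 - (max 0 (x \<bullet> x - 1))\<^sup>2) has_derivative (\<lambda>v. - (2 * max 0 (x \<bullet> x - 1) * (x \<bullet> v + v \<bullet> x)))) (at x)"
    using has_derivative_diff[OF has_derivative_const has_derivative_compose[OF 1 p], of 1] by simp
  have "(base has_derivative (\<lambda>v. 2 * max 0 (1 - (max 0 (x \<bullet> x - 1))\<^sup>2) * - (2 * max 0 (x \<bullet> x - 1) * (x \<bullet> v + v \<bullet> x)))) (at x)"
    unfolding base_def by (rule has_derivative_compose[OF 2 p])
  also have "(\<lambda>v. 2 * max 0 (1 - (max 0 (x \<bullet> x - 1))\<^sup>2) * - (2 * max 0 (x \<bullet> x - 1) * (x \<bullet> v + v \<bullet> x))) = dbase x"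
    by (intro ext) (simp add: dbase_def inner_commute)
  finally show ?thesis .
qed

lemma dbase_continuous: "continuous_on UNIV (\<lambda>x. dbase x v)"
  unfolding dbase_def by (intro continuous_intros)

lemma base_outside: "2 \<le> norm x \<Longrightarrow> base x = 0" "2 \<le> norm x \<Longrightarrow> dbase x v = 0"
proof -
  assume "2 \<le> norm x"
  then have "2\<^sup>2 \<le> (norm x)\<^sup>2" by (intro power_mono) auto
  then have "3 \<le> x \<bullet> x - 1" by (simp add: power2_norm_eq_inner)
  then have "3\<^sup>2 \<le> (max 0 (x \<bullet> x - 1))\<^sup>2" by (intro power_mono) auto
  then have "max 0 (1 - (max 0 (x \<bullet> x - 1))\<^sup>2) = 0" by simp
  then show "base x = 0" "dbase x v = 0" by (simp_all add: base_def dbase_def)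
qed

lemma base_inside: "norm x \<le> 1 \<Longrightarrow> base x = 1"
proof -
  assume "norm x \<le> 1"
  then have "x \<bullet> x \<le> 1" by (simp add: dot_square_norm power_le_one)
  then show ?thesis by (simp add: base_def)
qed

lemma dbase_bound: "\<bar>dbase x v\<bar> \<le> 16 * norm v"
proof (cases "2 \<le> norm x")
  case False
  define a where "a = max 0 (x \<bullet> x - 1)"
  have "\<bar>max 0 (1 - a\<^sup>2) * a\<bar> \<le> 1"
  proof (cases "a \<le> 1")
    case True
    have "0 \<le> a" by (simp add: a_def)
    then show ?thesis unfolding abs_mult using True by (intro mult_le_one) auto
  next
    case False
    then have "1 \<le> a\<^sup>2" by simp
    then show ?thesis by simp
  qed
  moreover have "\<bar>x \<bullet> v\<bar> \<le> 2 * norm v"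
    using False Cauchy_Schwarz_ineq2[of x v] mult_right_mono[of "norm x" 2 "norm v"] by simp
  ultimately have "\<bar>max 0 (1 - a\<^sup>2) * a\<bar> * \<bar>x \<bullet> v\<bar> \<le> 1 * (2 * norm v)" by (intro mult_mono) auto
  moreover have "\<bar>dbase x v\<bar> = 8 * (\<bar>max 0 (1 - a\<^sup>2) * a\<bar> * \<bar>x \<bullet> v\<bar>)" by (simp add: dbase_def a_def abs_mult)
  ultimately show ?thesis by linarith
qed (simp add: base_outside)

lemma base_lipschitz: "\<bar>base x - base y\<bar> \<le> 16 * norm (x - y)"
proof -
  have "norm (base x - base y) \<le> 16 * norm (x - y)"
  proof (rule differentiable_bound[of UNIV])
    show "(base has_derivative dbase x) (at x within UNIV)" for x by (rule base_derivative)
    show "onorm (dbase x) \<le> 16" for x by (rule onorm_bound) (use dbase_bound in auto)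
  qed auto
  then show ?thesis by simp
qed

text \<open>Averaging the cutoff over \<open>N\<close> dyadic scales gains a factor \<open>1 / N\<close> over a single scale, which
  turns the quadratic growth of the energy into a vanishing error.\<close>

definition dyad :: "nat \<Rightarrow> nat \<Rightarrow> real" where "dyad k0 k = 2 ^ (k0 + k)"

lemma dyad_pos [simp]: "0 < dyad k0 k" by (simp add: dyad_def)
lemma dyad_abs [simp]: "\<bar>dyad k0 k\<bar> = dyad k0 k" by (simp add: dyad_def)
lemma dyad_ge: "1 \<le> dyad k0 k" by (simp add: dyad_def)

definition cut :: "nat \<Rightarrow> nat \<Rightarrow> real^2 \<Rightarrow> real" where
  "cut k0 N x = (\<Sum>k<N. base ((1 / dyad k0 k) *\<^sub>R x)) / real N"

definition dcut :: "nat \<Rightarrow> nat \<Rightarrow> real^2 \<Rightarrow> real^2 \<Rightarrow> real" where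
  "dcut k0 N x v = (\<Sum>k<N. dbase ((1 / dyad k0 k) *\<^sub>R x) ((1 / dyad k0 k) *\<^sub>R v)) / real N"

definition near :: "nat \<Rightarrow> nat \<Rightarrow> real^2 \<Rightarrow> real^2 \<Rightarrow> real" where
  "near k0 k x y = (if norm x < 2 * dyad k0 k \<or> norm y < 2 * dyad k0 k then 1 else 0)"

text \<open>Common bound, at a pair of points, for the difference quotient of \<open>cut\<close> and
  for its gradient at either point. Scale \<open>k\<close> counts only if the pair meets the disc of
  radius \<open>2 * dyad k0 k\<close>, which is the region of pairs in the Dirichlet energy of that
  disc.\<close>

definition weight :: "nat \<Rightarrow> nat \<Rightarrow> real^2 \<Rightarrow> real^2 \<Rightarrow> real" where
  "weight k0 N x y = 16 * (\<Sum>k<N. near k0 k x y / dyad k0 k) / real N"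

lemma near_nonneg [simp]: "0 \<le> near k0 k x y" by (simp add: near_def)
lemma weight_nonneg [simp]: "0 \<le> weight k0 N x y"
  unfolding weight_def by (intro divide_nonneg_nonneg mult_nonneg_nonneg sum_nonneg) (auto intro: less_imp_le)

lemma cut_derivative: "(cut k0 N has_derivative dcut k0 N x) (at x)"
proof -
  have "((\<lambda>x. base (c *\<^sub>R x)) has_derivative (\<lambda>v. dbase (c *\<^sub>R x) (c *\<^sub>R v))) (at x)" for c x
    by (rule has_derivative_compose[OF _ base_derivative]) (auto intro!: derivative_eq_intros)
  then have "((\<lambda>x. (\<Sum>k<N. base ((1 / dyad k0 k) *\<^sub>R x)) / real N) has_derivative (\<lambda>v. (\<Sum>k<N. dbase ((1 / dyad k0 k) *\<^sub>R x) ((1 / dyad k0 k) *\<^sub>R v)) / real N)) (at x)"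
    unfolding divide_inverse by (intro has_derivative_mult_left has_derivative_sum)
  then show ?thesis unfolding cut_def dcut_def .
qed

lemma dcut_continuous: "continuous_on UNIV (\<lambda>x. dcut k0 N x v)"
proof -
  have "continuous_on UNIV (\<lambda>x. dbase (c *\<^sub>R x) w)" for c w
    by (rule continuous_on_compose2[OF dbase_continuous[of w], of UNIV "\<lambda>x. c *\<^sub>R x"])
       (intro continuous_intros, simp)
  then show ?thesis unfolding dcut_def divide_inverse by (intro continuous_intros)
qed

lemma cut_weight: "\<bar>cut k0 N x - cut k0 N y\<bar> \<le> weight k0 N x y * norm (x - y)"
proof -
  have "\<bar>base ((1 / dyad k0 k) *\<^sub>R x) - base ((1 / dyad k0 k) *\<^sub>R y)\<bar> \<le> 16 * (near k0 k x y / dyad k0 k) * norm (x - y)" for k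
  proof (cases "norm x < 2 * dyad k0 k \<or> norm y < 2 * dyad k0 k")
    case True
    then show ?thesis
      using base_lipschitz[of "(1 / dyad k0 k) *\<^sub>R x" "(1 / dyad k0 k) *\<^sub>R y"]
      unfolding scaleR_right_diff_distrib[symmetric] by (simp add: near_def)
  next
    case False
    then have "base ((1 / dyad k0 k) *\<^sub>R x) = 0" "base ((1 / dyad k0 k) *\<^sub>R y) = 0"
      by (auto intro!: base_outside simp: le_divide_eq)
    then show ?thesis using False by (simp add: near_def)
  qed
  then have "(\<Sum>k<N. \<bar>base ((1 / dyad k0 k) *\<^sub>R x) - base ((1 / dyad k0 k) *\<^sub>R y)\<bar>) \<le> (\<Sum>k<N. 16 * (near k0 k x y / dyad k0 k) * norm (x - y))"
    by (rule sum_mono)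
  then have "\<bar>\<Sum>k<N. base ((1 / dyad k0 k) *\<^sub>R x) - base ((1 / dyad k0 k) *\<^sub>R y)\<bar> \<le> (\<Sum>k<N. 16 * (near k0 k x y / dyad k0 k) * norm (x - y))"
    by (rule order_trans[OF sum_abs])
  then have "\<bar>\<Sum>k<N. base ((1 / dyad k0 k) *\<^sub>R x) - base ((1 / dyad k0 k) *\<^sub>R y)\<bar> / real N \<le> (\<Sum>k<N. 16 * (near k0 k x y / dyad k0 k) * norm (x - y)) / real N"
    by (rule divide_right_mono) simp
  then show ?thesis
    unfolding cut_def weight_def by (simp add: diff_divide_distrib[symmetric] sum_subtractf sum_distrib_left sum_distrib_right)
qed

lemma dcut_weight: "\<bar>dcut k0 N x v\<bar> \<le> weight k0 N x y * norm v" "\<bar>dcut k0 N x v\<bar> \<le> weight k0 N y x * norm v"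
proof -
  have "\<bar>dbase ((1 / dyad k0 k) *\<^sub>R x) ((1 / dyad k0 k) *\<^sub>R v)\<bar> \<le> 16 * (near k0 k x y / dyad k0 k) * norm v" for k
  proof (cases "norm x < 2 * dyad k0 k")
    case True
    then show ?thesis
      using dbase_bound[of "(1 / dyad k0 k) *\<^sub>R x" "(1 / dyad k0 k) *\<^sub>R v"] by (simp add: near_def)
  next
    case False
    then have "dbase ((1 / dyad k0 k) *\<^sub>R x) ((1 / dyad k0 k) *\<^sub>R v) = 0"
      by (auto intro!: base_outside simp: le_divide_eq)
    then show ?thesis by (simp add: less_imp_le)
  qed
  then have "(\<Sum>k<N. \<bar>dbase ((1 / dyad k0 k) *\<^sub>R x) ((1 / dyad k0 k) *\<^sub>R v)\<bar>) \<le> (\<Sum>k<N. 16 * (near k0 k x y / dyad k0 k) * norm v)"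
    by (rule sum_mono)
  then have "\<bar>\<Sum>k<N. dbase ((1 / dyad k0 k) *\<^sub>R x) ((1 / dyad k0 k) *\<^sub>R v)\<bar> \<le> (\<Sum>k<N. 16 * (near k0 k x y / dyad k0 k) * norm v)"
    by (rule order_trans[OF sum_abs])
  then have "\<bar>\<Sum>k<N. dbase ((1 / dyad k0 k) *\<^sub>R x) ((1 / dyad k0 k) *\<^sub>R v)\<bar> / real N \<le> (\<Sum>k<N. 16 * (near k0 k x y / dyad k0 k) * norm v) / real N"
    by (rule divide_right_mono) simp
  then show 1: "\<bar>dcut k0 N x v\<bar> \<le> weight k0 N x y * norm v"
    unfolding dcut_def weight_def by (simp add: sum_distrib_left sum_distrib_right)
  have "weight k0 N x y = weight k0 N y x" unfolding weight_def near_def by (simp add: disj_commute)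
  with 1 show "\<bar>dcut k0 N x v\<bar> \<le> weight k0 N y x * norm v" by simp
qed

text \<open>The sequence jumps from 0 to 1 at some index \<open>j\<close>, so the sum is at most
  \<open>2 / 2 ^ j\<close>, whose square is four times the first nonzero term on the right. The
  Cauchy-Schwarz bound for \<open>N\<close> terms would lose a factor \<open>N\<close>, exactly the
  gain wanted from averaging.\<close>

lemma dyadic_sum_square:
  fixes a :: "nat \<Rightarrow> real"
  assumes "\<And>k. a k = 0 \<or> a k = 1" "\<And>k. a k \<le> a (Suc k)"
  shows "(\<Sum>k<N. a k / 2 ^ k)\<^sup>2 \<le> 4 * (\<Sum>k<N. a k / 4 ^ k)"
  using assms
proof (induction N arbitrary: a)
  case (Suc N)
  define S where "S = (\<Sum>k<N. a (Suc k) / 2 ^ k)"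
  define Q where "Q = (\<Sum>k<N. a (Suc k) / 4 ^ k)"
  have S: "(\<Sum>k<Suc N. a k / 2 ^ k) = a 0 + S / 2"
    unfolding S_def by (simp add: sum.lessThan_Suc_shift sum_divide_distrib mult.commute del: sum.lessThan_Suc)
  have Q: "(\<Sum>k<Suc N. a k / 4 ^ k) = a 0 + Q / 4"
    unfolding Q_def by (simp add: sum.lessThan_Suc_shift sum_divide_distrib mult.commute del: sum.lessThan_Suc)
  have a01: "0 \<le> a k" "a k \<le> 1" for k using Suc.prems(1)[of k] by auto
  have Q0: "0 \<le> Q" unfolding Q_def using a01 by (intro sum_nonneg) auto
  consider "a 0 = 0" | "a 0 = 1" using Suc.prems(1) by blast
  then show ?case
  proof cases
    case 1
    have "S\<^sup>2 \<le> 4 * Q" unfolding S_def Q_def by (rule Suc.IH) (use Suc.prems in auto)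
    then show ?thesis unfolding S Q 1 by (simp add: power_divide)
  next
    case 2
    have S0: "0 \<le> S" unfolding S_def using a01 by (intro sum_nonneg) auto
    have "S \<le> (\<Sum>k<N. (1 / 2) ^ k)" unfolding S_def using a01 by (intro sum_mono) (simp add: power_divide divide_right_mono)
    also have "\<dots> = (1 - (1 / 2) ^ N) / (1 - 1 / 2)" by (simp add: geometric_sum)
    also have "\<dots> \<le> 2" by simp
    finally have "(1 + S / 2)\<^sup>2 \<le> 2\<^sup>2" using S0 by (intro power_mono) auto
    then show ?thesis unfolding S Q 2 using Q0 by simp
  qed
qed simp

lemma near_mono: "near k0 k x y \<le> near k0 (Suc k) x y"
proof -
  have "dyad k0 k \<le> dyad k0 (Suc k)" by (simp add: dyad_def)
  then show ?thesis unfolding near_def by auto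
qed

text \<open>The constant is \<open>16^2 * 4\<close>. Multiplied by the energy of the disc of radius
  \<open>2 * dyad k0 k\<close>, of order \<open>(dyad k0 k)^2\<close>, all scales contribute
  equally, and \<open>N\<close> equal terms over \<open>N^2\<close> leave
  \<open>1 / N\<close>.\<close>

lemma weight_square: "(weight k0 N x y)\<^sup>2 \<le> 1024 * (\<Sum>k<N. near k0 k x y / (dyad k0 k)\<^sup>2) / (real N)\<^sup>2"
proof -
  have e1: "(\<Sum>k<N. near k0 k x y / dyad k0 k) = (\<Sum>k<N. near k0 k x y / 2 ^ k) / 2 ^ k0"
    by (simp add: dyad_def power_add sum_divide_distrib mult.commute)
  have e2: "(\<Sum>k<N. near k0 k x y / (dyad k0 k)\<^sup>2) = (\<Sum>k<N. near k0 k x y / 4 ^ k) / (2 ^ k0)\<^sup>2"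
  proof -
    have "(2 ^ k)\<^sup>2 = (2\<^sup>2 :: real) ^ k" for k :: nat by (simp only: power_mult[symmetric] mult.commute)
    then have "(2 ^ k)\<^sup>2 = (4::real) ^ k" for k :: nat by simp
    then show ?thesis by (simp add: dyad_def power_add power_mult_distrib sum_divide_distrib mult.commute)
  qed
  have "(\<Sum>k<N. near k0 k x y / 2 ^ k)\<^sup>2 \<le> 4 * (\<Sum>k<N. near k0 k x y / 4 ^ k)"
    by (rule dyadic_sum_square) (auto simp: near_mono, auto simp: near_def)
  then have "256 * (\<Sum>k<N. near k0 k x y / 2 ^ k)\<^sup>2 / (2 ^ k0)\<^sup>2 / (real N)\<^sup>2 \<le> 256 * (4 * (\<Sum>k<N. near k0 k x y / 4 ^ k)) / (2 ^ k0)\<^sup>2 / (real N)\<^sup>2"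
    by (intro divide_right_mono mult_left_mono) auto
  then show ?thesis unfolding weight_def e1 e2 by (simp add: power_mult_distrib power_divide)
qed

lemma weight_le: "0 < N \<Longrightarrow> weight k0 N x y \<le> 32 / real N"
proof -
  assume N: "0 < N"
  have "(\<Sum>k<N. near k0 k x y / dyad k0 k) \<le> (\<Sum>k<N. (1 / 2) ^ k)"
  proof (rule sum_mono)
    fix k
    have "near k0 k x y / dyad k0 k \<le> 1 / dyad k0 k" by (intro divide_right_mono) (auto simp: near_def less_imp_le)
    also have "\<dots> \<le> 1 / 2 ^ k" by (intro divide_left_mono) (auto simp: dyad_def power_add mult_le_cancel_right1)
    finally show "near k0 k x y / dyad k0 k \<le> (1 / 2) ^ k" by (simp add: power_divide)
  qed
  also have "\<dots> = (1 - (1 / 2) ^ N) / (1 - 1 / 2)" by (simp add: geometric_sum)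
  also have "\<dots> \<le> 2" by simp
  finally show ?thesis unfolding weight_def using N by (simp add: divide_right_mono)
qed

lemma cut_inside: "0 < N \<Longrightarrow> norm x \<le> 2 ^ k0 \<Longrightarrow> cut k0 N x = 1"
proof -
  assume N: "0 < N" and x: "norm x \<le> 2 ^ k0"
  have "base ((1 / dyad k0 k) *\<^sub>R x) = 1" for k
  proof (rule base_inside)
    have "2 ^ k0 \<le> dyad k0 k" by (simp add: dyad_def)
    then show "norm ((1 / dyad k0 k) *\<^sub>R x) \<le> 1" using x dyad_pos[of k0 k] by (simp add: divide_le_eq)
  qed
  then show ?thesis using N by (simp add: cut_def)
qed

lemma cut_outside: "2 ^ (k0 + N) \<le> norm x \<Longrightarrow> cut k0 N x = 0"
proof -
  assume x: "2 ^ (k0 + N) \<le> norm x"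
  have "base ((1 / dyad k0 k) *\<^sub>R x) = 0" if "k < N" for k
  proof (rule base_outside)
    have "2 * dyad k0 k = 2 ^ (k0 + Suc k)" by (simp add: dyad_def)
    also have "\<dots> \<le> 2 ^ (k0 + N)" using that by (intro power_increasing) auto
    finally show "2 \<le> norm ((1 / dyad k0 k) *\<^sub>R x)" using x by (simp add: le_divide_eq)
  qed
  then show ?thesis by (simp add: cut_def)
qed

text \<open>The condition on \<open>N\<close> says \<open>32 / N * norm h \<le> 1 / 4\<close>:
  spreading the cutoff over enough scales makes it flat enough for any prescribed
  translation.\<close>

lemma displacement_cut:
  assumes N: "0 < N" "128 * norm h \<le> real N"
  shows "displacement (cut k0 N) (dcut k0 N) h (32 / real N) (2 ^ (k0 + N))"
proof
  show "\<bar>cut k0 N x - cut k0 N y\<bar> \<le> 32 / real N * norm (x - y)" for x y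
    using cut_weight[of k0 N x y] mult_right_mono[OF weight_le[OF N(1), of k0 x y], of "norm (x - y)"] by simp
  show "\<bar>dcut k0 N x v\<bar> \<le> 32 / real N * norm v" for x v
    using dcut_weight(1)[of k0 N x v x] mult_right_mono[OF weight_le[OF N(1), of k0 x x], of "norm v"] by simp
  show "32 / real N * norm h \<le> 1 / 4" using N by (simp add: divide_le_eq)
qed (use cut_derivative dcut_continuous cut_outside in auto)

context fractional_order begin

subsection \<open>Energy of a displaced minimizer\<close>

abbreviation pairs :: "(real^2) set \<Rightarrow> ((real^2) \<times> (real^2)) set" where
  "pairs \<Omega> \<equiv> UNIV - (- \<Omega>) \<times> (- \<Omega>)"

text \<open>Changing variables in both arguments undoes the composition with the inverse:
  \<open>u\<close> stays as it is, and the displacement is felt only through the kernel and the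
  Jacobians. No derivative of \<open>u\<close> appears.\<close>

lemma E_Dir_displaced:
  assumes "displacement \<Phi> D h l R" and Rr: "R \<le> r" and [measurable]: "u \<in> borel_measurable borel"
  defines "t \<equiv> displacement.\<tau> \<Phi> h" and "j \<equiv> displacement.J D h"
  shows "E_Dir s (\<lambda>y. u (inv t y)) (ball 0 r) =
    (\<integral>\<^sup>+p. indicator (pairs (ball 0 r)) p * ennreal ((u (fst p) - u (snd p))\<^sup>2 * (K (t (fst p) - t (snd p)) * (j (fst p) * j (snd p)))) \<partial>(lborel \<Otimes>\<^sub>M lborel))"
proof -
  interpret displacement \<Phi> D h l R by fact
  have [measurable]: "t \<in> borel_measurable borel" "j \<in> borel_measurable borel" "inv t \<in> borel_measurable borel"
    using \<tau>_measurable J_measurable inv_\<tau>_measurable unfolding t_def j_def .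
  let ?I = "indicator (pairs (ball 0 r)) :: (real^2) \<times> (real^2) \<Rightarrow> ennreal"
  let ?v = "\<lambda>y. u (inv t y)"
  have I: "?I (t x, t y) = ?I (x, y)" for x y
    using \<tau>_ball[OF Rr] unfolding t_def by (simp add: indicator_def del: mem_ball)
  have inv: "inv t (t x) = x" for x unfolding t_def by (rule inv_\<tau>)
  have J0: "0 \<le> j x" for x unfolding j_def by (rule J_nonneg)
  have "E_Dir s ?v (ball 0 r) = (\<integral>\<^sup>+x. (\<integral>\<^sup>+y. ?I (x, y) * ennreal ((?v x - ?v y)\<^sup>2 * K (x - y)) \<partial>lborel) \<partial>lborel)"
    by (rule E_Dir_iterated) measurable
  also have "\<dots> = (\<integral>\<^sup>+x. (\<integral>\<^sup>+y. ?I (t x, y) * ennreal ((?v (t x) - ?v y)\<^sup>2 * K (t x - y)) \<partial>lborel) * ennreal (j x) \<partial>lborel)"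
    unfolding t_def j_def by (rule nn_integral_\<tau>) (unfold t_def[symmetric], measurable)
  also have "\<dots> = (\<integral>\<^sup>+x. (\<integral>\<^sup>+y. ?I (x, y) * ennreal ((u x - u y)\<^sup>2 * (K (t x - t y) * (j x * j y))) \<partial>lborel) \<partial>lborel)"
  proof (rule nn_integral_cong)
    fix x
    define f where "f y = ?I (t x, y) * ennreal ((?v (t x) - ?v y)\<^sup>2 * K (t x - y))" for y
    have [measurable]: "f \<in> borel_measurable borel" unfolding f_def by measurable
    have A: "(\<integral>\<^sup>+y. ?I (t x, y) * ennreal ((?v (t x) - ?v y)\<^sup>2 * K (t x - y)) \<partial>lborel) =
        (\<integral>\<^sup>+y. ?I (t x, t y) * ennreal ((?v (t x) - ?v (t y))\<^sup>2 * K (t x - t y)) * ennreal (j y) \<partial>lborel)"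
      using nn_integral_\<tau>[of f] unfolding t_def[symmetric] j_def[symmetric] f_def by simp
    have "(\<integral>\<^sup>+y. ?I (t x, y) * ennreal ((?v (t x) - ?v y)\<^sup>2 * K (t x - y)) \<partial>lborel) * ennreal (j x) = (\<integral>\<^sup>+y. ?I (t x, t y) * ennreal ((?v (t x) - ?v (t y))\<^sup>2 * K (t x - t y)) * ennreal (j y) * ennreal (j x) \<partial>lborel)"
      unfolding A by (rule nn_integral_multc[symmetric]) measurable
    also have "\<dots> = (\<integral>\<^sup>+y. ?I (x, y) * ennreal ((u x - u y)\<^sup>2 * (K (t x - t y) * (j x * j y))) \<partial>lborel)"
    proof (rule nn_integral_cong)
      fix y
      show "?I (t x, t y) * ennreal ((?v (t x) - ?v (t y))\<^sup>2 * K (t x - t y)) * ennreal (j y) * ennreal (j x) = ?I (x, y) * ennreal ((u x - u y)\<^sup>2 * (K (t x - t y) * (j x * j y)))"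
        unfolding I inv using J0[of x] J0[of y] by (simp add: ennreal_mult mult_ac)
    qed
    finally show "(\<integral>\<^sup>+y. ?I (t x, y) * ennreal ((?v (t x) - ?v y)\<^sup>2 * K (t x - y)) \<partial>lborel) * ennreal (j x) =
      (\<integral>\<^sup>+y. ?I (x, y) * ennreal ((u x - u y)\<^sup>2 * (K (t x - t y) * (j x * j y))) \<partial>lborel)" .
  qed
  also have "\<dots> = (\<integral>\<^sup>+p. ?I p * ennreal ((u (fst p) - u (snd p))\<^sup>2 * (K (t (fst p) - t (snd p)) * (j (fst p) * j (snd p)))) \<partial>(lborel \<Otimes>\<^sub>M lborel))"
    by (subst lborel.nn_integral_fst[symmetric]) auto
  finally show ?thesis .
qed

lemma V_displaced:
  assumes "displacement \<Phi> D h l R" and Rr: "R \<le> r" and [measurable]: "u \<in> borel_measurable borel"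
  defines "t \<equiv> displacement.\<tau> \<Phi> h" and "j \<equiv> displacement.J D h"
  shows "V (\<lambda>y. u (inv t y)) (ball 0 r) = (\<integral>\<^sup>+x. indicator (ball 0 r) x * ennreal ((1 - (u x)\<^sup>2)\<^sup>2 * j x) \<partial>lborel)"
proof -
  interpret displacement \<Phi> D h l R by fact
  have [measurable]: "t \<in> borel_measurable borel" "j \<in> borel_measurable borel" "inv t \<in> borel_measurable borel"
    using \<tau>_measurable J_measurable inv_\<tau>_measurable unfolding t_def j_def .
  have "V (\<lambda>y. u (inv t y)) (ball 0 r) = (\<integral>\<^sup>+x. indicator (ball 0 r) (t x) * ennreal ((1 - (u (inv t (t x)))\<^sup>2)\<^sup>2) * ennreal (j x) \<partial>lborel)"
    unfolding t_def j_def V_def by (rule nn_integral_\<tau>) (unfold t_def[symmetric], measurable)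
  also have "\<dots> = (\<integral>\<^sup>+x. indicator (ball 0 r) x * ennreal ((1 - (u x)\<^sup>2)\<^sup>2 * j x) \<partial>lborel)"
  proof (rule nn_integral_cong)
    fix x
    have "indicator (ball 0 r) (t x) = (indicator (ball 0 r) x :: ennreal)" "inv t (t x) = x" "0 \<le> j x"
      using \<tau>_ball[OF Rr] inv_\<tau>(1) J_nonneg unfolding t_def j_def by (simp_all add: indicator_def del: mem_ball)
    then show "indicator (ball 0 r) (t x) * ennreal ((1 - (u (inv t (t x)))\<^sup>2)\<^sup>2) * ennreal (j x) = indicator (ball 0 r) x * ennreal ((1 - (u x)\<^sup>2)\<^sup>2 * j x)"
      by (simp add: ennreal_mult mult_ac)
  qed
  finally show ?thesis .
qed

text \<open>The constant combines the Jacobian bound 5/4 with the worst growth of the kernel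
  permitted by \<open>\<tau>_lower\<close>.\<close>

lemma regular_displaced:
  assumes "displacement \<Phi> D h l R" and u: "regular u"
  shows "regular (\<lambda>y. u (inv (displacement.\<tau> \<Phi> h) y))"
proof -
  interpret displacement \<Phi> D h l R by fact
  have [measurable]: "u \<in> borel_measurable borel" by (rule regular_measurable[OF u])
  define c where "c = 5 / 4 / (3 / 4) powr (2 + s)"
  have c: "0 \<le> c" by (simp add: c_def)
  have "enosc (\<lambda>y. u (inv \<tau> y)) y < \<infinity>" for y
  proof -
    define x where "x = inv \<tau> y"
    have y: "y = \<tau> x" by (simp add: x_def inv_\<tau>)
    have "enosc (\<lambda>y. u (inv \<tau> y)) y = (\<integral>\<^sup>+z. ennreal (\<bar>u x - u (inv \<tau> (\<tau> z))\<bar> * K (\<tau> z - y)) * ennreal (J z) \<partial>lborel)"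
      unfolding enosc_def x_def by (rule nn_integral_\<tau>) measurable
    also have "\<dots> \<le> (\<integral>\<^sup>+z. ennreal c * ennreal (\<bar>u x - u z\<bar> * K (z - x)) \<partial>lborel)"
    proof (rule nn_integral_mono)
      fix z
      have "K (\<tau> z - \<tau> x) * J z \<le> c * K (z - x)"
      proof (cases "z = x")
        case False
        have "K (\<tau> z - \<tau> x) \<le> K ((3 / 4) *\<^sub>R (z - x))" using \<tau>_lower[of z x] False by (intro K_mono) auto
        also have "\<dots> = K (z - x) / (3 / 4) powr (2 + s)" by (rule K_scale) simp
        finally have "K (\<tau> z - \<tau> x) * J z \<le> K (z - x) / (3 / 4) powr (2 + s) * (5 / 4)"
          using J_bounds(2)[of z] by (intro mult_mono) auto
        then show ?thesis by (simp add: c_def)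
      qed simp
      then have "\<bar>u x - u z\<bar> * (K (\<tau> z - \<tau> x) * J z) \<le> \<bar>u x - u z\<bar> * (c * K (z - x))" by (rule mult_left_mono) simp
      then have "ennreal (\<bar>u x - u z\<bar> * (K (\<tau> z - \<tau> x) * J z)) \<le> ennreal (c * (\<bar>u x - u z\<bar> * K (z - x)))"
        by (intro ennreal_leI) (simp add: mult_ac)
      then show "ennreal (\<bar>u x - u (inv \<tau> (\<tau> z))\<bar> * K (\<tau> z - y)) * ennreal (J z) \<le> ennreal c * ennreal (\<bar>u x - u z\<bar> * K (z - x))"
        using c by (simp add: inv_\<tau>(1) y ennreal_mult mult_ac)
    qed
    also have "\<dots> = ennreal c * enosc u x" unfolding enosc_def by (rule nn_integral_cmult) measurable
    also have "\<dots> < \<infinity>" using u by (simp add: regular_def ennreal_mult_less_top)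
    finally show ?thesis .
  qed
  then show ?thesis by (simp add: regular_def)
qed

text \<open>\<open>8192 = 1024 * 2 * 4\<close>: the constant of \<open>weight_square\<close>, the
  factor 2 in \<open>solution_E_Dir\<close>, and the square of the factor 2 in the radius
  \<open>2 * dyad k0 k\<close>.\<close>

definition cD :: "real^2 \<Rightarrow> real" where "cD h = 8192 * cT * cE * (norm h)\<^sup>2"

lemma cT_nonneg: "0 \<le> cT" using cT0(1) by (simp add: cT_def)
lemma cD_nonneg: "0 \<le> cD h" using cT_nonneg cE_nonneg by (simp add: cD_def)

text \<open>On each pair, \<open>kernel_second_order\<close> with
  \<open>a = norm h * weight k0 N x y\<close> bounds the sum of the two displaced densities;
  \<open>weight_square\<close> distributes the excess over the scales, and quadratic energy growth
  pays for each. For the potential the first-order Jacobian terms cancel exactly, hence an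
  equality.\<close>

lemma displaced_sum:
  assumes sol: "is_solution s u" and N: "0 < N" "128 * norm h \<le> real N" and r: "2 ^ (k0 + N) \<le> r"
  defines "\<tau> \<equiv> displacement.\<tau> (cut k0 N) h" and "\<tau>' \<equiv> displacement.\<tau> (cut k0 N) (- h)"
  shows "E_Dir s (\<lambda>y. u (inv \<tau> y)) (ball 0 r) + E_Dir s (\<lambda>y. u (inv \<tau>' y)) (ball 0 r) \<le> 2 * E_Dir s u (ball 0 r) + ennreal (cD h / real N)"
    and "V (\<lambda>y. u (inv \<tau> y)) (ball 0 r) + V (\<lambda>y. u (inv \<tau>' y)) (ball 0 r) = 2 * V u (ball 0 r)"
proof -
  have [measurable]: "u \<in> borel_measurable borel" by (rule regular_measurable[OF solution_regular[OF sol]])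
  have dp: "displacement (cut k0 N) (dcut k0 N) h (32 / real N) (2 ^ (k0 + N))" by (rule displacement_cut[OF N])
  have dn: "displacement (cut k0 N) (dcut k0 N) (- h) (32 / real N) (2 ^ (k0 + N))" by (rule displacement_cut) (use N in auto)
  interpret p: displacement "cut k0 N" "dcut k0 N" h "32 / real N" "2 ^ (k0 + N)" by (rule dp)
  interpret n: displacement "cut k0 N" "dcut k0 N" "- h" "32 / real N" "2 ^ (k0 + N)" by (rule dn)
  define J where "J = displacement.J (dcut k0 N) h"
  define J' where "J' = displacement.J (dcut k0 N) (- h)"
  have J: "J x = 1 + dcut k0 N x h" "J' x = 1 - dcut k0 N x h" for x
    using linear_neg[OF has_derivative_linear[OF cut_derivative[of k0 N x]], of h] by (simp_all add: J_def J'_def p.J_def n.J_def)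
  have J0: "0 \<le> J x" "0 \<le> J' x" for x unfolding J_def J'_def by simp_all
  have [measurable]: "\<tau> \<in> borel_measurable borel" "J \<in> borel_measurable borel" "\<tau>' \<in> borel_measurable borel" "J' \<in> borel_measurable borel"
    unfolding \<tau>_def J_def \<tau>'_def J'_def by measurable
  let ?I = "indicator (pairs (ball 0 r)) :: (real^2) \<times> (real^2) \<Rightarrow> ennreal"
  let ?Ik = "\<lambda>k. indicator (pairs (ball 0 (2 * dyad k0 k))) :: (real^2) \<times> (real^2) \<Rightarrow> ennreal"
  let ?P = "lborel \<Otimes>\<^sub>M (lborel :: (real^2) measure)"
  let ?q = "\<lambda>p. (u (fst p) - u (snd p))\<^sup>2 * K (fst p - snd p)"
  define c where "c k = cT * (norm h)\<^sup>2 * 1024 / (real N)\<^sup>2 / (dyad k0 k)\<^sup>2" for k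
  have c0: "0 \<le> c k" for k using cT_nonneg by (simp add: c_def)
  have pw: "(u x - u y)\<^sup>2 * (K (\<tau> x - \<tau> y) * (J x * J y)) + (u x - u y)\<^sup>2 * (K (\<tau>' x - \<tau>' y) * (J' x * J' y))
      \<le> 2 * ((u x - u y)\<^sup>2 * K (x - y)) + (\<Sum>k<N. c k * (near k0 k x y * ((u x - u y)\<^sup>2 * K (x - y))))" for x y
  proof (cases "x = y")
    case True then show ?thesis by simp
  next
    case False
    define a where "a = norm h * weight k0 N x y"
    define d where "d = (cut k0 N x - cut k0 N y) *\<^sub>R h"
    have "a \<le> norm h * (32 / real N)" unfolding a_def by (intro mult_left_mono weight_le N) auto
    also have "\<dots> \<le> 1 / 4" using N by (simp add: divide_le_eq)
    finally have a: "a \<le> 1 / 4" .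
    have "norm d \<le> (weight k0 N x y * norm (x - y)) * norm h"
      unfolding d_def norm_scaleR using cut_weight[of k0 N x y] by (intro mult_right_mono) auto
    then have d: "norm d \<le> a * norm (x - y)" by (simp add: a_def mult_ac)
    have p: "\<bar>dcut k0 N x h\<bar> \<le> a" "\<bar>dcut k0 N y h\<bar> \<le> a"
      using dcut_weight(1)[of k0 N x h y] dcut_weight(2)[of k0 N y h x] by (simp_all add: a_def mult.commute)
    have t: "\<tau> x - \<tau> y = (x - y) + d" "\<tau>' x - \<tau>' y = (x - y) - d"
      by (simp_all add: \<tau>_def \<tau>'_def p.\<tau>_def n.\<tau>_def d_def scaleR_left_diff_distrib)
    have "K (\<tau> x - \<tau> y) * (J x * J y) + K (\<tau>' x - \<tau>' y) * (J' x * J' y) \<le> K (x - y) * (2 + cT * a\<^sup>2)"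
      unfolding t J using kernel_second_order[OF _ a d p] False by simp
    also have "\<dots> \<le> K (x - y) * (2 + (\<Sum>k<N. c k * near k0 k x y))"
    proof (intro mult_left_mono add_left_mono)
      have "cT * a\<^sup>2 \<le> cT * ((norm h)\<^sup>2 * (1024 * (\<Sum>k<N. near k0 k x y / (dyad k0 k)\<^sup>2) / (real N)\<^sup>2))"
        unfolding a_def power_mult_distrib by (intro mult_left_mono weight_square cT_nonneg) auto
      also have "\<dots> = (\<Sum>k<N. c k * near k0 k x y)"
        by (simp add: c_def sum_distrib_left sum_divide_distrib mult_ac)
      finally show "cT * a\<^sup>2 \<le> (\<Sum>k<N. c k * near k0 k x y)" .
    qed simp
    finally have "(u x - u y)\<^sup>2 * (K (\<tau> x - \<tau> y) * (J x * J y) + K (\<tau>' x - \<tau>' y) * (J' x * J' y)) \<le> (u x - u y)\<^sup>2 * (K (x - y) * (2 + (\<Sum>k<N. c k * near k0 k x y)))"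
      by (rule mult_left_mono) simp
    also have "\<dots> = 2 * ((u x - u y)\<^sup>2 * K (x - y)) + (u x - u y)\<^sup>2 * K (x - y) * (\<Sum>k<N. c k * near k0 k x y)"
      by (simp add: algebra_simps)
    also have "(u x - u y)\<^sup>2 * K (x - y) * (\<Sum>k<N. c k * near k0 k x y) = (\<Sum>k<N. c k * (near k0 k x y * ((u x - u y)\<^sup>2 * K (x - y))))"
      by (simp add: sum_distrib_left mult_ac)
    finally show ?thesis by (simp only: distrib_left)
  qed
  have "E_Dir s (\<lambda>y. u (inv \<tau> y)) (ball 0 r) + E_Dir s (\<lambda>y. u (inv \<tau>' y)) (ball 0 r) =
    (\<integral>\<^sup>+p. ?I p * ennreal ((u (fst p) - u (snd p))\<^sup>2 * (K (\<tau> (fst p) - \<tau> (snd p)) * (J (fst p) * J (snd p)))) +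
        ?I p * ennreal ((u (fst p) - u (snd p))\<^sup>2 * (K (\<tau>' (fst p) - \<tau>' (snd p)) * (J' (fst p) * J' (snd p)))) \<partial>?P)"
    unfolding \<tau>_def \<tau>'_def E_Dir_displaced[OF dp r \<open>u \<in> borel_measurable borel\<close>] E_Dir_displaced[OF dn r \<open>u \<in> borel_measurable borel\<close>]
    unfolding \<tau>_def[symmetric] \<tau>'_def[symmetric] J_def[symmetric] J'_def[symmetric]
    by (rule nn_integral_add[symmetric]) measurable
  also have "\<dots> \<le> (\<integral>\<^sup>+p. 2 * (?I p * ennreal (?q p)) + (\<Sum>k<N. ennreal (c k) * (?Ik k p * ennreal (?q p))) \<partial>?P)"
  proof (rule nn_integral_mono)
    fix p :: "(real^2) \<times> (real^2)"
    obtain x y where p: "p = (x, y)" by (cases p)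
    have near: "ennreal (c k * (near k0 k x y * ?q p)) = ennreal (c k) * (?Ik k p * ennreal (?q p))" for k
      using c0[of k] by (simp add: p near_def indicator_def ennreal_mult)
    have "ennreal ((u x - u y)\<^sup>2 * (K (\<tau> x - \<tau> y) * (J x * J y))) + ennreal ((u x - u y)\<^sup>2 * (K (\<tau>' x - \<tau>' y) * (J' x * J' y)))
        = ennreal ((u x - u y)\<^sup>2 * (K (\<tau> x - \<tau> y) * (J x * J y)) + (u x - u y)\<^sup>2 * (K (\<tau>' x - \<tau>' y) * (J' x * J' y)))"
      using J0 by (subst ennreal_plus) auto
    also have "\<dots> \<le> ennreal (2 * ?q p + (\<Sum>k<N. c k * (near k0 k x y * ?q p)))"
      using pw[of x y] by (intro ennreal_leI) (simp add: p)
    also have "\<dots> = 2 * ennreal (?q p) + (\<Sum>k<N. ennreal (c k * (near k0 k x y * ?q p)))"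
    proof -
      have t: "0 \<le> c k * (near k0 k x y * ?q p)" for k using c0[of k] by simp
      have "ennreal (2 * ?q p + (\<Sum>k<N. c k * (near k0 k x y * ?q p))) = ennreal (2 * ?q p) + ennreal (\<Sum>k<N. c k * (near k0 k x y * ?q p))"
        using t by (intro ennreal_plus sum_nonneg) auto
      also have "ennreal (2 * ?q p) = 2 * ennreal (?q p)" by (subst ennreal_mult) auto
      also have "ennreal (\<Sum>k<N. c k * (near k0 k x y * ?q p)) = (\<Sum>k<N. ennreal (c k * (near k0 k x y * ?q p)))"
        using t by (intro sum_ennreal[symmetric])
      finally show ?thesis .
    qed
    finally have *: "ennreal ((u x - u y)\<^sup>2 * (K (\<tau> x - \<tau> y) * (J x * J y))) + ennreal ((u x - u y)\<^sup>2 * (K (\<tau>' x - \<tau>' y) * (J' x * J' y)))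
      \<le> 2 * ennreal (?q p) + (\<Sum>k<N. ennreal (c k) * (?Ik k p * ennreal (?q p)))" unfolding near .
    show "?I p * ennreal ((u (fst p) - u (snd p))\<^sup>2 * (K (\<tau> (fst p) - \<tau> (snd p)) * (J (fst p) * J (snd p)))) +
        ?I p * ennreal ((u (fst p) - u (snd p))\<^sup>2 * (K (\<tau>' (fst p) - \<tau>' (snd p)) * (J' (fst p) * J' (snd p))))
      \<le> 2 * (?I p * ennreal (?q p)) + (\<Sum>k<N. ennreal (c k) * (?Ik k p * ennreal (?q p)))"
    proof (cases "p \<in> pairs (ball 0 r)")
      case True then show ?thesis using * by (simp add: p)
    next
      case False then show ?thesis by simp
    qed
  qed
  also have "\<dots> = 2 * E_Dir s u (ball 0 r) + (\<Sum>k<N. ennreal (c k) * E_Dir s u (ball 0 (2 * dyad k0 k)))"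
    unfolding E_Dir_K lborel_prod[symmetric] by (simp add: nn_integral_add nn_integral_cmult nn_integral_sum)
  also have "\<dots> \<le> 2 * E_Dir s u (ball 0 r) + (\<Sum>k<N. ennreal (cD h / real N / real N))"
  proof (intro add_left_mono sum_mono)
    fix k
    have "1 \<le> 2 * dyad k0 k" using dyad_ge[of k0 k] by linarith
    then have "ennreal (c k) * E_Dir s u (ball 0 (2 * dyad k0 k)) \<le> ennreal (c k) * ennreal (2 * cE * (2 * dyad k0 k)\<^sup>2)"
      by (intro mult_left_mono solution_E_Dir[OF sol]) auto
    also have "\<dots> = ennreal (c k * (2 * cE * (2 * dyad k0 k)\<^sup>2))" using c0[of k] cE_nonneg by (simp add: ennreal_mult)
    also have "c k * (2 * cE * (2 * dyad k0 k)\<^sup>2) = cD h / real N / real N"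
    proof -
      have "dyad k0 k \<noteq> 0" using dyad_pos[of k0 k] by linarith
      then show ?thesis by (simp add: c_def cD_def power_mult_distrib power2_eq_square)
    qed
    finally show "ennreal (c k) * E_Dir s u (ball 0 (2 * dyad k0 k)) \<le> ennreal (cD h / real N / real N)" .
  qed
  also have "(\<Sum>k<N. ennreal (cD h / real N / real N)) = ennreal (cD h / real N)"
    using cD_nonneg[of h] N(1) by (subst sum_ennreal) auto
  finally show "E_Dir s (\<lambda>y. u (inv \<tau> y)) (ball 0 r) + E_Dir s (\<lambda>y. u (inv \<tau>' y)) (ball 0 r) \<le> 2 * E_Dir s u (ball 0 r) + ennreal (cD h / real N)" .
  have "V (\<lambda>y. u (inv \<tau> y)) (ball 0 r) + V (\<lambda>y. u (inv \<tau>' y)) (ball 0 r) =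
    (\<integral>\<^sup>+x. indicator (ball 0 r) x * ennreal ((1 - (u x)\<^sup>2)\<^sup>2 * J x) + indicator (ball 0 r) x * ennreal ((1 - (u x)\<^sup>2)\<^sup>2 * J' x) \<partial>lborel)"
    unfolding \<tau>_def \<tau>'_def V_displaced[OF dp r \<open>u \<in> borel_measurable borel\<close>] V_displaced[OF dn r \<open>u \<in> borel_measurable borel\<close>]
    unfolding J_def[symmetric] J'_def[symmetric]
    by (rule nn_integral_add[symmetric]) measurable
  also have "\<dots> = (\<integral>\<^sup>+x. 2 * (indicator (ball 0 r) x * ennreal ((1 - (u x)\<^sup>2)\<^sup>2)) \<partial>lborel)"
  proof (rule nn_integral_cong)
    fix x
    have "ennreal ((1 - (u x)\<^sup>2)\<^sup>2 * J x) + ennreal ((1 - (u x)\<^sup>2)\<^sup>2 * J' x) = ennreal ((1 - (u x)\<^sup>2)\<^sup>2 * J x + (1 - (u x)\<^sup>2)\<^sup>2 * J' x)"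
      using J0 by (subst ennreal_plus) auto
    also have "(1 - (u x)\<^sup>2)\<^sup>2 * J x + (1 - (u x)\<^sup>2)\<^sup>2 * J' x = 2 * (1 - (u x)\<^sup>2)\<^sup>2" unfolding J by (simp add: algebra_simps)
    finally have "ennreal ((1 - (u x)\<^sup>2)\<^sup>2 * J x) + ennreal ((1 - (u x)\<^sup>2)\<^sup>2 * J' x) = 2 * ennreal ((1 - (u x)\<^sup>2)\<^sup>2)" by (simp add: ennreal_mult)
    then show "indicator (ball 0 r) x * ennreal ((1 - (u x)\<^sup>2)\<^sup>2 * J x) + indicator (ball 0 r) x * ennreal ((1 - (u x)\<^sup>2)\<^sup>2 * J' x) = 2 * (indicator (ball 0 r) x * ennreal ((1 - (u x)\<^sup>2)\<^sup>2))"
      by (simp add: indicator_def)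
  qed
  also have "\<dots> = 2 * V u (ball 0 r)" unfolding V_def by (rule nn_integral_cmult) measurable
  finally show "V (\<lambda>y. u (inv \<tau> y)) (ball 0 r) + V (\<lambda>y. u (inv \<tau>' y)) (ball 0 r) = 2 * V u (ball 0 r)" .
qed

subsection \<open>Monotonicity in every direction\<close>

text \<open>The energy saved by replacing \<open>u\<close> and \<open>v\<close> with their minimum and maximum.\<close>

definition gap :: "(real^2 \<Rightarrow> real) \<Rightarrow> (real^2 \<Rightarrow> real) \<Rightarrow> (real^2) \<times> (real^2) \<Rightarrow> real" where
  "gap u v p = max 0 (v (fst p) - u (fst p)) * max 0 (u (snd p) - v (snd p)) + max 0 (u (fst p) - v (fst p)) * max 0 (v (snd p) - u (snd p))"

lemma gap_nonneg [simp]: "0 \<le> gap u v p" by (simp add: gap_def)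

lemma min_max_identity:
  "(min (u x) (v x) - min (u y) (v y))\<^sup>2 + (max (u x) (v x) - max (u y) (v y))\<^sup>2 + 2 * gap u v (x, y) = (u x - u y)\<^sup>2 + (v x - v y)\<^sup>2"
proof -
  consider "u x \<le> v x" "u y \<le> v y" | "u x \<le> v x" "v y \<le> u y" | "v x \<le> u x" "u y \<le> v y" | "v x \<le> u x" "v y \<le> u y" by linarith
  then show ?thesis by cases (simp_all add: gap_def min_def max_def power2_eq_square algebra_simps)
qed

lemma E_Dir_min_max:
  assumes [measurable]: "u \<in> borel_measurable borel" "v \<in> borel_measurable borel" "\<Omega> \<in> sets borel"
  shows "E_Dir s (\<lambda>x. min (u x) (v x)) \<Omega> + E_Dir s (\<lambda>x. max (u x) (v x)) \<Omega> +
      (\<integral>\<^sup>+p. indicator (pairs \<Omega>) p * ennreal (2 * gap u v p * K (fst p - snd p)) \<partial>(lborel \<Otimes>\<^sub>M lborel)) = E_Dir s u \<Omega> + E_Dir s v \<Omega>"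
proof -
  let ?I = "indicator (pairs \<Omega>) :: (real^2) \<times> (real^2) \<Rightarrow> ennreal"
  let ?P = "lborel \<Otimes>\<^sub>M (lborel :: (real^2) measure)"
  define q where "q f p = ?I p * ennreal ((f (fst p) - f (snd p))\<^sup>2 * K (fst p - snd p))" for f p
  have E: "E_Dir s f \<Omega> = (\<integral>\<^sup>+p. q f p \<partial>?P)" for f unfolding E_Dir_K lborel_prod q_def ..
  define g where "g p = ?I p * ennreal (2 * gap u v p * K (fst p - snd p))" for p
  have [measurable]: "q f \<in> borel_measurable ?P" if [measurable]: "f \<in> borel_measurable borel" for f unfolding q_def by measurable
  have [measurable]: "g \<in> borel_measurable ?P" unfolding g_def gap_def by measurable
  have "(\<integral>\<^sup>+p. q (\<lambda>x. min (u x) (v x)) p \<partial>?P) + (\<integral>\<^sup>+p. q (\<lambda>x. max (u x) (v x)) p \<partial>?P) + (\<integral>\<^sup>+p. g p \<partial>?P)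
      = (\<integral>\<^sup>+p. q (\<lambda>x. min (u x) (v x)) p + q (\<lambda>x. max (u x) (v x)) p + g p \<partial>?P)"
    by (simp add: nn_integral_add)
  also have "\<dots> = (\<integral>\<^sup>+p. q u p + q v p \<partial>?P)"
  proof (rule nn_integral_cong)
    fix p :: "(real^2) \<times> (real^2)"
    obtain x y where p: "p = (x, y)" by (cases p)
    show "q (\<lambda>x. min (u x) (v x)) p + q (\<lambda>x. max (u x) (v x)) p + g p = q u p + q v p"
    proof (cases "p \<in> pairs \<Omega>")
      case True
      let ?k = "K (x - y)"
      have "(min (u x) (v x) - min (u y) (v y))\<^sup>2 * ?k + (max (u x) (v x) - max (u y) (v y))\<^sup>2 * ?k + 2 * gap u v (x, y) * ?k = (u x - u y)\<^sup>2 * ?k + (v x - v y)\<^sup>2 * ?k"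
        unfolding distrib_right[symmetric] by (simp only: min_max_identity)
      then have "ennreal ((min (u x) (v x) - min (u y) (v y))\<^sup>2 * ?k + (max (u x) (v x) - max (u y) (v y))\<^sup>2 * ?k + 2 * gap u v (x, y) * ?k) = ennreal ((u x - u y)\<^sup>2 * ?k + (v x - v y)\<^sup>2 * ?k)"
        by (rule arg_cong)
      then show ?thesis using True unfolding q_def g_def p by simp
    qed (simp add: q_def g_def)
  qed
  also have "\<dots> = (\<integral>\<^sup>+p. q u p \<partial>?P) + (\<integral>\<^sup>+p. q v p \<partial>?P)" by (rule nn_integral_add) measurable
  finally show ?thesis unfolding E g_def .
qed

lemma V_min_max:
  assumes [measurable]: "u \<in> borel_measurable borel" "v \<in> borel_measurable borel" "\<Omega> \<in> sets borel"
  shows "V (\<lambda>x. min (u x) (v x)) \<Omega> + V (\<lambda>x. max (u x) (v x)) \<Omega> = V u \<Omega> + V v \<Omega>"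
proof -
  have "V (\<lambda>x. min (u x) (v x)) \<Omega> + V (\<lambda>x. max (u x) (v x)) \<Omega> =
      (\<integral>\<^sup>+x. indicator \<Omega> x * ennreal ((1 - (min (u x) (v x))\<^sup>2)\<^sup>2) + indicator \<Omega> x * ennreal ((1 - (max (u x) (v x))\<^sup>2)\<^sup>2) \<partial>lborel)"
    unfolding V_def by (rule nn_integral_add[symmetric]) measurable
  also have "\<dots> = (\<integral>\<^sup>+x. indicator \<Omega> x * ennreal ((1 - (u x)\<^sup>2)\<^sup>2) + indicator \<Omega> x * ennreal ((1 - (v x)\<^sup>2)\<^sup>2) \<partial>lborel)"
    by (intro nn_integral_cong) (auto simp: min_def max_def add.commute)
  also have "\<dots> = V u \<Omega> + V v \<Omega>" unfolding V_def by (rule nn_integral_add) measurable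
  finally show ?thesis .
qed

lemma minimizer_competitor:
  assumes sol: "is_solution s u" and min: "is_minimizer s u"
    and v: "regular v" "\<And>x. \<bar>v x\<bar> \<le> 1" "\<And>x. r0 \<le> norm x \<Longrightarrow> v x = u x" and r: "r0 < r" "1 \<le> r"
    and fin: "E_Dir s v (ball 0 r) < \<infinity>"
  shows "E_energy s u (ball 0 r) \<le> E_energy s v (ball 0 r)"
proof -
  have u: "regular u" by (rule solution_regular[OF sol])
  have "E_energy s u (ball 0 r) \<le> E_energy s (\<lambda>x. u x + (v x - u x)) (ball 0 r)"
  proof (rule minimizer_extended[OF sol min _ _ _ r])
    show "regular (\<lambda>x. v x - u x)"
      using regular_measurable[OF u] regular_measurable[OF v(1)] by (intro regular_dom[OF _ v(1) u, of _ 1]) auto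
    show "\<bar>v x - u x\<bar> \<le> 2" for x using v(2)[of x] solution_bounded[OF sol, of x] by linarith
    show "norm x \<le> r0" if "v x - u x \<noteq> 0" for x using v(3)[of x] that by fastforce
    show "E_Dir s (\<lambda>x. u x + (v x - u x)) (ball 0 r) < \<infinity>" using fin by simp
  qed
  then show ?thesis by simp
qed

text \<open>Minimality is used three times and the results are added: against the minimum, the
  maximum, and the mirror displacement \<open>v'\<close>. The first two have together the Dirichlet
  energy of \<open>u\<close> and \<open>v\<close> less the gap, and \<open>v\<close> with
  \<open>v'\<close> exceeds twice the energy of \<open>u\<close> by at most \<open>cD h / N\<close>.
  The energies of \<open>u\<close> cancel and the gap remains.\<close>

lemma gap_bound:
  assumes sol: "is_solution s u" and min: "is_minimizer s u"
    and N: "0 < N" "128 * norm h \<le> real N" and R: "R + norm h \<le> 2 ^ k0"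
  shows "(\<integral>\<^sup>+p. indicator (ball 0 R \<times> ball 0 R) p * ennreal (2 * gap u (\<lambda>x. u (x - h)) p * K (fst p - snd p)) \<partial>(lborel \<Otimes>\<^sub>M lborel)) \<le> ennreal (cD h / real N)"
proof -
  have u: "regular u" by (rule solution_regular[OF sol])
  have [measurable]: "u \<in> borel_measurable borel" by (rule regular_measurable[OF u])
  have bd: "\<bar>u x\<bar> \<le> 1" for x by (rule solution_bounded[OF sol])
  define r0 :: real where "r0 = 2 ^ (k0 + N)"
  \<comment> \<open>Perturbations live in the disc of radius \<open>r0\<close>; the strictly larger
    \<open>r\<close> leaves the margin for mollification that \<open>minimizer_extended\<close> asks
    for.\<close>
  define r where "r = 2 * r0"
  have "1 \<le> r0" unfolding r0_def by simp
  then have r: "r0 < r" "r0 \<le> r" "1 \<le> r" by (auto simp: r_def)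
  let ?B = "ball (0::real^2) r"
  have dp: "displacement (cut k0 N) (dcut k0 N) h (32 / real N) r0" unfolding r0_def by (rule displacement_cut[OF N])
  have dn: "displacement (cut k0 N) (dcut k0 N) (- h) (32 / real N) r0" unfolding r0_def by (rule displacement_cut) (use N in auto)
  interpret p: displacement "cut k0 N" "dcut k0 N" h "32 / real N" r0 by (rule dp)
  interpret n: displacement "cut k0 N" "dcut k0 N" "- h" "32 / real N" r0 by (rule dn)
  define v where "v y = u (inv p.\<tau> y)" for y
  define v' where "v' y = u (inv n.\<tau> y)" for y
  have v: "regular v" unfolding v_def by (rule regular_displaced[OF dp u])
  have v': "regular v'" unfolding v'_def by (rule regular_displaced[OF dn u])
  have [measurable]: "v \<in> borel_measurable borel" by (rule regular_measurable[OF v])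
  have vout: "v x = u x" "v' x = u x" if "r0 \<le> norm x" for x
    unfolding v_def v'_def using p.inv_\<tau>(1)[of x] n.inv_\<tau>(1)[of x] p.\<tau>_outside[OF that] n.\<tau>_outside[OF that] by simp_all
  have vbd: "\<bar>v x\<bar> \<le> 1" "\<bar>v' x\<bar> \<le> 1" for x unfolding v_def v'_def by (rule bd)+
  have sumD: "E_Dir s v ?B + E_Dir s v' ?B \<le> 2 * E_Dir s u ?B + ennreal (cD h / real N)"
    and sumV: "V v ?B + V v' ?B = 2 * V u ?B"
    using displaced_sum[OF sol N, of k0 r] r(2) unfolding r0_def v_def v'_def by auto
  have fu: "E_Dir s u ?B < \<infinity>" using solution_E_Dir[OF sol r(3)] by (rule le_less_trans) simp
  have fsum: "E_Dir s v ?B + E_Dir s v' ?B < \<infinity>"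
    using sumD by (rule le_less_trans) (use fu in \<open>simp add: ennreal_mult_less_top\<close>)
  then have fv: "E_Dir s v ?B < \<infinity>" "E_Dir s v' ?B < \<infinity>" by auto
  have fV: "V u ?B < \<infinity>"
  proof -
    have "V u ?B \<le> (\<integral>\<^sup>+x. indicator ?B x * ennreal 64 \<partial>lborel)"
      unfolding V_def by (intro nn_integral_mono mult_left_mono ennreal_leI well_le) (use bd in \<open>auto intro: order_trans[OF bd]\<close>)
    also have "\<dots> < \<infinity>" using r(3) by (simp add: nn_integral_multc emeasure_cball_plane ennreal_mult_less_top)
    finally show ?thesis .
  qed
  define mi where "mi x = min (u x) (v x)" for x
  define ma where "ma x = max (u x) (v x)" for x
  define Gp where "Gp = (\<integral>\<^sup>+p. indicator (pairs ?B) p * ennreal (2 * gap u v p * K (fst p - snd p)) \<partial>(lborel \<Otimes>\<^sub>M lborel))"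
  have mD: "E_Dir s mi ?B + E_Dir s ma ?B + Gp = E_Dir s u ?B + E_Dir s v ?B"
    unfolding mi_def[abs_def] ma_def[abs_def] Gp_def by (rule E_Dir_min_max) measurable
  have mV: "V mi ?B + V ma ?B = V u ?B + V v ?B"
    unfolding mi_def[abs_def] ma_def[abs_def] by (rule V_min_max) measurable
  have "E_Dir s mi ?B + E_Dir s ma ?B + Gp < \<infinity>" unfolding mD using fu fv by simp
  then have fm: "E_Dir s mi ?B < \<infinity>" "E_Dir s ma ?B < \<infinity>" by auto
  have regmi: "regular mi" by (rule regular_dom[OF _ u v, of _ 1]) (auto simp: mi_def[abs_def] min_def)
  have regma: "regular ma" by (rule regular_dom[OF _ u v, of _ 1]) (auto simp: ma_def[abs_def] max_def)
  have c1: "E_energy s u ?B \<le> E_energy s v' ?B"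
    by (rule minimizer_competitor[OF sol min v' vbd(2) vout(2) r(1,3) fv(2)])
  have c2: "E_energy s u ?B \<le> E_energy s mi ?B"
  proof (rule minimizer_competitor[OF sol min regmi _ _ r(1,3) fm(1)])
    show "\<bar>mi x\<bar> \<le> 1" for x using bd[of x] vbd(1)[of x] by (auto simp: mi_def min_def)
    show "mi x = u x" if "r0 \<le> norm x" for x using vout(1)[OF that] by (simp add: mi_def)
  qed
  have c3: "E_energy s u ?B \<le> E_energy s ma ?B"
  proof (rule minimizer_competitor[OF sol min regma _ _ r(1,3) fm(2)])
    show "\<bar>ma x\<bar> \<le> 1" for x using bd[of x] vbd(1)[of x] by (auto simp: ma_def max_def)
    show "ma x = u x" if "r0 \<le> norm x" for x using vout(1)[OF that] by (simp add: ma_def)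
  qed
  define e where "e = E_energy s u ?B"
  \<comment> \<open>Cancellation in \<open>ennreal\<close> is legitimate only for a finite term;
    here the a priori bounds enter.\<close>
  have fe: "e < \<infinity>" using fu fV by (simp add: e_def E_energy_V)
  have "(e + e + e) + Gp \<le> (E_energy s mi ?B + E_energy s ma ?B + E_energy s v' ?B) + Gp"
    unfolding e_def by (intro add_right_mono add_mono c1 c2 c3)
  also have "\<dots> = (E_Dir s mi ?B + E_Dir s ma ?B + Gp) + (V mi ?B + V ma ?B) + E_energy s v' ?B"
    unfolding E_energy_V by (simp add: ac_simps)
  also have "\<dots> = (E_Dir s u ?B + V u ?B) + (E_Dir s v ?B + E_Dir s v' ?B) + (V v ?B + V v' ?B)"
    unfolding mD mV E_energy_V by (simp add: ac_simps)
  also have "\<dots> \<le> (E_Dir s u ?B + V u ?B) + (2 * E_Dir s u ?B + ennreal (cD h / real N)) + 2 * V u ?B"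
    unfolding sumV by (intro add_mono add_left_mono sumD order_refl)
  also have "\<dots> = (e + e + e) + ennreal (cD h / real N)"
    unfolding e_def E_energy_V mult_2 by (simp add: ac_simps)
  finally have Gp: "Gp \<le> ennreal (cD h / real N)"
    using fe by (subst (asm) ennreal_add_left_cancel_le) auto
  \<comment> \<open>Where \<open>cut\<close> equals 1 the displacement is the translation by
    \<open>h\<close>; the hypothesis on \<open>R\<close> keeps \<open>x - h\<close> in that
    region.\<close>
  have inner: "v x = u (x - h)" if "x \<in> ball 0 R" for x
  proof -
    have "norm (x - h) \<le> 2 ^ k0" using that R norm_triangle_ineq4[of x h] by simp
    then have "p.\<tau> (x - h) = x" using cut_inside[OF N(1), of "x - h" k0] by (simp add: p.\<tau>_def)
    then show ?thesis unfolding v_def using p.inv_\<tau>(1)[of "x - h"] by simp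
  qed
  have Rr: "ball 0 R \<subseteq> ?B"
  proof -
    have "R \<le> 2 ^ k0" using R norm_ge_zero[of h] by linarith
    also have "\<dots> \<le> r0" unfolding r0_def by (intro power_increasing) auto
    finally show ?thesis using r by auto
  qed
  have "(\<integral>\<^sup>+p. indicator (ball 0 R \<times> ball 0 R) p * ennreal (2 * gap u (\<lambda>x. u (x - h)) p * K (fst p - snd p)) \<partial>(lborel \<Otimes>\<^sub>M lborel)) \<le> Gp"
    unfolding Gp_def
  proof (rule nn_integral_mono)
    fix p :: "(real^2) \<times> (real^2)"
    obtain x y where p: "p = (x, y)" by (cases p)
    show "indicator (ball 0 R \<times> ball 0 R) p * ennreal (2 * gap u (\<lambda>x. u (x - h)) p * K (fst p - snd p)) \<le> indicator (pairs ?B) p * ennreal (2 * gap u v p * K (fst p - snd p))"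
    proof (cases "x \<in> ball 0 R \<and> y \<in> ball 0 R")
      case True
      then have "p \<in> pairs ?B" using Rr p by auto
      then show ?thesis using True inner[of x] inner[of y] by (simp add: p gap_def)
    qed (auto simp: p)
  qed
  also note Gp
  finally show ?thesis .
qed

text \<open>As \<open>N\<close> tends to infinity the gap integral vanishes on every product of
  discs, so the gap is 0 almost everywhere, the kernel being positive off the diagonal. One summand
  of the gap is a function of the first point times a function of the second; by Fubini the positive
  or the negative part of \<open>u (x - h) - u x\<close> has integral 0.\<close>

lemma sign_dichotomy:
  assumes sol: "is_solution s u" and min: "is_minimizer s u"
  shows "(\<forall>x. u x \<le> u (x - h)) \<or> (\<forall>x. u (x - h) \<le> u x)"
proof -
  have u: "regular u" by (rule solution_regular[OF sol])
  have [measurable]: "u \<in> borel_measurable borel" by (rule regular_measurable[OF u])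
  define g where "g p = gap u (\<lambda>x. u (x - h)) p * K (fst p - snd p)" for p
  have [measurable]: "g \<in> borel_measurable (lborel \<Otimes>\<^sub>M lborel)" unfolding g_def gap_def by measurable
  have g0: "0 \<le> g p" for p by (simp add: g_def)
  have zero: "(\<integral>\<^sup>+p. indicator (ball 0 (real R) \<times> ball 0 (real R)) p * ennreal (2 * g p) \<partial>(lborel \<Otimes>\<^sub>M lborel)) = 0" (is "?Z = 0") for R :: nat
  proof -
    obtain k0 where k0: "real R + norm h < 2 ^ k0" using real_arch_pow[of 2] by auto
    obtain N0 where N0: "128 * norm h \<le> real N0" using real_arch_simple by blast
    have "(\<lambda>n. cD h * (1 / real (Suc n))) \<longlonglongrightarrow> cD h * 0" by (intro tendsto_mult tendsto_const inverse_Suc_tendsto)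
    then have "(\<lambda>n. ennreal (cD h / real (Suc n))) \<longlonglongrightarrow> ennreal 0" by (intro tendsto_ennrealI) simp
    then have "?Z \<le> ennreal 0"
    proof (rule LIMSEQ_le_const, intro exI allI impI)
      fix n assume "N0 \<le> n"
      then have "128 * norm h \<le> real (Suc n)" using N0 by linarith
      then show "?Z \<le> ennreal (cD h / real (Suc n))"
        using gap_bound[OF sol min, of "Suc n" h "real R" k0] k0 by (simp add: g_def mult.assoc)
    qed
    then show ?thesis by simp
  qed
  have "AE p in lborel \<Otimes>\<^sub>M lborel. \<forall>R::nat. indicator (ball 0 (real R) \<times> ball 0 (real R)) p * ennreal (2 * g p) = 0"
    unfolding AE_all_countable
  proof
    fix R :: nat
    show "AE p in lborel \<Otimes>\<^sub>M lborel. indicator (ball 0 (real R) \<times> ball 0 (real R)) p * ennreal (2 * g p) = 0"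
      by (subst nn_integral_0_iff_AE[symmetric]) (measurable, rule zero)
  qed
  then have "AE p in lborel \<Otimes>\<^sub>M lborel. ennreal (max 0 (u (fst p - h) - u (fst p))) * ennreal (max 0 (u (snd p) - u (snd p - h))) = 0"
  proof eventually_elim
    case (elim p)
    obtain R :: nat where R: "norm (fst p) + norm (snd p) < real R" using reals_Archimedean2 by blast
    have "norm (fst p) < real R" "norm (snd p) < real R"
      using R norm_ge_zero[of "fst p"] norm_ge_zero[of "snd p"] by linarith+
    then have "p \<in> ball 0 (real R) \<times> ball 0 (real R)" by (simp add: mem_Times_iff)
    then have "ennreal (2 * g p) = 0" using elim[rule_format, of R] by simp
    then have g: "g p = 0" using g0[of p] by (simp add: ennreal_eq_0_iff)
    have "max 0 (u (fst p - h) - u (fst p)) * max 0 (u (snd p) - u (snd p - h)) = 0"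
    proof (cases "fst p = snd p")
      case True then show ?thesis by (auto simp: max_def)
    next
      case False
      then have "K (fst p - snd p) \<noteq> 0" using K_pos[of "fst p - snd p"] by simp
      then have "gap u (\<lambda>x. u (x - h)) p = 0" using g by (simp add: g_def)
      then show ?thesis unfolding gap_def
        by (subst (asm) add_nonneg_eq_0_iff) (auto intro: mult_nonneg_nonneg)
    qed
    then show ?case by (subst ennreal_mult[symmetric]) auto
  qed
  then have "(\<integral>\<^sup>+p. ennreal (max 0 (u (fst p - h) - u (fst p))) * ennreal (max 0 (u (snd p) - u (snd p - h))) \<partial>(lborel \<Otimes>\<^sub>M lborel)) = 0"
    by (subst nn_integral_0_iff_AE) auto
  moreover have "(\<integral>\<^sup>+p. ennreal (max 0 (u (fst p - h) - u (fst p))) * ennreal (max 0 (u (snd p) - u (snd p - h))) \<partial>(lborel \<Otimes>\<^sub>M lborel))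
     = (\<integral>\<^sup>+x. ennreal (max 0 (u (x - h) - u x)) \<partial>lborel) * (\<integral>\<^sup>+y. ennreal (max 0 (u y - u (y - h))) \<partial>lborel)"
    by (subst lborel.nn_integral_fst[symmetric]) (auto simp: nn_integral_cmult nn_integral_multc)
  ultimately have "(\<integral>\<^sup>+x. ennreal (max 0 (u (x - h) - u x)) \<partial>lborel) = 0 \<or> (\<integral>\<^sup>+y. ennreal (max 0 (u y - u (y - h))) \<partial>lborel) = 0"
    by simp
  then have "(AE x in lborel. 0 \<le> u x - u (x - h)) \<or> (AE x in lborel. 0 \<le> u (x - h) - u x)"
  proof
    assume "(\<integral>\<^sup>+x. ennreal (max 0 (u (x - h) - u x)) \<partial>lborel) = 0"
    then have "AE x in lborel. ennreal (max 0 (u (x - h) - u x)) = 0" by (subst (asm) nn_integral_0_iff_AE) auto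
    then have "AE x in lborel. 0 \<le> u x - u (x - h)" by eventually_elim (auto simp: ennreal_eq_0_iff max_def split: if_splits)
    then show ?thesis ..
  next
    assume "(\<integral>\<^sup>+x. ennreal (max 0 (u x - u (x - h))) \<partial>lborel) = 0"
    then have "AE x in lborel. ennreal (max 0 (u x - u (x - h))) = 0" by (subst (asm) nn_integral_0_iff_AE) auto
    then have "AE x in lborel. 0 \<le> u (x - h) - u x" by eventually_elim (auto simp: ennreal_eq_0_iff max_def split: if_splits)
    then show ?thesis ..
  qed
  moreover have uh: "regular (\<lambda>x. u (x - h))"
  proof -
    have "enosc (\<lambda>x. u (x - h)) x = enosc u (x - h)" for x
      unfolding enosc_def by (subst nn_integral_translate[of _ "-h", symmetric]) auto
    then show ?thesis using u by (simp add: regular_def)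
  qed
  moreover have "regular (\<lambda>x. u x - u (x - h))" by (rule regular_dom[OF _ u uh, of _ 1]) auto
  moreover have "regular (\<lambda>x. u (x - h) - u x)" by (rule regular_dom[OF _ u uh, of _ 1]) auto
  ultimately have "(\<forall>x. 0 \<le> u x - u (x - h)) \<or> (\<forall>x. 0 \<le> u (x - h) - u x)"
    using regular_AE_nonneg by blast
  then show ?thesis by auto
qed

subsection \<open>One-dimensional symmetry\<close>

definition up :: "(real^2 \<Rightarrow> real) \<Rightarrow> (real^2) set" where
  "up u = {h. \<forall>x. u x \<le> u (x + h)}"

text \<open>Bounds on \<open>nosc u\<close> are not uniform along the sequence, so
  \<open>regular_holder\<close> does not give the limit directly. The averages \<open>U e\<close>
  inherit the inequalities and, for fixed \<open>e\<close>, are locally Lipschitz in the base point;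
  the limit in \<open>n\<close> is taken for them, and \<open>e\<close> tends to 0
  afterwards.\<close>

lemma closed_up:
  assumes u: "regular u"
  shows "closed (up u)"
  unfolding closed_sequential_limits
proof (intro allI impI, elim conjE)
  fix X l assume X: "\<forall>n. X n \<in> up u" and lim: "X \<longlonglongrightarrow> l"
  have [measurable]: "u \<in> borel_measurable borel" by (rule regular_measurable[OF u])
  define U where "U e x = (\<integral>z. u z * \<rho> e (z - x) \<partial>lborel)" for e x
  have Ushift: "U e x = (\<integral>z. u (x + z) * \<rho> e z \<partial>lborel)" for e x
    unfolding U_def by (subst integral_translate[of _ x, symmetric]) auto
  have int: "integrable lborel (\<lambda>z. u z * \<rho> e (z - x))" if e: "0 < e" for e x
  proof -
    obtain A where A: "tame A (\<lambda>z. \<rho> e (z - x))" using \<rho>_tame[OF e] tame_translate by blast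
    show ?thesis using tameD(2)[OF A] by (intro weighted_integrable[OF u, of _ A]) auto
  qed
  have int': "integrable lborel (\<lambda>z. u (x + z) * \<rho> e z)" if e: "0 < e" for e x
    using int[OF e, of x] integrable_translate[of "\<lambda>z. u z * \<rho> e (z - x)" x] by simp
  have Ule: "U e x \<le> U e (x + X n)" if e: "0 < e" for e x n
    unfolding Ushift
  proof (rule integral_mono[OF int'[OF e] int'[OF e]])
    fix z
    have "u (x + z) \<le> u (x + z + X n)" using X by (auto simp: up_def)
    then show "u (x + z) * \<rho> e z \<le> u (x + X n + z) * \<rho> e z" by (intro mult_right_mono) (auto simp: ac_simps)
  qed
  have Ucont: "(\<lambda>n. U e (x + X n)) \<longlonglongrightarrow> U e (x + l)" if e: "0 < e" for e x
  proof -
    obtain A where A: "tame A (\<rho> e)" using \<rho>_tame[OF e] by blast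
    define y where "y = x + l"
    define C where "C = (1 + norm y) powr (2 + s) * A"
    have ty: "tame C (\<lambda>z. \<rho> e (z - y))" unfolding C_def by (rule tame_translate[OF A])
    define I where "I = (\<integral>z. \<bar>u z\<bar> * w z \<partial>lborel)"
    have bnd: "\<bar>U e (y + h) - U e y\<bar> \<le> C * I * norm h" if h: "norm h \<le> 1" for h
    proof -
      have eq: "U e (y + h) - U e y = (\<integral>z. u z * \<rho> e (z - (y + h)) - u z * \<rho> e (z - y) \<partial>lborel)"
        unfolding U_def by (rule Bochner_Integration.integral_diff[OF int[OF e] int[OF e], symmetric])
      have "\<bar>U e (y + h) - U e y\<bar> \<le> (\<integral>z. \<bar>u z * \<rho> e (z - (y + h)) - u z * \<rho> e (z - y)\<bar> \<partial>lborel)"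
        unfolding eq by (rule integral_abs_bound)
      also have "\<dots> \<le> (\<integral>z. C * norm h * (\<bar>u z\<bar> * w z) \<partial>lborel)"
      proof (rule integral_mono)
        show "integrable lborel (\<lambda>z. \<bar>u z * \<rho> e (z - (y + h)) - u z * \<rho> e (z - y)\<bar>)"
          by (intro integrable_abs Bochner_Integration.integrable_diff int e)
        show "integrable lborel (\<lambda>z. C * norm h * (\<bar>u z\<bar> * w z))" by (intro integrable_mult_right regular_weighted[OF u])
        fix z
        have "\<bar>\<rho> e (z - y) - \<rho> e (z + - h - y)\<bar> \<le> C * w z * norm (- h)" by (rule tameD(3)[OF ty]) (use h in simp)
        then have "\<bar>u z\<bar> * \<bar>\<rho> e (z - (y + h)) - \<rho> e (z - y)\<bar> \<le> \<bar>u z\<bar> * (C * w z * norm h)"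
          by (intro mult_left_mono) (auto simp: abs_minus_commute algebra_simps)
        then show "\<bar>u z * \<rho> e (z - (y + h)) - u z * \<rho> e (z - y)\<bar> \<le> C * norm h * (\<bar>u z\<bar> * w z)"
          by (simp add: right_diff_distrib[symmetric] abs_mult mult_ac)
      qed
      also have "\<dots> = C * I * norm h" by (simp add: I_def)
      finally show ?thesis .
    qed
    have Xl: "(\<lambda>n. X n - l) \<longlonglongrightarrow> 0" using lim by (simp add: LIM_zero_iff)
    have "(\<lambda>n. U e (y + (X n - l)) - U e y) \<longlonglongrightarrow> 0"
    proof (rule Lim_null_comparison)
      show "(\<lambda>n. C * I * norm (X n - l)) \<longlonglongrightarrow> 0" by (intro tendsto_mult_right_zero tendsto_norm_zero Xl)
      have "\<forall>\<^sub>F n in sequentially. norm (X n - l) < 1" using tendsto_norm_zero[OF Xl] by (rule order_tendstoD(2)) simp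
      then show "\<forall>\<^sub>F n in sequentially. norm (U e (y + (X n - l)) - U e y) \<le> C * I * norm (X n - l)"
        by eventually_elim (use bnd in \<open>simp add: less_imp_le\<close>)
    qed
    then show ?thesis by (simp add: LIM_zero_iff y_def algebra_simps)
  qed
  have Ulim: "(\<lambda>n. U (1 / real (Suc n)) x) \<longlonglongrightarrow> c0 * u x" for x
  proof -
    have z: "regular (\<lambda>_. 0)" by (simp add: regular_def enosc_def)
    have "(\<lambda>n. moll_form (\<lambda>_. 0) u (1 / real (Suc n)) x) \<longlonglongrightarrow> c0 * (frac_lap s (\<lambda>_. 0) x + u x)"
      by (rule moll_form_limit[OF z u _ inverse_Suc_tendsto]) simp
    then show ?thesis by (simp add: moll_form_def frac_lap_def U_def)
  qed
  have "u x \<le> u (x + l)" for x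
  proof -
    have "U e x \<le> U e (x + l)" if "0 < e" for e
      by (rule LIMSEQ_le_const[OF Ucont[OF that]]) (use Ule[OF that] in blast)
    then have "c0 * u x \<le> c0 * u (x + l)" by (intro LIMSEQ_le[OF Ulim Ulim]) auto
    then show ?thesis using c0_pos by simp
  qed
  then show "l \<in> up u" by (simp add: up_def)
qed

text \<open>A circle is connected and is covered by two nonempty closed sets, the upward directions
  \<open>P\<close> and their reflection \<open>Q\<close>. They must meet, and at a common point
  \<open>u\<close> is monotone both ways.\<close>

lemma up_periods:
  assumes u: "regular u" and total: "\<And>h. h \<in> up u \<or> - h \<in> up u" and r: "0 < r"
  shows "\<exists>h. norm h = r \<and> h \<in> up u \<and> - h \<in> up u"
proof (rule ccontr)
  assume neg: "\<not> ?thesis"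
  define P where "P = up u \<inter> sphere 0 r"
  define Q where "Q = uminus ` up u \<inter> sphere 0 r"
  have "closed P" unfolding P_def by (intro closed_Int closed_up[OF u] closed_sphere)
  moreover have "closed Q" unfolding Q_def by (intro closed_Int closed_negations closed_up[OF u] closed_sphere)
  moreover have "sphere 0 r \<subseteq> P \<union> Q"
  proof
    fix x assume "x \<in> sphere (0::real^2) r"
    then show "x \<in> P \<union> Q" using total[of x] by (auto simp: P_def Q_def image_iff) (metis minus_minus)
  qed
  moreover have "P \<inter> Q \<inter> sphere 0 r = {}"
    using neg by (auto simp: P_def Q_def)
  moreover have "connected (sphere (0::real^2) r)" by (rule connected_sphere) simp
  ultimately have "P \<inter> sphere 0 r = {} \<or> Q \<inter> sphere 0 r = {}" unfolding connected_closed by blast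
  moreover obtain a :: "real^2" where a: "norm a = r" using vector_choose_size[of r] r by auto
  then have "P \<inter> sphere 0 r \<noteq> {}" "Q \<inter> sphere 0 r \<noteq> {}"
  proof -
    show "P \<inter> sphere 0 r \<noteq> {}" using total[of a] a by (auto simp: P_def)
    show "Q \<inter> sphere 0 r \<noteq> {}"
    proof (cases "a \<in> up u")
      case True then have "- a \<in> Q" using a by (auto simp: Q_def)
      then show ?thesis using a by (auto simp: Q_def)
    next
      case False then have "- a \<in> up u" using total[of a] by blast
      then have "a \<in> Q" using a by (auto simp: Q_def image_iff intro!: bexI[of _ "- a"])
      then show ?thesis using a by (auto simp: Q_def)
    qed
  qed
  ultimately show False by blast
qed

text \<open>The periods \<open>Z\<close> are closed, contain integer multiples of their members, and
  have members of length \<open>1 / Suc n\<close> for every \<open>n\<close>. Multiples of shorter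
  and shorter periods fill, in the limit, the line spanned by a limit \<open>e\<close> of their
  directions, and \<open>u\<close> is constant along it.\<close>

lemma one_dimensional:
  assumes u: "regular u" and total: "\<And>h. h \<in> up u \<or> - h \<in> up u"
  shows "\<exists>ubar :: real \<Rightarrow> real. \<exists>\<omega> :: real^2. norm \<omega> = 1 \<and> (\<forall>x. u x = ubar (\<omega> \<bullet> x))"
proof -
  define Z where "Z = {h. \<forall>x. u (x + h) = u x}"
  have Zup: "h \<in> Z \<longleftrightarrow> h \<in> up u \<and> - h \<in> up u" for h
  proof
    assume h: "h \<in> Z"
    have "u (x + - h) = u x" for x
    proof -
      have "u ((x + - h) + h) = u (x + - h)" using h unfolding Z_def by blast
      then show ?thesis by simp
    qed
    then show "h \<in> up u \<and> - h \<in> up u" using h by (auto simp: Z_def up_def)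
  next
    assume h: "h \<in> up u \<and> - h \<in> up u"
    have "u (x + h) \<le> u x" for x
    proof -
      have "u (x + h) \<le> u (x + h + - h)" using h by (simp only: up_def mem_Collect_eq)
      then show ?thesis by simp
    qed
    then show "h \<in> Z" using h by (auto simp: Z_def up_def intro: antisym)
  qed
  have closedZ: "closed Z"
  proof -
    have "Z = up u \<inter> uminus ` up u" using Zup by (force simp: image_iff)
    then show ?thesis using closed_up[OF u] closed_negations[OF closed_up[OF u]] by auto
  qed
  have Zneg: "- h \<in> Z" if "h \<in> Z" for h using that Zup[of h] Zup[of "- h"] by simp
  have Znat: "real n *\<^sub>R h \<in> Z" if h: "h \<in> Z" for n h
  proof (induction n)
    case 0 show ?case by (simp add: Z_def)
  next
    case (Suc n)
    have "u (x + real (Suc n) *\<^sub>R h) = u x" for x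
    proof -
      have "u (x + real (Suc n) *\<^sub>R h) = u ((x + real n *\<^sub>R h) + h)" by (simp add: algebra_simps)
      also have "\<dots> = u (x + real n *\<^sub>R h)" using h by (simp add: Z_def)
      also have "\<dots> = u x" using Suc by (simp add: Z_def)
      finally show ?thesis .
    qed
    then show ?case by (simp add: Z_def)
  qed
  have Zint: "real_of_int i *\<^sub>R h \<in> Z" if h: "h \<in> Z" for i h
  proof (cases "0 \<le> i")
    case True then show ?thesis using Znat[OF h, of "nat i"] by simp
  next
    case False then show ?thesis using Zneg[OF Znat[OF h, of "nat (- i)"]] by simp
  qed
  have "\<exists>h. norm h = 1 / real (Suc n) \<and> h \<in> Z" for n
    using up_periods[OF u total, of "1 / real (Suc n)"] Zup by auto
  then obtain H where H: "\<And>n. norm (H n) = 1 / real (Suc n)" "\<And>n. H n \<in> Z" by metis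
  define d where "d n = real (Suc n) *\<^sub>R H n" for n
  have "d n \<in> sphere 0 1" for n using H(1)[of n] by (simp add: d_def)
  then obtain e f where e: "e \<in> sphere 0 1" "strict_mono f" "(d \<circ> f) \<longlonglongrightarrow> e"
    using compact_sphere[of "0::real^2" 1] unfolding compact_def by blast
  have line: "a *\<^sub>R e \<in> Z" for a :: real
  proof -
    \<comment> \<open>Rounding makes \<open>c n *\<^sub>R d (f n)\<close> an integer multiple of the
      period \<open>H (f n)\<close>, and \<open>c n\<close> differs from \<open>a\<close> by at most
      the length of that period.\<close>
    define c where "c n = real_of_int \<lfloor>a * real (Suc (f n))\<rfloor> / real (Suc (f n))" for n
    have f0: "(\<lambda>n. 1 / real (Suc (f n))) \<longlonglongrightarrow> 0"
      using LIMSEQ_subseq_LIMSEQ[OF inverse_Suc_tendsto e(2)] by (simp add: o_def)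
    have "(\<lambda>n. c n - a) \<longlonglongrightarrow> 0"
    proof (rule Lim_null_comparison[OF _ f0], rule always_eventually, rule allI)
      fix n
      have p: "0 < real (Suc (f n))" by simp
      have "\<bar>real_of_int \<lfloor>a * real (Suc (f n))\<rfloor> - a * real (Suc (f n))\<bar> \<le> 1" by linarith
      moreover have "c n - a = (real_of_int \<lfloor>a * real (Suc (f n))\<rfloor> - a * real (Suc (f n))) / real (Suc (f n))"
        using p by (simp add: c_def diff_divide_distrib)
      ultimately show "norm (c n - a) \<le> 1 / real (Suc (f n))" by (simp add: divide_right_mono)
    qed
    then have "c \<longlonglongrightarrow> a" by (simp add: LIM_zero_iff)
    define q where "q n = c n *\<^sub>R (d \<circ> f) n" for n
    have qlim: "q \<longlonglongrightarrow> a *\<^sub>R e" unfolding q_def by (rule tendsto_scaleR[OF \<open>c \<longlonglongrightarrow> a\<close> e(3)])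
    have qZ: "q n \<in> Z" for n
    proof -
      have "c n *\<^sub>R (d \<circ> f) n = real_of_int \<lfloor>a * real (Suc (f n))\<rfloor> *\<^sub>R H (f n)" by (simp add: c_def d_def)
      then show ?thesis using Zint[OF H(2)] by (simp add: q_def)
    qed
    show ?thesis by (rule closed_sequentially[OF closedZ qZ qlim])
  qed
  \<comment> \<open>The vector \<open>e\<close> turned by a right angle, so that
    \<open>\<omega>\<close> and \<open>e\<close> form an orthonormal basis.\<close>
  define \<omega> :: "real^2" where "\<omega> = (\<chi> i. if i = 1 then - e $ 2 else e $ 1)"
  have n: "(e $ 1)\<^sup>2 + (e $ 2)\<^sup>2 = 1" using e(1) by (simp add: norm_eq_1 inner_vec_def sum_2 power2_eq_square)
  have n\<omega>: "norm \<omega> = 1" using n by (simp add: norm_eq_1 inner_vec_def sum_2 power2_eq_square \<omega>_def add.commute)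
  have dec: "x = (\<omega> \<bullet> x) *\<^sub>R \<omega> + (e \<bullet> x) *\<^sub>R e" for x
  proof -
    have "x $ 1 = ((e $ 1)\<^sup>2 + (e $ 2)\<^sup>2) * x $ 1" "x $ 2 = ((e $ 1)\<^sup>2 + (e $ 2)\<^sup>2) * x $ 2" using n by simp_all
    then show ?thesis
      by (simp add: vec_eq_iff forall_2 inner_vec_def sum_2 \<omega>_def power2_eq_square algebra_simps)
  qed
  have "u x = u ((\<omega> \<bullet> x) *\<^sub>R \<omega>)" for x
  proof -
    have "u x = u ((\<omega> \<bullet> x) *\<^sub>R \<omega> + (e \<bullet> x) *\<^sub>R e)" using dec[of x] by simp
    also have "\<dots> = u ((\<omega> \<bullet> x) *\<^sub>R \<omega>)" using line[of "e \<bullet> x"] by (simp add: Z_def)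
    finally show ?thesis .
  qed
  then show ?thesis using n\<omega> by (intro exI[of _ "\<lambda>t. u (t *\<^sub>R \<omega>)"] exI[of _ \<omega>]) auto
qed

end

theorem theorem1p3:
  fixes s :: real and u :: "real^2 \<Rightarrow> real"
  assumes "0 < s" "s < 1"
    and "is_solution s u"
    and "is_minimizer s u"
  shows "\<exists>ubar :: real \<Rightarrow> real. \<exists>\<omega> :: real^2. norm \<omega> = 1 \<and> (\<forall>x. u x = ubar (\<omega> \<bullet> x))"
proof -
  interpret fractional_order s by standard (use assms in auto)
  have "h \<in> up u \<or> - h \<in> up u" for h
  proof -
    consider "\<forall>x. u x \<le> u (x - - h)" | "\<forall>x. u (x - - h) \<le> u x"
      using sign_dichotomy[OF assms(3,4), of "- h"] by blast
    then show ?thesis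
    proof cases
      case 1 then show ?thesis by (simp add: up_def)
    next
      case 2
      have "u x \<le> u (x + - h)" for x using 2[rule_format, of "x + - h"] by simp
      then show ?thesis by (simp add: up_def)
    qed
  qed
  then show ?thesis by (rule one_dimensional[OF solution_regular[OF assms(3)]])
qed

end
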